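(* Let $(\mathfrak{M},\Phi)$ be a discrete quantum process. Then there exist a Hilbert space $\mathcal{H}$ and a faithful normal representation $\pi:\mathfrak{M}\to\mathfrak{B}(\mathcal{H})$ such that, after identifying $\mathfrak{M}$ with $\pi(\mathfrak{M})$, the process has a dilation; that is, the quantum process $(\pi(\mathfrak{M}),\Psi)$, where $\Psi(\pi(x))=\pi(\Phi(x))$ for $x\in\mathfrak{M}$ and $\pi(\mathfrak{M})$ acts on $\mathcal{H}$, has a dilation $(\mathfrak{R},\Theta,\mathcal{K},z)$.
   Context: A discrete quantum process is a pair $(\mathfrak{M},\Phi)$ consisting of a von Neumann algebra $\mathfrak{M}$ and a normal unital completely positive map $\Phi:\mathfrak{M}\to\mathfrak{M}$. If $\mathfrak{M}$ acts on the Hilbert space $\mathcal{H}$, a dilation of $(\mathfrak{M},\Phi)$ is a quadruple $(\mathfrak{R},\Theta,\mathcal{K},z)$ where $(\mathfrak{R},\Theta)$ is a quantum process with $\mathfrak{R}$ acting on a Hilbert space $\mathcal{K}$, $\Theta$ is a *-endomorphism of $\mathfrak{R}$, and $z:\mathcal{H}\to\mathcal{K}$ is an isometric embedding such that: (i) $z\mathfrak{M}z^*\subset\mathfrak{R}$ and $z^*\mathfrak{R}z\subset\mathfrak{M}$; (ii) $\Phi^n(a)=z^*\Theta^n(zaz^* )z$ for all $a\in\mathfrak{M}$, $n\in\mathbb{N}$; (iii) $z^*\Theta^n(X)z=\Phi^n(z^*Xz)$ for all $X\in\mathfrak{R}$, $n\in\mathbb{N}$. *)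

theory Defs
  imports "HOL-Analysis.Analysis" "HOL-Library.FuncSet" "HOL-Library.Nonpos_Ints"
    "HOL-Algebra.Module"
begin

section \<open>Complex Hilbert spaces\<close>

definition complex_ring :: "complex ring" where
  "complex_ring = \<lparr>carrier = UNIV, monoid.mult = (*), one = 1, zero = 0, add = (+)\<rparr>"

lemma cring_complex_ring: "cring complex_ring"
proof (rule cringI)
  show "abelian_group complex_ring"
  proof (rule abelian_groupI)
    fix x :: complex
    show "\<exists>y\<in>carrier complex_ring. y \<oplus>\<^bsub>complex_ring\<^esub> x = \<zero>\<^bsub>complex_ring\<^esub>"
      by (rule bexI[of _ "- x"]) (simp_all add: complex_ring_def)
  qed (simp_all add: complex_ring_def)
  show "comm_monoid complex_ring"
    by (rule comm_monoidI) (simp_all add: complex_ring_def)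
qed (simp_all add: complex_ring_def algebra_simps)

text \<open>
  A Hilbert space is a module over the complex field (the multiplicative fields of the
  underlying ring record play no role) with an inner product that is linear in its
  second argument. Spaces have explicit carriers, so that one can quantify
  existentially over them.
\<close>

record 'h hilbert = "(complex, 'h) module" +
  ip :: "'h \<Rightarrow> 'h \<Rightarrow> complex"

definition hnorm :: "'h hilbert \<Rightarrow> 'h \<Rightarrow> real" where
  "hnorm H x = sqrt (Re (ip H x x))"

locale hilbert_space = Module.module complex_ring H
  for H :: "'h hilbert" (structure) +
  assumes ip_add: "\<lbrakk>w \<in> carrier H; x \<in> carrier H; y \<in> carrier H\<rbrakk>
      \<Longrightarrow> ip H w (x \<oplus> y) = ip H w x + ip H w y"
    and ip_smult: "\<lbrakk>w \<in> carrier H; x \<in> carrier H\<rbrakk> \<Longrightarrow> ip H w (c \<odot> x) = c * ip H w x"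
    and ip_cnj: "\<lbrakk>x \<in> carrier H; y \<in> carrier H\<rbrakk> \<Longrightarrow> ip H x y = cnj (ip H y x)"
    and ip_nonneg: "x \<in> carrier H \<Longrightarrow> 0 \<le> Re (ip H x x)"
    and ip_definite: "\<lbrakk>x \<in> carrier H; ip H x x = 0\<rbrakk> \<Longrightarrow> x = \<zero>"
    and complete: "\<lbrakk>\<And>n. s n \<in> carrier H;
        \<And>e. 0 < e \<Longrightarrow> \<exists>N. \<forall>m\<ge>N. \<forall>n\<ge>N. hnorm H (s m \<ominus> s n) < e\<rbrakk>
      \<Longrightarrow> \<exists>x\<in>carrier H. (\<lambda>n. hnorm H (s n \<ominus> x)) \<longlonglongrightarrow> 0"


section \<open>Bounded operators\<close>

text \<open>
  Operators are extensional functions on the carrier, so that equality of functions is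
  equality of operators.
\<close>

definition bounded_ops :: "'h hilbert \<Rightarrow> 'k hilbert \<Rightarrow> ('h \<Rightarrow> 'k) set" where
  "bounded_ops H K = {T \<in> carrier H \<rightarrow>\<^sub>E carrier K.
     (\<forall>x\<in>carrier H. \<forall>y\<in>carrier H. T (x \<oplus>\<^bsub>H\<^esub> y) = T x \<oplus>\<^bsub>K\<^esub> T y) \<and>
     (\<forall>c. \<forall>x\<in>carrier H. T (c \<odot>\<^bsub>H\<^esub> x) = c \<odot>\<^bsub>K\<^esub> T x) \<and>
     (\<exists>B. \<forall>x\<in>carrier H. hnorm K (T x) \<le> B * hnorm H x)}"

definition adj :: "'h hilbert \<Rightarrow> 'k hilbert \<Rightarrow> ('h \<Rightarrow> 'k) \<Rightarrow> ('k \<Rightarrow> 'h)" where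
  "adj H K T = (THE S. S \<in> bounded_ops K H \<and>
     (\<forall>x\<in>carrier H. \<forall>y\<in>carrier K. ip H (S y) x = ip K y (T x)))"

definition op_one :: "'h hilbert \<Rightarrow> 'h \<Rightarrow> 'h" where
  "op_one H = (\<lambda>x\<in>carrier H. x)"

definition op_mult :: "'h hilbert \<Rightarrow> ('h \<Rightarrow> 'h) \<Rightarrow> ('h \<Rightarrow> 'h) \<Rightarrow> 'h \<Rightarrow> 'h" where
  "op_mult H S T = compose (carrier H) S T"

definition op_add :: "'h hilbert \<Rightarrow> ('h \<Rightarrow> 'h) \<Rightarrow> ('h \<Rightarrow> 'h) \<Rightarrow> 'h \<Rightarrow> 'h" where
  "op_add H S T = (\<lambda>x\<in>carrier H. S x \<oplus>\<^bsub>H\<^esub> T x)"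

definition op_smult :: "'h hilbert \<Rightarrow> complex \<Rightarrow> ('h \<Rightarrow> 'h) \<Rightarrow> 'h \<Rightarrow> 'h" where
  "op_smult H c T = (\<lambda>x\<in>carrier H. c \<odot>\<^bsub>H\<^esub> T x)"

definition self_adjoint :: "'h hilbert \<Rightarrow> ('h \<Rightarrow> 'h) \<Rightarrow> bool" where
  "self_adjoint H T \<longleftrightarrow> T \<in> bounded_ops H H \<and> adj H H T = T"

definition op_le :: "'h hilbert \<Rightarrow> ('h \<Rightarrow> 'h) \<Rightarrow> ('h \<Rightarrow> 'h) \<Rightarrow> bool" where
  "op_le H S T \<longleftrightarrow> (\<forall>x\<in>carrier H. ip H x (T x) - ip H x (S x) \<in> \<real>\<^sub>\<ge>\<^sub>0)"


section \<open>Von Neumann algebras and their maps\<close>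

definition commutant :: "'h hilbert \<Rightarrow> ('h \<Rightarrow> 'h) set \<Rightarrow> ('h \<Rightarrow> 'h) set" where
  "commutant H S = {T \<in> bounded_ops H H. \<forall>A\<in>S. op_mult H T A = op_mult H A T}"

text \<open>Being a commutant already makes \<open>M\<close> a subalgebra containing the identity of \<open>H\<close>.\<close>

definition von_neumann_algebra :: "'h hilbert \<Rightarrow> ('h \<Rightarrow> 'h) set \<Rightarrow> bool" where
  "von_neumann_algebra H M \<longleftrightarrow> hilbert_space H \<and> M \<subseteq> bounded_ops H H \<and>
     (\<forall>T\<in>M. adj H H T \<in> M) \<and> commutant H (commutant H M) = M"

definition linear_map ::
  "'h hilbert \<Rightarrow> ('h \<Rightarrow> 'h) set \<Rightarrow> 'k hilbert \<Rightarrow> ('k \<Rightarrow> 'k) set \<Rightarrow> (('h \<Rightarrow> 'h) \<Rightarrow> ('k \<Rightarrow> 'k)) \<Rightarrow> bool" where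
  "linear_map H M K N \<Phi> \<longleftrightarrow> \<Phi> \<in> M \<rightarrow> N \<and>
     (\<forall>a\<in>M. \<forall>b\<in>M. \<Phi> (op_add H a b) = op_add K (\<Phi> a) (\<Phi> b)) \<and>
     (\<forall>c. \<forall>a\<in>M. \<Phi> (op_smult H c a) = op_smult K c (\<Phi> a))"

text \<open>Positivity of the \<open>n \<times> n\<close> operator matrix \<open>a\<close>, acting on the \<open>n\<close>-fold direct sum of \<open>H\<close>.\<close>

definition positive_matrix :: "'h hilbert \<Rightarrow> nat \<Rightarrow> (nat \<Rightarrow> nat \<Rightarrow> 'h \<Rightarrow> 'h) \<Rightarrow> bool" where
  "positive_matrix H n a \<longleftrightarrow> (\<forall>\<xi>. (\<forall>i<n. \<xi> i \<in> carrier H) \<longrightarrow>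
     (\<Sum>i<n. \<Sum>j<n. ip H (\<xi> i) (a i j (\<xi> j))) \<in> \<real>\<^sub>\<ge>\<^sub>0)"

definition completely_positive ::
  "'h hilbert \<Rightarrow> ('h \<Rightarrow> 'h) set \<Rightarrow> 'k hilbert \<Rightarrow> ('k \<Rightarrow> 'k) set \<Rightarrow> (('h \<Rightarrow> 'h) \<Rightarrow> ('k \<Rightarrow> 'k)) \<Rightarrow> bool" where
  "completely_positive H M K N \<Phi> \<longleftrightarrow> linear_map H M K N \<Phi> \<and>
     (\<forall>n a. (\<forall>i<n. \<forall>j<n. a i j \<in> M) \<longrightarrow> positive_matrix H n a \<longrightarrow>
        positive_matrix K n (\<lambda>i j. \<Phi> (a i j)))"

definition op_lub :: "'h hilbert \<Rightarrow> ('h \<Rightarrow> 'h) set \<Rightarrow> ('h \<Rightarrow> 'h) set \<Rightarrow> ('h \<Rightarrow> 'h) \<Rightarrow> bool" where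
  "op_lub H M D s \<longleftrightarrow> s \<in> M \<and> self_adjoint H s \<and> (\<forall>a\<in>D. op_le H a s) \<and>
     (\<forall>b\<in>M. self_adjoint H b \<longrightarrow> (\<forall>a\<in>D. op_le H a b) \<longrightarrow> op_le H s b)"

text \<open>
  A positive map is normal if it preserves the suprema of bounded increasing nets of
  self-adjoint elements. Such nets are represented by their ranges, which are the
  upward directed sets that are bounded above.
\<close>

definition normal_map ::
  "'h hilbert \<Rightarrow> ('h \<Rightarrow> 'h) set \<Rightarrow> 'k hilbert \<Rightarrow> ('k \<Rightarrow> 'k) set \<Rightarrow> (('h \<Rightarrow> 'h) \<Rightarrow> ('k \<Rightarrow> 'k)) \<Rightarrow> bool" where
  "normal_map H M K N \<Phi> \<longleftrightarrow>
     (\<forall>D s. D \<noteq> {} \<longrightarrow> D \<subseteq> {a \<in> M. self_adjoint H a} \<longrightarrow>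
        (\<forall>a\<in>D. \<forall>b\<in>D. \<exists>c\<in>D. op_le H a c \<and> op_le H b c) \<longrightarrow>
        op_lub H M D s \<longrightarrow> op_lub K N (\<Phi> ` D) (\<Phi> s))"

definition star_hom ::
  "'h hilbert \<Rightarrow> ('h \<Rightarrow> 'h) set \<Rightarrow> 'k hilbert \<Rightarrow> ('k \<Rightarrow> 'k) set \<Rightarrow> (('h \<Rightarrow> 'h) \<Rightarrow> ('k \<Rightarrow> 'k)) \<Rightarrow> bool" where
  "star_hom H M K N \<Phi> \<longleftrightarrow> linear_map H M K N \<Phi> \<and>
     (\<forall>a\<in>M. \<forall>b\<in>M. \<Phi> (op_mult H a b) = op_mult K (\<Phi> a) (\<Phi> b)) \<and>
     (\<forall>a\<in>M. \<Phi> (adj H H a) = adj K K (\<Phi> a))"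

definition faithful_normal_representation ::
  "'h hilbert \<Rightarrow> ('h \<Rightarrow> 'h) set \<Rightarrow> 'k hilbert \<Rightarrow> (('h \<Rightarrow> 'h) \<Rightarrow> ('k \<Rightarrow> 'k)) \<Rightarrow> bool" where
  "faithful_normal_representation H M K \<pi> \<longleftrightarrow> hilbert_space K \<and>
     star_hom H M K (bounded_ops K K) \<pi> \<and> \<pi> (op_one H) = op_one K \<and>
     inj_on \<pi> M \<and> normal_map H M K (bounded_ops K K) \<pi>"


section \<open>Quantum processes and dilations\<close>

definition quantum_process ::
  "'h hilbert \<Rightarrow> ('h \<Rightarrow> 'h) set \<Rightarrow> (('h \<Rightarrow> 'h) \<Rightarrow> ('h \<Rightarrow> 'h)) \<Rightarrow> bool" where
  "quantum_process H M \<Phi> \<longleftrightarrow> von_neumann_algebra H M \<and> completely_positive H M H M \<Phi> \<and>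
     \<Phi> (op_one H) = op_one H \<and> normal_map H M H M \<Phi>"

definition isometric_embedding :: "'h hilbert \<Rightarrow> 'k hilbert \<Rightarrow> ('h \<Rightarrow> 'k) \<Rightarrow> bool" where
  "isometric_embedding H K z \<longleftrightarrow> z \<in> bounded_ops H K \<and>
     (\<forall>x\<in>carrier H. hnorm K (z x) = hnorm H x)"

text \<open>\<open>lift_op H K z a\<close> is \<open>z a z*\<close> and \<open>compress_op H K z X\<close> is \<open>z* X z\<close>.\<close>

definition lift_op :: "'h hilbert \<Rightarrow> 'k hilbert \<Rightarrow> ('h \<Rightarrow> 'k) \<Rightarrow> ('h \<Rightarrow> 'h) \<Rightarrow> ('k \<Rightarrow> 'k)" where
  "lift_op H K z a = compose (carrier K) z (compose (carrier K) a (adj H K z))"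

definition compress_op :: "'h hilbert \<Rightarrow> 'k hilbert \<Rightarrow> ('h \<Rightarrow> 'k) \<Rightarrow> ('k \<Rightarrow> 'k) \<Rightarrow> ('h \<Rightarrow> 'h)" where
  "compress_op H K z X = compose (carrier H) (adj H K z) (compose (carrier H) X z)"

definition dilation ::
  "'h hilbert \<Rightarrow> ('h \<Rightarrow> 'h) set \<Rightarrow> (('h \<Rightarrow> 'h) \<Rightarrow> ('h \<Rightarrow> 'h)) \<Rightarrow>
   ('k \<Rightarrow> 'k) set \<Rightarrow> (('k \<Rightarrow> 'k) \<Rightarrow> ('k \<Rightarrow> 'k)) \<Rightarrow> 'k hilbert \<Rightarrow> ('h \<Rightarrow> 'k) \<Rightarrow> bool" where
  "dilation H M \<Phi> R \<Theta> K z \<longleftrightarrow>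
     quantum_process K R \<Theta> \<and> star_hom K R K R \<Theta> \<and> isometric_embedding H K z \<and>
     lift_op H K z ` M \<subseteq> R \<and> compress_op H K z ` R \<subseteq> M \<and>
     (\<forall>a\<in>M. \<forall>n. (\<Phi> ^^ n) a = compress_op H K z ((\<Theta> ^^ n) (lift_op H K z a))) \<and>
     (\<forall>X\<in>R. \<forall>n. compress_op H K z ((\<Theta> ^^ n) X) = (\<Phi> ^^ n) (compress_op H K z X))"

text \<open>
  In HOL an existential statement about Hilbert spaces has to fix the type of their
  vectors. For an algebra acting on a space with vectors in \<open>'a\<close> the following type is
  large enough: up to isomorphism it carries every Hilbert space whose Hilbert dimension
  is at most the cardinality of the infinite type \<open>('a \<Rightarrow> 'a) list \<times> 'a\<close>, in particular the
  spaces obtained by finite or countable iteration of the GNS and Stinespring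
  constructions.
\<close>

type_synonym 'a large = "('a \<Rightarrow> 'a) list \<times> 'a \<Rightarrow> complex"

end

(* Let L_0 = H0 and let L_(n+1) be the Stinespring space of Phi acting on L_n, spanned by the
   vectors a (x) x with a in M and x in L_n. On the direct sum H of the L_n the algebra M acts
   by left multiplication, pi say, and the shift V, x |-> 1 (x) x from L_n to L_(n+1), is an
   isometry with V* pi(a) V = pi(Phi(a)). Since H contains L_0 and normal representations are
   quasi-contained in the defining one, pi(M) is again a von Neumann algebra.

   Extend V to a unitary U on a larger space K, let R be the von Neumann algebra generated by all
   U^(-n) pi(M) U^n, and let Theta be conjugation by U. The compression to H of a product of
   generators reduces to an element of pi(M) by cancelling factors V* a V = pi(Phi(..)); lifting
   the commutant of pi(M) into the commutant of R extends this to all of R. The two dilation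
   identities follow from U z = z V.

   All Hilbert spaces are built from positive definite kernels, that is, from the Gram matrix of
   a total family; this also keeps H and K inside the prescribed type. *)

theory Submission
  imports Defs
begin

text \<open>On the given space \<open>\<Phi>\<close> need not have the form
  \<open>V\<^sup>* a V\<close> with a single isometry \<open>V\<close>. One Stinespring step
  supplies such a \<open>V\<close>, but into a different space; summing over all levels makes it a
  map of one space into itself, and this is why the representation has to be changed. Conjugation by
  an isometry is in general multiplicative only if the isometry is onto, hence the passage to a
  unitary.

  Most of the work comes from the definition of the algebras as bicommutants. For the image of
  \<open>M\<close> under \<open>\<pi>\<close>, intertwiners from the original space have to be total
  in the new one; this is a Radon-Nikodym argument for vector functionals, in which maximal elements
  of the unit interval stand in for support and comparison projections. For \<open>R\<close>,
  compressing products of generators says nothing yet about the other elements of a bicommutant, so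
  commuting operators are lifted instead, and the difficulty is to bound the lift uniformly over all
  finite combinations.

  An infinite index type absorbs a product with \<open>nat\<close>, so the unitary extension stays
  in the same type.\<close>

lemma complex_ring_simps [simp]:
  "carrier complex_ring = UNIV" "add complex_ring = (+)" "monoid.mult complex_ring = (*)"
  "one complex_ring = 1" "zero complex_ring = 0"
  by (simp_all add: complex_ring_def)

text \<open>Discriminant argument, with \<open>t\<close> along \<open>- cnj b\<close>. It yields
  every Cauchy-Schwarz inequality below, for vectors, positive operators and kernels, and with
  \<open>a = 0\<close> it makes a first variation vanish.\<close>

lemma quadratic_nonneg_imp_bound:
  fixes a c :: real and b :: complex
  assumes q: "\<And>t. 0 \<le> a + 2 * Re (t * b) + (cmod t)\<^sup>2 * c" and "0 \<le> c"
  shows "(cmod b)\<^sup>2 \<le> a * c"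
proof (cases "c = 0")
  case True
  have "cmod b = 0"
  proof (rule ccontr)
    assume "cmod b \<noteq> 0"
    then have p: "0 < (cmod b)\<^sup>2" by simp
    \<comment> \<open>For \<open>c = 0\<close> the expression is affine in \<open>t\<close>; this
      multiple of \<open>- cnj b\<close> brings it down to
      \<open>a - 2 * (\<bar>a\<bar> + 1) < 0\<close>.\<close>
    define s where "s = (\<bar>a\<bar> + 1) / (cmod b)\<^sup>2"
    have "Re (of_real (- s) * cnj b * b) = - s * (cmod b)\<^sup>2"
      by (simp add: cmod_power2) (simp add: algebra_simps power2_eq_square)
    then have "0 \<le> a + 2 * (- s * (cmod b)\<^sup>2)"
      using q[of "of_real (- s) * cnj b"] True by simp
    moreover have "s * (cmod b)\<^sup>2 = \<bar>a\<bar> + 1" using p by (simp add: s_def)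
    ultimately show False by (simp add: mult_minus_left)
  qed
  then show ?thesis using True by simp
next
  case False
  then have c: "0 < c" using assms by simp
  have 1: "Re (of_real (- 1 / c) * cnj b * b) = - (cmod b)\<^sup>2 / c"
    using c by (simp add: cmod_power2) (simp add: power2_eq_square field_simps)
  have 2: "(cmod (of_real (- 1 / c) * cnj b))\<^sup>2 * c = (cmod b)\<^sup>2 / c"
    using c by (simp add: norm_mult power_mult_distrib power2_eq_square field_simps norm_divide)
  have "0 \<le> a - (cmod b)\<^sup>2 / c"
    using q[of "of_real (- 1 / c) * cnj b"] unfolding 1 2 by linarith
  then show ?thesis using c by (simp add: field_simps)
qed

subsection \<open>Inner products\<close>

text \<open>Completeness is left out so that the calculus is available for a kernel space before
  that space is known to be complete.\<close>

locale inner_product_space = Module.module complex_ring H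
  for H :: "'h hilbert" (structure) +
  assumes ip_add: "\<lbrakk>w \<in> carrier H; x \<in> carrier H; y \<in> carrier H\<rbrakk>
      \<Longrightarrow> ip H w (x \<oplus> y) = ip H w x + ip H w y"
    and ip_smult: "\<lbrakk>w \<in> carrier H; x \<in> carrier H\<rbrakk> \<Longrightarrow> ip H w (c \<odot> x) = c * ip H w x"
    and ip_cnj: "\<lbrakk>x \<in> carrier H; y \<in> carrier H\<rbrakk> \<Longrightarrow> ip H x y = cnj (ip H y x)"
    and ip_nonneg: "x \<in> carrier H \<Longrightarrow> 0 \<le> Re (ip H x x)"
    and ip_definite: "\<lbrakk>x \<in> carrier H; ip H x x = 0\<rbrakk> \<Longrightarrow> x = \<zero>"
begin

lemma smult_in [simp]: "x \<in> carrier H \<Longrightarrow> c \<odot> x \<in> carrier H"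
  using smult_closed[of c x] by simp

declare ip_add [simp] ip_smult [simp]

lemma ip_zero [simp]: "w \<in> carrier H \<Longrightarrow> ip H w \<zero> = 0"
  using ip_add[of w \<zero> \<zero>] by simp

lemma ip_neg [simp]: "\<lbrakk>w \<in> carrier H; x \<in> carrier H\<rbrakk> \<Longrightarrow> ip H w (\<ominus> x) = - ip H w x"
  using ip_add[of w x "\<ominus> x"] group_add_class.minus_unique[of "ip H w x" "ip H w (\<ominus> x)"] by (simp add: M.r_neg)

lemma ip_diff [simp]: "\<lbrakk>w \<in> carrier H; x \<in> carrier H; y \<in> carrier H\<rbrakk>
    \<Longrightarrow> ip H w (x \<ominus> y) = ip H w x - ip H w y"
  by (simp add: a_minus_def)

lemma ip_add_left [simp]: "\<lbrakk>w \<in> carrier H; x \<in> carrier H; y \<in> carrier H\<rbrakk>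
    \<Longrightarrow> ip H (x \<oplus> y) w = ip H x w + ip H y w"
  by (subst (1 2 3) ip_cnj) simp_all

lemma ip_smult_left [simp]: "\<lbrakk>w \<in> carrier H; x \<in> carrier H\<rbrakk>
    \<Longrightarrow> ip H (c \<odot> x) w = cnj c * ip H x w"
  by (subst (1 2) ip_cnj) simp_all

lemma ip_zero_left [simp]: "w \<in> carrier H \<Longrightarrow> ip H \<zero> w = 0"
  by (subst ip_cnj) simp_all

lemma ip_neg_left [simp]: "\<lbrakk>w \<in> carrier H; x \<in> carrier H\<rbrakk> \<Longrightarrow> ip H (\<ominus> x) w = - ip H x w"
  by (subst (1 2) ip_cnj) simp_all

lemma ip_diff_left [simp]: "\<lbrakk>w \<in> carrier H; x \<in> carrier H; y \<in> carrier H\<rbrakk>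
    \<Longrightarrow> ip H (x \<ominus> y) w = ip H x w - ip H y w"
  by (simp add: a_minus_def)

text \<open>Turns identities of vectors into identities of complex numbers, which simp settles by
  sesquilinearity without module arithmetic.\<close>

lemma vec_eqI:
  assumes [simp]: "x \<in> carrier H" "y \<in> carrier H" and eq: "\<And>w. w \<in> carrier H \<Longrightarrow> ip H w x = ip H w y"
  shows "x = y"
proof -
  have "ip H (x \<ominus> y) (x \<ominus> y) = 0" using eq[of "x \<ominus> y"] by simp
  then have "x \<ominus> y = \<zero>" by (intro ip_definite) simp_all
  then show ?thesis using M.minus_equality[of x "\<ominus> y"] by (simp add: a_minus_def)
qed

lemma hnorm_nonneg [simp]: "x \<in> carrier H \<Longrightarrow> 0 \<le> hnorm H x"
  by (simp add: hnorm_def ip_nonneg)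

lemma hnorm_sq: "x \<in> carrier H \<Longrightarrow> (hnorm H x)\<^sup>2 = Re (ip H x x)"
  by (simp add: hnorm_def ip_nonneg)

lemma ip_self: "x \<in> carrier H \<Longrightarrow> ip H x x = of_real ((hnorm H x)\<^sup>2)"
  using ip_cnj[of x x] by (simp add: hnorm_sq complex_eq_iff)

lemma hnorm_zero [simp]: "hnorm H \<zero> = 0"
  by (simp add: hnorm_def)

lemma hnorm_eq_0: "\<lbrakk>x \<in> carrier H; hnorm H x = 0\<rbrakk> \<Longrightarrow> x = \<zero>"
  by (rule ip_definite) (simp_all add: ip_self)

lemma hnorm_smult [simp]: "x \<in> carrier H \<Longrightarrow> hnorm H (c \<odot> x) = cmod c * hnorm H x"
proof -
  assume [simp]: "x \<in> carrier H"
  have "(hnorm H (c \<odot> x))\<^sup>2 = (cmod c * hnorm H x)\<^sup>2"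
    by (simp add: hnorm_sq[of "c \<odot> x"] ip_self[of x] power_mult_distrib cmod_power2)
      (simp add: power2_eq_square algebra_simps)
  then show ?thesis by (simp add: power2_eq_iff_nonneg)
qed

lemma hnorm_add_sq: "\<lbrakk>x \<in> carrier H; y \<in> carrier H\<rbrakk>
    \<Longrightarrow> (hnorm H (x \<oplus> y))\<^sup>2 = (hnorm H x)\<^sup>2 + (hnorm H y)\<^sup>2 + 2 * Re (ip H x y)"
  using ip_cnj[of y x] by (simp add: hnorm_sq)

lemma cauchy_schwarz:
  assumes [simp]: "x \<in> carrier H" "y \<in> carrier H"
  shows "cmod (ip H x y) \<le> hnorm H x * hnorm H y"
proof -
  have "(cmod (ip H x y))\<^sup>2 \<le> (hnorm H x)\<^sup>2 * (hnorm H y)\<^sup>2"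
  proof (rule quadratic_nonneg_imp_bound)
    fix t
    have "0 \<le> (hnorm H (x \<oplus> t \<odot> y))\<^sup>2" by simp
    then show "0 \<le> (hnorm H x)\<^sup>2 + 2 * Re (t * ip H x y) + (cmod t)\<^sup>2 * (hnorm H y)\<^sup>2"
      by (simp add: hnorm_add_sq power_mult_distrib algebra_simps)
  qed simp
  then show ?thesis by (simp add: power_mult_distrib[symmetric] abs_le_square_iff[symmetric])
qed

lemma hnorm_triangle:
  assumes [simp]: "x \<in> carrier H" "y \<in> carrier H"
  shows "hnorm H (x \<oplus> y) \<le> hnorm H x + hnorm H y"
proof -
  have "Re (ip H x y) \<le> hnorm H x * hnorm H y"
    using cauchy_schwarz[OF assms] complex_Re_le_cmod order_trans by blast
  then have "(hnorm H (x \<oplus> y))\<^sup>2 \<le> (hnorm H x + hnorm H y)\<^sup>2"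
    by (simp add: hnorm_add_sq power2_sum)
  then show ?thesis by (simp add: abs_le_square_iff[symmetric])
qed

lemma hnorm_diff_commute:
  "\<lbrakk>x \<in> carrier H; y \<in> carrier H\<rbrakk> \<Longrightarrow> hnorm H (x \<ominus> y) = hnorm H (y \<ominus> x)"
  by (simp add: hnorm_def)

lemma hnorm_diff_triangle:
  assumes [simp]: "x \<in> carrier H" "y \<in> carrier H" "w \<in> carrier H"
  shows "hnorm H (x \<ominus> w) \<le> hnorm H (x \<ominus> y) + hnorm H (y \<ominus> w)"
proof -
  have "x \<ominus> w = (x \<ominus> y) \<oplus> (y \<ominus> w)" by (rule vec_eqI) simp_all
  then show ?thesis using hnorm_triangle[of "x \<ominus> y" "y \<ominus> w"] by simp
qed

lemma hnorm_le_diff: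
  assumes [simp]: "x \<in> carrier H" "y \<in> carrier H"
  shows "hnorm H x \<le> hnorm H (x \<ominus> y) + hnorm H y"
proof -
  have "x = (x \<ominus> y) \<oplus> y" by (rule vec_eqI) simp_all
  then show ?thesis using hnorm_triangle[of "x \<ominus> y" y] by simp
qed

lemma ip_tendsto:
  assumes [simp]: "w \<in> carrier H" "x \<in> carrier H" "\<And>n. s n \<in> carrier H"
    and lim: "(\<lambda>n. hnorm H (s n \<ominus> x)) \<longlonglongrightarrow> 0"
  shows "(\<lambda>n. ip H w (s n)) \<longlonglongrightarrow> ip H w x"
proof -
  have "(\<lambda>n. ip H w (s n) - ip H w x) \<longlonglongrightarrow> 0"
  proof (rule Lim_null_comparison)
    show "\<forall>\<^sub>F n in sequentially. norm (ip H w (s n) - ip H w x) \<le> hnorm H w * hnorm H (s n \<ominus> x)"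
      using cauchy_schwarz[of w "s _ \<ominus> x"] by simp
    show "(\<lambda>n. hnorm H w * hnorm H (s n \<ominus> x)) \<longlonglongrightarrow> 0"
      using tendsto_mult_right_zero[OF lim] by simp
  qed
  then show ?thesis by (rule LIM_zero_cancel)
qed

lemma hnorm_tendsto:
  assumes [simp]: "x \<in> carrier H" "\<And>n. s n \<in> carrier H"
    and lim: "(\<lambda>n. hnorm H (s n \<ominus> x)) \<longlonglongrightarrow> 0"
  shows "(\<lambda>n. hnorm H (s n)) \<longlonglongrightarrow> hnorm H x"
proof -
  have "(\<lambda>n. hnorm H (s n) - hnorm H x) \<longlonglongrightarrow> 0"
  proof (rule Lim_null_comparison[OF _ lim])
    have "norm (hnorm H (s n) - hnorm H x) \<le> hnorm H (s n \<ominus> x)" for n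
      using hnorm_le_diff[of "s n" x] hnorm_le_diff[of x "s n"] hnorm_diff_commute[of x "s n"]
      by simp
    then show "\<forall>\<^sub>F n in sequentially. norm (hnorm H (s n) - hnorm H x) \<le> hnorm H (s n \<ominus> x)"
      by simp
  qed
  then show ?thesis by (rule LIM_zero_cancel)
qed

end

sublocale hilbert_space \<subseteq> inner_product_space
  by (intro inner_product_space.intro inner_product_space_axioms.intro module_axioms
      ip_add ip_smult ip_cnj ip_nonneg ip_definite)

lemma hilbert_spaceI:
  assumes "inner_product_space H"
    and "\<And>s. \<lbrakk>\<And>n. s n \<in> carrier H;
        \<And>e. 0 < e \<Longrightarrow> \<exists>N. \<forall>m\<ge>N. \<forall>n\<ge>N. hnorm H (s m \<ominus>\<^bsub>H\<^esub> s n) < e\<rbrakk>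
      \<Longrightarrow> \<exists>x\<in>carrier H. (\<lambda>n. hnorm H (s n \<ominus>\<^bsub>H\<^esub> x)) \<longlonglongrightarrow> 0"
  shows "hilbert_space H"
proof -
  interpret inner_product_space H by fact
  show ?thesis
    by (intro hilbert_space.intro hilbert_space_axioms.intro module_axioms
        ip_add ip_smult ip_cnj ip_nonneg ip_definite assms(2))
qed

subsection \<open>Finite linear combinations\<close>

text \<open>A finite linear combination of a family is a list of pairs of a coefficient and an index.\<close>

definition ev :: "('i \<Rightarrow> complex) \<Rightarrow> (complex \<times> 'i) list \<Rightarrow> complex" where
  "ev f xs = (\<Sum>(c, i)\<leftarrow>xs. c * f i)"

definition sc :: "complex \<Rightarrow> (complex \<times> 'i) list \<Rightarrow> (complex \<times> 'i) list" where
  "sc t xs = map (\<lambda>(c, i). (t * c, i)) xs"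

primrec lc :: "'h hilbert \<Rightarrow> ('i \<Rightarrow> 'h) \<Rightarrow> (complex \<times> 'i) list \<Rightarrow> 'h" where
  "lc H e [] = \<zero>\<^bsub>H\<^esub>"
| "lc H e (p # xs) = (fst p \<odot>\<^bsub>H\<^esub> e (snd p)) \<oplus>\<^bsub>H\<^esub> lc H e xs"

lemma ev_simps [simp]:
  "ev f [] = 0" "ev f ((c, i) # xs) = c * f i + ev f xs" "ev f (xs @ ys) = ev f xs + ev f ys"
  "ev f (sc t xs) = t * ev f xs"
proof -
  show "ev f (sc t xs) = t * ev f xs"
    by (induction xs) (auto simp: ev_def sc_def algebra_simps)
qed (simp_all add: ev_def)

lemma ev_add: "ev (\<lambda>i. f i + g i) xs = ev f xs + ev g xs"
  by (induction xs) (auto simp: algebra_simps)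

lemma ev_scale: "ev (\<lambda>i. c * f i) xs = c * ev f xs"
  by (induction xs) (auto simp: algebra_simps)

lemma ev_tendsto: "(\<And>i. ((\<lambda>n. f n i) \<longlongrightarrow> g i) F) \<Longrightarrow> ((\<lambda>n. ev (f n) xs) \<longlongrightarrow> ev g xs) F"
  by (induction xs) (auto intro!: tendsto_intros)

lemma sc_simps [simp]: "sc t [] = []" "sc t ((c, i) # xs) = (t * c, i) # sc t xs"
  by (simp_all add: sc_def)

context inner_product_space begin

lemma lc_in [simp]: "(\<And>i. e i \<in> carrier H) \<Longrightarrow> lc H e xs \<in> carrier H"
  by (induction xs) auto

lemma ip_lc: "\<lbrakk>\<And>i. e i \<in> carrier H; w \<in> carrier H\<rbrakk> \<Longrightarrow> ip H w (lc H e xs) = ev (\<lambda>i. ip H w (e i)) xs"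
  by (induction xs) auto

lemma lc_append: "(\<And>i. e i \<in> carrier H) \<Longrightarrow> lc H e (xs @ ys) = lc H e xs \<oplus> lc H e ys"
  by (rule vec_eqI) (simp_all add: ip_lc)

lemma lc_sc: "(\<And>i. e i \<in> carrier H) \<Longrightarrow> lc H e (sc t xs) = t \<odot> lc H e xs"
  by (rule vec_eqI) (simp_all add: ip_lc)

end

text \<open>The vector is the limit of a minimising sequence of \<open>\<parallel>v\<parallel>\<^sup>2 - 2 Re (f v)\<close> over the span of the family.\<close>

lemma (in hilbert_space) riesz:
  fixes e :: "'i \<Rightarrow> 'h"
  assumes e [simp]: "\<And>i. e i \<in> carrier H"
    and C: "0 \<le> C" and bound: "\<And>xs. cmod (ev f xs) \<le> C * hnorm H (lc H e xs)"
  obtains v where "v \<in> carrier H" "\<And>i. ip H v (e i) = f i" "hnorm H v \<le> C"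
    "\<And>x. \<lbrakk>x \<in> carrier H; \<And>i. ip H (e i) x = 0\<rbrakk> \<Longrightarrow> ip H v x = 0"
proof -
  define Q where "Q xs = (hnorm H (lc H e xs))\<^sup>2 - 2 * Re (ev f xs)" for xs
  have lower: "- (C\<^sup>2) \<le> Q xs" for xs
  proof -
    have "Re (ev f xs) \<le> C * hnorm H (lc H e xs)"
      using bound[of xs] complex_Re_le_cmod order_trans by blast
    moreover have "0 \<le> (hnorm H (lc H e xs) - C)\<^sup>2" by simp
    ultimately show ?thesis unfolding Q_def by (simp add: power2_diff algebra_simps)
  qed
  define m where "m = Inf (range Q)"
  have bdd: "bdd_below (range Q)" using lower by (intro bdd_belowI[of _ "- (C\<^sup>2)"]) auto
  have mle: "m \<le> Q xs" for xs unfolding m_def by (intro cInf_lower bdd) auto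
  have "\<exists>xs. Q xs < m + 1 / Suc n" for n
  proof (rule ccontr)
    assume "\<not> ?thesis"
    then have "m + 1 / Suc n \<le> Inf (range Q)" by (intro cInf_greatest) (auto simp: not_less)
    then show False unfolding m_def[symmetric] by simp
  qed
  then obtain X where X: "Q (X n) < m + 1 / Suc n" for n by metis
  \<comment> \<open>Parallelogram law: the midpoint of two combinations is again a combination, so
    its \<open>Q\<close> is at least \<open>m\<close>. Nearly minimal combinations are therefore
    close to each other.\<close>
  have par: "(hnorm H (lc H e xs \<ominus> lc H e ys))\<^sup>2 \<le> 2 * (Q xs + Q ys - 2 * m)" for xs ys
  proof -
    define v w where "v = lc H e xs" and "w = lc H e ys"
    have [simp]: "v \<in> carrier H" "w \<in> carrier H" by (simp_all add: v_def w_def)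
    have mid: "lc H e (sc (1/2) (xs @ ys)) = (1/2) \<odot> (v \<oplus> w)"
      by (simp only: lc_sc[OF e] lc_append[OF e] v_def w_def)
    have "Q (sc (1/2) (xs @ ys)) = (hnorm H (v \<oplus> w))\<^sup>2 / 4 - Re (ev f xs) - Re (ev f ys)"
      unfolding Q_def mid by (simp add: power_divide) (simp add: field_simps)
    moreover have "(hnorm H (v \<ominus> w))\<^sup>2 + (hnorm H (v \<oplus> w))\<^sup>2 = 2 * (hnorm H v)\<^sup>2 + 2 * (hnorm H w)\<^sup>2"
      by (simp add: hnorm_sq)
    ultimately show ?thesis
      using mle[of "sc (1/2) (xs @ ys)"] unfolding Q_def v_def[symmetric] w_def[symmetric] by simp
  qed
  define s where "s n = lc H e (X n)" for n
  have [simp]: "s n \<in> carrier H" for n by (simp add: s_def)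
  have cau: "\<exists>N. \<forall>k\<ge>N. \<forall>n\<ge>N. hnorm H (s k \<ominus> s n) < d" if "0 < d" for d
  proof -
    \<comment> \<open>Beyond \<open>N\<close> each excess \<open>Q (X j) - m\<close> is below
      \<open>d\<^sup>2 / 4\<close>, so that \<open>par\<close> bounds the squared distance by
      \<open>d\<^sup>2\<close>.\<close>
    obtain N where N: "4 / d\<^sup>2 < real N" using reals_Archimedean2 by blast
    have "hnorm H (s k \<ominus> s n) < d" if kn: "k \<ge> N" "n \<ge> N" for k n
    proof -
      have inv: "1 / real (Suc j) < d\<^sup>2 / 4" if "j \<ge> N" for j
      proof -
        have "4 / d\<^sup>2 < real (Suc j)" using N that by simp
        then show ?thesis using \<open>0 < d\<close> by (simp add: field_simps)
      qed
      have "(hnorm H (s k \<ominus> s n))\<^sup>2 < d\<^sup>2"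
        using par[of "X k" "X n"] X[of k] X[of n] inv[OF kn(1)] inv[OF kn(2)] unfolding s_def by argo
      then show ?thesis using \<open>0 < d\<close> by (simp add: power2_less_imp_less)
    qed
    then show ?thesis by blast
  qed
  obtain v where v [simp]: "v \<in> carrier H" and lim: "(\<lambda>n. hnorm H (s n \<ominus> v)) \<longlonglongrightarrow> 0"
    using complete[of s] cau by auto
  have limv: "(\<lambda>n. ip H w (s n)) \<longlonglongrightarrow> ip H w v" if "w \<in> carrier H" for w
    using that lim by (intro ip_tendsto) auto
  have limv': "(\<lambda>n. ip H (s n) w) \<longlonglongrightarrow> ip H v w" if w: "w \<in> carrier H" for w
    using tendsto_cnj[OF limv[OF w]] w by (simp add: ip_cnj[of _ w])
  have Qlim: "(\<lambda>n. Q (X n)) \<longlonglongrightarrow> m"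
  proof (rule tendsto_sandwich[of "\<lambda>_. m" _ _ "\<lambda>n. m + 1 / real (Suc n)"])
    show "(\<lambda>n. m + 1 / real (Suc n)) \<longlonglongrightarrow> m"
      using tendsto_add[OF tendsto_const LIMSEQ_inverse_real_of_nat, of m] by (simp add: inverse_eq_divide)
    show "\<forall>\<^sub>F n in sequentially. Q (X n) \<le> m + 1 / real (Suc n)"
      using X less_imp_le by (intro always_eventually allI) blast
  qed (simp_all add: mle)
  have vf: "ip H v (e j) = f j" for j
  proof -
    \<comment> \<open>First variation: moving the minimising sequence by
      \<open>t \<odot> e j\<close> cannot lower the limit \<open>m\<close>. The resulting polynomial
      in \<open>t\<close> has constant term 0, so its linear coefficient vanishes.\<close>
    have "(cmod (ip H v (e j) - f j))\<^sup>2 \<le> 0 * (hnorm H (e j))\<^sup>2"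
    proof (rule quadratic_nonneg_imp_bound)
      fix t
      have "m \<le> Q (X n) + 2 * Re (t * (ip H (s n) (e j) - f j)) + (cmod t)\<^sup>2 * (hnorm H (e j))\<^sup>2" for n
      proof -
        have "lc H e (X n @ [(t, j)]) = s n \<oplus> t \<odot> e j" by (simp add: lc_append s_def)
        then have "Q (X n @ [(t, j)]) = Q (X n) + 2 * Re (t * (ip H (s n) (e j) - f j)) + (cmod t)\<^sup>2 * (hnorm H (e j))\<^sup>2"
          unfolding Q_def by (simp add: hnorm_add_sq power_mult_distrib s_def[symmetric] algebra_simps)
        then show ?thesis using mle by metis
      qed
      moreover have "(\<lambda>n. Q (X n) + 2 * Re (t * (ip H (s n) (e j) - f j)) + (cmod t)\<^sup>2 * (hnorm H (e j))\<^sup>2)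
          \<longlonglongrightarrow> m + 2 * Re (t * (ip H v (e j) - f j)) + (cmod t)\<^sup>2 * (hnorm H (e j))\<^sup>2"
        by (intro tendsto_intros Qlim limv') simp
      ultimately have "m \<le> m + 2 * Re (t * (ip H v (e j) - f j)) + (cmod t)\<^sup>2 * (hnorm H (e j))\<^sup>2"
        by (intro LIMSEQ_le_const) auto
      then show "0 \<le> 0 + 2 * Re (t * (ip H v (e j) - f j)) + (cmod t)\<^sup>2 * (hnorm H (e j))\<^sup>2" by simp
    qed simp
    then show ?thesis by simp
  qed
  have "(hnorm H v)\<^sup>2 \<le> C * hnorm H v"
  proof -
    have "ev f (X n) = ip H v (s n)" for n by (simp add: s_def ip_lc vf)
    then have "cmod (ip H v (s n)) \<le> C * hnorm H (s n)" for n using bound[of "X n"] by (simp add: s_def)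
    moreover have "(\<lambda>n. C * hnorm H (s n)) \<longlonglongrightarrow> C * hnorm H v"
      using lim by (intro tendsto_intros hnorm_tendsto) auto
    moreover have "(\<lambda>n. cmod (ip H v (s n))) \<longlonglongrightarrow> cmod (ip H v v)"
      by (intro tendsto_norm limv) simp
    ultimately have "cmod (ip H v v) \<le> C * hnorm H v"
      by (intro LIMSEQ_le) auto
    then show ?thesis by (simp add: ip_self norm_power)
  qed
  then have "hnorm H v \<le> C"
    using C hnorm_nonneg[OF v] by (cases "hnorm H v = 0") (auto simp: power2_eq_square)
  moreover have "ip H v x = 0" if x: "x \<in> carrier H" "\<And>i. ip H (e i) x = 0" for x
  proof -
    have "ip H x (s n) = 0" for n
      using x ip_cnj[of x "e _"] unfolding s_def by (simp add: ip_lc ev_def split_def)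
    then have "ip H (s n) x = 0" for n using ip_cnj[of "s n" x] x by simp
    then show ?thesis using limv'[OF x(1)] by (simp add: LIMSEQ_const_iff)
  qed
  ultimately show thesis using that[of v] vf v by blast
qed

subsection \<open>Bounded operators and adjoints\<close>

lemma bounded_ops_in: "\<lbrakk>T \<in> bounded_ops H K; x \<in> carrier H\<rbrakk> \<Longrightarrow> T x \<in> carrier K"
  by (auto simp: bounded_ops_def)

lemma bounded_ops_add: "\<lbrakk>T \<in> bounded_ops H K; x \<in> carrier H; y \<in> carrier H\<rbrakk>
    \<Longrightarrow> T (x \<oplus>\<^bsub>H\<^esub> y) = T x \<oplus>\<^bsub>K\<^esub> T y"
  by (auto simp: bounded_ops_def)

lemma bounded_ops_smult: "\<lbrakk>T \<in> bounded_ops H K; x \<in> carrier H\<rbrakk>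
    \<Longrightarrow> T (c \<odot>\<^bsub>H\<^esub> x) = c \<odot>\<^bsub>K\<^esub> T x"
  by (auto simp: bounded_ops_def)

text \<open>The constant is taken at least 1, so that it can be used as a positive scale and divided
  by.\<close>

lemma bounded_ops_bound:
  assumes "hilbert_space H" "T \<in> bounded_ops H K"
  obtains B where "1 \<le> B" "\<And>x. x \<in> carrier H \<Longrightarrow> hnorm K (T x) \<le> B * hnorm H x"
proof -
  interpret hilbert_space H by fact
  obtain B where B: "\<And>x. x \<in> carrier H \<Longrightarrow> hnorm K (T x) \<le> B * hnorm H x"
    using assms unfolding bounded_ops_def by blast
  have "hnorm K (T x) \<le> max 1 B * hnorm H x" if "x \<in> carrier H" for x
  proof -
    have "B * hnorm H x \<le> max 1 B * hnorm H x" using that by (intro mult_right_mono) auto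
    then show ?thesis using B[OF that] by linarith
  qed
  then show thesis using that[of "max 1 B"] by simp
qed

lemma bounded_ops_eqI:
  assumes "T \<in> bounded_ops H K" "S \<in> bounded_ops H K" "\<And>x. x \<in> carrier H \<Longrightarrow> T x = S x"
  shows "T = S"
  using assms by (intro extensionalityI[of T "carrier H" S]) (auto simp: bounded_ops_def PiE_def)

lemma bounded_ops_eqI_ip:
  assumes "hilbert_space K" "T \<in> bounded_ops H K" "S \<in> bounded_ops H K"
    "\<And>x y. \<lbrakk>x \<in> carrier H; y \<in> carrier K\<rbrakk> \<Longrightarrow> ip K y (T x) = ip K y (S x)"
  shows "T = S"
proof -
  interpret hilbert_space K by fact
  show ?thesis
    by (rule bounded_ops_eqI[OF assms(2,3)], rule vec_eqI)
      (simp_all add: assms(4) bounded_ops_in[OF assms(2)] bounded_ops_in[OF assms(3)])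
qed

lemma bounded_opsI:
  assumes "\<And>x. x \<in> carrier H \<Longrightarrow> T x \<in> carrier K"
    "\<And>x y. \<lbrakk>x \<in> carrier H; y \<in> carrier H\<rbrakk> \<Longrightarrow> T (x \<oplus>\<^bsub>H\<^esub> y) = T x \<oplus>\<^bsub>K\<^esub> T y"
    "\<And>c x. x \<in> carrier H \<Longrightarrow> T (c \<odot>\<^bsub>H\<^esub> x) = c \<odot>\<^bsub>K\<^esub> T x"
    "\<And>x. x \<in> carrier H \<Longrightarrow> hnorm K (T x) \<le> B * hnorm H x"
    "T \<in> extensional (carrier H)"
  shows "T \<in> bounded_ops H K"
  using assms unfolding bounded_ops_def PiE_def by blast

lemma lc_bounded_op:
  assumes "hilbert_space H" "hilbert_space K" "T \<in> bounded_ops H K" "\<And>i. e i \<in> carrier H"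
  shows "lc K (\<lambda>i. T (e i)) xs = T (lc H e xs)"
proof -
  interpret H: hilbert_space H by fact
  interpret K: hilbert_space K by fact
  have "T \<zero>\<^bsub>H\<^esub> = T (0 \<odot>\<^bsub>H\<^esub> \<zero>\<^bsub>H\<^esub>)" by (rule arg_cong[of _ _ T], rule H.vec_eqI) simp_all
  also have "\<dots> = 0 \<odot>\<^bsub>K\<^esub> T \<zero>\<^bsub>H\<^esub>" using assms(3) by (intro bounded_ops_smult) auto
  also have "\<dots> = \<zero>\<^bsub>K\<^esub>" using bounded_ops_in[OF assms(3)] by (intro K.vec_eqI) simp_all
  finally show ?thesis
    using assms(3,4) by (induction xs) (simp_all add: bounded_ops_add bounded_ops_smult)
qed

lemma sesquilinear_form_operator:
  fixes b :: "'k \<Rightarrow> 'h \<Rightarrow> complex"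
  assumes H: "hilbert_space H" and K: "hilbert_space K"
    and add: "\<And>y x x'. \<lbrakk>y \<in> carrier K; x \<in> carrier H; x' \<in> carrier H\<rbrakk>
        \<Longrightarrow> b y (x \<oplus>\<^bsub>H\<^esub> x') = b y x + b y x'"
    and smult: "\<And>y x c. \<lbrakk>y \<in> carrier K; x \<in> carrier H\<rbrakk> \<Longrightarrow> b y (c \<odot>\<^bsub>H\<^esub> x) = c * b y x"
    and addl: "\<And>y y' x. \<lbrakk>y \<in> carrier K; y' \<in> carrier K; x \<in> carrier H\<rbrakk>
        \<Longrightarrow> b (y \<oplus>\<^bsub>K\<^esub> y') x = b y x + b y' x"
    and smultl: "\<And>y x c. \<lbrakk>y \<in> carrier K; x \<in> carrier H\<rbrakk> \<Longrightarrow> b (c \<odot>\<^bsub>K\<^esub> y) x = cnj c * b y x"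
    and bound: "\<And>y x. \<lbrakk>y \<in> carrier K; x \<in> carrier H\<rbrakk>
        \<Longrightarrow> cmod (b y x) \<le> C * hnorm K y * hnorm H x"
    and C: "0 \<le> C"
  obtains T where "T \<in> bounded_ops H K"
    "\<And>x y. \<lbrakk>x \<in> carrier H; y \<in> carrier K\<rbrakk> \<Longrightarrow> ip K y (T x) = b y x"
proof -
  interpret H: hilbert_space H by fact
  interpret K: hilbert_space K by fact
  \<comment> \<open>The family consists of all vectors of \<open>K\<close>. Since
    \<open>riesz\<close> expects a family indexed by a whole type, values outside the carrier are
    sent to zero; the same device recurs below.\<close>
  define e where "e y = (if y \<in> carrier K then y else \<zero>\<^bsub>K\<^esub>)" for y
  have e [simp]: "e y \<in> carrier K" for y by (simp add: e_def)
  have "\<exists>v\<in>carrier K. (\<forall>y\<in>carrier K. ip K y v = b y x) \<and> hnorm K v \<le> C * hnorm H x"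
    if x: "x \<in> carrier H" for x
  proof -
    define f where "f y = cnj (b (e y) x)" for y
    have b0: "b \<zero>\<^bsub>K\<^esub> x = 0" using bound[of "\<zero>\<^bsub>K\<^esub>" x] x by simp
    have ev: "ev f xs = cnj (b (lc K e xs) x)" for xs
      by (induction xs) (auto simp: b0 addl smultl x f_def)
    have bnd: "cmod (ev f xs) \<le> C * hnorm H x * hnorm K (lc K e xs)" for xs
      using bound[of "lc K e xs" x] x by (simp add: ev mult_ac)
    obtain v where v: "v \<in> carrier K" "\<And>y. ip K v (e y) = f y" "hnorm K v \<le> C * hnorm H x"
      by (rule K.riesz[OF e _ bnd]) (use C x in simp, blast)
    have "ip K y v = b y x" if "y \<in> carrier K" for y
      using v(2)[of y] K.ip_cnj[of y v] that v(1) by (simp add: f_def e_def)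
    then show ?thesis using v by auto
  qed
  then obtain t where t: "\<And>x. x \<in> carrier H \<Longrightarrow> t x \<in> carrier K"
    "\<And>x y. \<lbrakk>x \<in> carrier H; y \<in> carrier K\<rbrakk> \<Longrightarrow> ip K y (t x) = b y x"
    "\<And>x. x \<in> carrier H \<Longrightarrow> hnorm K (t x) \<le> C * hnorm H x" by metis
  define T where "T = restrict t (carrier H)"
  have "T \<in> bounded_ops H K"
    by (rule bounded_opsI[where B = C]; (rule K.vec_eqI)?) (simp_all add: T_def t add smult)
  then show thesis using that[of T] t by (simp add: T_def)
qed

lemma adjoint_exists:
  assumes H: "hilbert_space H" and K: "hilbert_space K" and T: "T \<in> bounded_ops H K"
  obtains S where "S \<in> bounded_ops K H"
    "\<And>x y. \<lbrakk>x \<in> carrier H; y \<in> carrier K\<rbrakk> \<Longrightarrow> ip H (S y) x = ip K y (T x)"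
proof -
  interpret H: hilbert_space H by fact
  interpret K: hilbert_space K by fact
  note [simp] = bounded_ops_in[OF T] bounded_ops_add[OF T] bounded_ops_smult[OF T]
  obtain B where B: "1 \<le> B" "\<And>x. x \<in> carrier H \<Longrightarrow> hnorm K (T x) \<le> B * hnorm H x"
    using bounded_ops_bound[OF H T] by blast
  have bnd: "cmod (ip K (T x) y) \<le> B * hnorm H x * hnorm K y"
    if xy: "y \<in> carrier K" "x \<in> carrier H" for x y
  proof -
    have "hnorm K (T x) * hnorm K y \<le> B * hnorm H x * hnorm K y"
      using B xy by (intro mult_right_mono) auto
    then show ?thesis using K.cauchy_schwarz[of "T x" y] xy by force
  qed
  obtain S where S: "S \<in> bounded_ops K H"
    "\<And>x y. \<lbrakk>x \<in> carrier K; y \<in> carrier H\<rbrakk> \<Longrightarrow> ip H y (S x) = ip K (T y) x"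
    by (rule sesquilinear_form_operator[OF K H, of "\<lambda>x y. ip K (T x) y" B])
      (use B(1) bnd in auto)
  have "ip H (S y) x = ip K y (T x)" if "x \<in> carrier H" "y \<in> carrier K" for x y
    using S(2)[of y x] that H.ip_cnj[of "S y" x] K.ip_cnj[of y "T x"] bounded_ops_in[OF S(1)] by simp
  then show thesis using that S by blast
qed

lemma adj_eqI:
  assumes H: "hilbert_space H" and S: "S \<in> bounded_ops K H"
    and eq: "\<And>x y. \<lbrakk>x \<in> carrier H; y \<in> carrier K\<rbrakk> \<Longrightarrow> ip H (S y) x = ip K y (T x)"
  shows "adj H K T = S"
  unfolding adj_def
proof (rule the_equality)
  show "S \<in> bounded_ops K H \<and> (\<forall>x\<in>carrier H. \<forall>y\<in>carrier K. ip H (S y) x = ip K y (T x))"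
    using S eq by blast
next
  interpret hilbert_space H by fact
  fix S' assume "S' \<in> bounded_ops K H \<and> (\<forall>x\<in>carrier H. \<forall>y\<in>carrier K. ip H (S' y) x = ip K y (T x))"
  then have S': "S' \<in> bounded_ops K H" "\<And>x y. \<lbrakk>x \<in> carrier H; y \<in> carrier K\<rbrakk> \<Longrightarrow> ip H (S' y) x = ip K y (T x)"
    by blast+
  show "S' = S"
  proof (rule bounded_ops_eqI_ip[OF H _ S])
    fix x y assume "x \<in> carrier K" "y \<in> carrier H"
    then show "ip H y (S' x) = ip H y (S x)"
      using eq[of y x] S S' ip_cnj[of y "S' x"] ip_cnj[of y "S x"] by (simp add: bounded_ops_in)
  qed fact
qed

lemma
  assumes H: "hilbert_space H" and K: "hilbert_space K" and T: "T \<in> bounded_ops H K"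
  shows adj_in: "adj H K T \<in> bounded_ops K H"
    and adj_ip: "\<lbrakk>x \<in> carrier H; y \<in> carrier K\<rbrakk> \<Longrightarrow> ip H (adj H K T y) x = ip K y (T x)"
    and adj_ip': "\<lbrakk>x \<in> carrier H; y \<in> carrier K\<rbrakk> \<Longrightarrow> ip H x (adj H K T y) = ip K (T x) y"
proof -
  obtain S where S: "S \<in> bounded_ops K H"
    "\<And>x y. \<lbrakk>x \<in> carrier H; y \<in> carrier K\<rbrakk> \<Longrightarrow> ip H (S y) x = ip K y (T x)"
    using adjoint_exists[OF assms] by blast
  have e: "adj H K T = S" using S by (intro adj_eqI H)
  show "adj H K T \<in> bounded_ops K H" using S e by simp
  show *: "ip H (adj H K T y) x = ip K y (T x)" if "x \<in> carrier H" "y \<in> carrier K"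
    using S e that by simp
  interpret H: hilbert_space H by fact
  interpret K: hilbert_space K by fact
  assume "x \<in> carrier H" "y \<in> carrier K"
  then show "ip H x (adj H K T y) = ip K (T x) y"
    using * H.ip_cnj[of x "S y"] K.ip_cnj[of "T x" y] S T by (simp add: e bounded_ops_in)
qed

lemma adj_adj:
  assumes H: "hilbert_space H" and K: "hilbert_space K" and T: "T \<in> bounded_ops H K"
  shows "adj K H (adj H K T) = T"
  using assms by (intro adj_eqI) (auto simp: adj_ip')

lemma compose_in:
  assumes H: "hilbert_space H" and K: "hilbert_space K" and L: "hilbert_space L"
    and T: "T \<in> bounded_ops H K" and S: "S \<in> bounded_ops K L"
  shows "compose (carrier H) S T \<in> bounded_ops H L"
proof -
  interpret H: hilbert_space H by fact
  interpret K: hilbert_space K by fact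
  interpret L: hilbert_space L by fact
  note [simp] = bounded_ops_in[OF T] bounded_ops_add[OF T] bounded_ops_smult[OF T]
    bounded_ops_in[OF S] bounded_ops_add[OF S] bounded_ops_smult[OF S]
  obtain B where B: "1 \<le> B" "\<And>x. x \<in> carrier H \<Longrightarrow> hnorm K (T x) \<le> B * hnorm H x"
    using bounded_ops_bound[OF H T] by blast
  obtain C where C: "1 \<le> C" "\<And>x. x \<in> carrier K \<Longrightarrow> hnorm L (S x) \<le> C * hnorm K x"
    using bounded_ops_bound[OF K S] by blast
  have "hnorm L (S (T x)) \<le> C * B * hnorm H x" if "x \<in> carrier H" for x
  proof -
    have "hnorm L (S (T x)) \<le> C * hnorm K (T x)" using C that by simp
    also have "\<dots> \<le> C * (B * hnorm H x)" using B C that by (intro mult_left_mono) auto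
    finally show ?thesis by (simp add: mult.assoc)
  qed
  then show ?thesis by (intro bounded_opsI[where B = "C * B"]) (simp_all add: compose_def)
qed

lemma adj_compose:
  assumes H: "hilbert_space H" and K: "hilbert_space K" and L: "hilbert_space L"
    and T: "T \<in> bounded_ops H K" and S: "S \<in> bounded_ops K L"
  shows "adj H L (compose (carrier H) S T) = compose (carrier L) (adj H K T) (adj K L S)"
proof -
  note a = adj_in[OF H K T] adj_in[OF K L S]
  show ?thesis
    by (intro adj_eqI compose_in[of _ K] assms a)
      (simp_all add: compose_def bounded_ops_in[OF T] bounded_ops_in[OF a(2)] adj_ip[OF H K T] adj_ip[OF K L S])
qed

lemma
  assumes H: "hilbert_space H"
  shows op_one_in: "op_one H \<in> bounded_ops H H"
    and adj_op_one: "adj H H (op_one H) = op_one H"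
proof -
  interpret hilbert_space H by fact
  show "op_one H \<in> bounded_ops H H"
    by (rule bounded_opsI[where B = 1]) (simp_all add: op_one_def)
  then show "adj H H (op_one H) = op_one H"
    by (intro adj_eqI H) (simp_all add: op_one_def)
qed

lemma op_mult_in: "\<lbrakk>hilbert_space H; S \<in> bounded_ops H H; T \<in> bounded_ops H H\<rbrakk>
    \<Longrightarrow> op_mult H S T \<in> bounded_ops H H"
  unfolding op_mult_def by (rule compose_in[of _ H])

lemma op_add_in:
  assumes H: "hilbert_space H" and S: "S \<in> bounded_ops H H" and T: "T \<in> bounded_ops H H"
  shows "op_add H S T \<in> bounded_ops H H"
proof -
  interpret hilbert_space H by fact
  note [simp] = bounded_ops_in[OF T] bounded_ops_add[OF T] bounded_ops_smult[OF T]
    bounded_ops_in[OF S] bounded_ops_add[OF S] bounded_ops_smult[OF S]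
  obtain B where B: "1 \<le> B" "\<And>x. x \<in> carrier H \<Longrightarrow> hnorm H (T x) \<le> B * hnorm H x"
    using bounded_ops_bound[OF H T] by blast
  obtain C where C: "1 \<le> C" "\<And>x. x \<in> carrier H \<Longrightarrow> hnorm H (S x) \<le> C * hnorm H x"
    using bounded_ops_bound[OF H S] by blast
  have bnd: "hnorm H (S x \<oplus>\<^bsub>H\<^esub> T x) \<le> (C + B) * hnorm H x" if "x \<in> carrier H" for x
    using hnorm_triangle[of "S x" "T x"] B(2)[OF that] C(2)[OF that] that by (simp add: distrib_right)
  show ?thesis
    by (rule bounded_opsI[where B = "C + B"]; (rule vec_eqI)?) (simp_all add: op_add_def bnd distrib_left)
qed

lemma op_smult_in:
  assumes H: "hilbert_space H" and S: "S \<in> bounded_ops H H"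
  shows "op_smult H c S \<in> bounded_ops H H"
proof -
  interpret hilbert_space H by fact
  note [simp] = bounded_ops_in[OF S] bounded_ops_add[OF S] bounded_ops_smult[OF S]
  obtain C where C: "1 \<le> C" "\<And>x. x \<in> carrier H \<Longrightarrow> hnorm H (S x) \<le> C * hnorm H x"
    using bounded_ops_bound[OF H S] by blast
  have bnd: "cmod c * hnorm H (S x) \<le> cmod c * C * hnorm H x" if "x \<in> carrier H" for x
    using C that by (simp add: mult.assoc mult_left_mono)
  show ?thesis
    by (rule bounded_opsI[where B = "cmod c * C"]; (rule vec_eqI)?) (simp_all add: op_smult_def bnd distrib_left)
qed

lemma
  assumes H: "hilbert_space H" and S: "S \<in> bounded_ops H H" and T: "T \<in> bounded_ops H H"
  shows adj_op_mult: "adj H H (op_mult H S T) = op_mult H (adj H H T) (adj H H S)"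
    and adj_op_add: "adj H H (op_add H S T) = op_add H (adj H H S) (adj H H T)"
    and adj_op_smult: "adj H H (op_smult H c S) = op_smult H (cnj c) (adj H H S)"
proof -
  interpret hilbert_space H by fact
  note a = adj_in[OF H H S] adj_in[OF H H T]
  note [simp] = bounded_ops_in[OF T] bounded_ops_in[OF S] bounded_ops_in[OF a(1)] bounded_ops_in[OF a(2)]
    adj_ip[OF H H S] adj_ip[OF H H T]
  show "adj H H (op_mult H S T) = op_mult H (adj H H T) (adj H H S)"
    unfolding op_mult_def by (rule adj_compose[OF H H H T S])
  show "adj H H (op_add H S T) = op_add H (adj H H S) (adj H H T)"
    by (intro adj_eqI H op_add_in a) (simp_all add: op_add_def)
  show "adj H H (op_smult H c S) = op_smult H (cnj c) (adj H H S)"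
    by (intro adj_eqI H op_smult_in a) (simp_all add: op_smult_def)
qed

text \<open>A trivial orthogonal complement is equivalent to density of the span; in this form
  identities can be tested on the family without taking limits.\<close>

definition total_family :: "'h hilbert \<Rightarrow> ('i \<Rightarrow> 'h) \<Rightarrow> bool" where
  "total_family H e \<longleftrightarrow> (\<forall>i. e i \<in> carrier H) \<and>
     (\<forall>x\<in>carrier H. (\<forall>i. ip H (e i) x = 0) \<longrightarrow> x = \<zero>\<^bsub>H\<^esub>)"

lemma total_in: "total_family H e \<Longrightarrow> e i \<in> carrier H"
  by (simp add: total_family_def)

lemma total_vec_eqI:
  assumes "hilbert_space H" "total_family H e" "x \<in> carrier H" "y \<in> carrier H" "\<And>i. ip H (e i) x = ip H (e i) y"
  shows "x = y"
proof -
  interpret hilbert_space H by fact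
  have "x \<ominus>\<^bsub>H\<^esub> y = \<zero>\<^bsub>H\<^esub>"
    using assms(2-) by (simp add: total_family_def)
  then show ?thesis using assms M.minus_equality[of x "\<ominus>\<^bsub>H\<^esub> y"] by (simp add: a_minus_def)
qed

text \<open>The adjoints of \<open>T\<close> and \<open>S\<close> have the same inner products with
  the family, hence agree everywhere; no approximation of vectors is involved.\<close>

lemma total_op_eqI:
  assumes H: "hilbert_space H" and K: "hilbert_space K" and e: "total_family H e"
    and T: "T \<in> bounded_ops H K" and S: "S \<in> bounded_ops H K" and eq: "\<And>i. T (e i) = S (e i)"
  shows "T = S"
proof -
  interpret H: hilbert_space H by fact
  interpret K: hilbert_space K by fact
  note [simp] = total_in[OF e]
  have "adj H K T y = adj H K S y" if y: "y \<in> carrier K" for y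
    by (rule total_vec_eqI[OF H e]) (use y eq in \<open>simp_all add: adj_ip'[OF H K T] adj_ip'[OF H K S]
        bounded_ops_in[OF adj_in[OF H K T]] bounded_ops_in[OF adj_in[OF H K S]]\<close>)
  then have "adj H K T = adj H K S" using bounded_ops_eqI[OF adj_in[OF H K T] adj_in[OF H K S]] by blast
  then show ?thesis using adj_adj[OF H K T] adj_adj[OF H K S] by metis
qed

text \<open>The adjoint \<open>S\<close> of the extension is built before the extension itself: the
  domination makes \<open>e i \<mapsto> \<langle>y, f i\<rangle>\<close> a bounded functional, which
  \<open>riesz\<close> represents by \<open>s y\<close>. These vectors are orthogonal to everything
  orthogonal to the family, so \<open>T\<close> vanishes there. Families that are not total are
  allowed for this reason.\<close>

lemma gram_extension:
  fixes e :: "'i \<Rightarrow> 'h" and f :: "'i \<Rightarrow> 'k"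
  assumes H: "hilbert_space H" and K: "hilbert_space K"
    and e [simp]: "\<And>i. e i \<in> carrier H" and f [simp]: "\<And>i. f i \<in> carrier K"
    and C: "0 \<le> C" and dom: "\<And>xs. hnorm K (lc K f xs) \<le> C * hnorm H (lc H e xs)"
  obtains T where "T \<in> bounded_ops H K" "\<And>i. T (e i) = f i"
    "\<And>x. \<lbrakk>x \<in> carrier H; \<And>i. ip H (e i) x = 0\<rbrakk> \<Longrightarrow> T x = \<zero>\<^bsub>K\<^esub>"
proof -
  interpret H: hilbert_space H by fact
  interpret K: hilbert_space K by fact
  have "\<exists>v\<in>carrier H. (\<forall>i. ip H v (e i) = ip K y (f i)) \<and> hnorm H v \<le> C * hnorm K y
      \<and> (\<forall>x\<in>carrier H. (\<forall>i. ip H (e i) x = 0) \<longrightarrow> ip H v x = 0)"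
    if y: "y \<in> carrier K" for y
  proof -
    have bnd: "cmod (ev (\<lambda>i. ip K y (f i)) xs) \<le> C * hnorm K y * hnorm H (lc H e xs)" for xs
    proof -
      have "cmod (ip K y (lc K f xs)) \<le> hnorm K y * hnorm K (lc K f xs)"
        using y by (intro K.cauchy_schwarz) auto
      also have "\<dots> \<le> hnorm K y * (C * hnorm H (lc H e xs))"
        using dom y by (intro mult_left_mono) auto
      finally show ?thesis using y by (simp add: K.ip_lc mult_ac)
    qed
    show ?thesis
      by (rule H.riesz[OF e _ bnd]) (use C y in simp, blast)
  qed
  then have "\<forall>y\<in>carrier K. \<exists>v. v \<in> carrier H \<and> (\<forall>i. ip H v (e i) = ip K y (f i)) \<and> hnorm H v \<le> C * hnorm K y
      \<and> (\<forall>x\<in>carrier H. (\<forall>i. ip H (e i) x = 0) \<longrightarrow> ip H v x = 0)" by blast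
  from bchoice[OF this] obtain s where s: "\<And>y. y \<in> carrier K \<Longrightarrow> s y \<in> carrier H"
    "\<And>y i. y \<in> carrier K \<Longrightarrow> ip H (s y) (e i) = ip K y (f i)"
    "\<And>y. y \<in> carrier K \<Longrightarrow> hnorm H (s y) \<le> C * hnorm K y"
    "\<And>y x. \<lbrakk>y \<in> carrier K; x \<in> carrier H; \<forall>i. ip H (e i) x = 0\<rbrakk> \<Longrightarrow> ip H (s y) x = 0"
    by blast
  \<comment> \<open>Being orthogonal to the complement of the family pins \<open>s y\<close> down,
    and uniqueness is what makes \<open>s\<close> additive and homogeneous.\<close>
  have uniq: "v = s y" if v: "v \<in> carrier H" "\<And>i. ip H v (e i) = ip K y (f i)"
      "\<And>x. \<lbrakk>x \<in> carrier H; \<forall>i. ip H (e i) x = 0\<rbrakk> \<Longrightarrow> ip H v x = 0" and y: "y \<in> carrier K" for v y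
  proof -
    define d where "d = v \<ominus>\<^bsub>H\<^esub> s y"
    have d: "d \<in> carrier H" using v s(1)[OF y] by (simp add: d_def)
    have "ip H d (e i) = 0" for i
      using v(1,2) s(1,2)[OF y] by (simp add: d_def)
    then have od: "\<forall>i. ip H (e i) d = 0" using H.ip_cnj[of "e _" d] d by simp
    have "ip H d d = ip H v d - ip H (s y) d" using d v(1) s(1)[OF y] by (subst (1) d_def) simp
    then have "ip H d d = 0" using v(3)[OF d od] s(4)[OF y d od] by simp
    then have "d = \<zero>\<^bsub>H\<^esub>" using d by (intro H.ip_definite)
    then show ?thesis using v(1) s(1)[OF y] H.M.minus_equality[of v "\<ominus>\<^bsub>H\<^esub> s y"] by (simp add: d_def a_minus_def)
  qed
  define S where "S = restrict s (carrier K)"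
  have S: "S \<in> bounded_ops K H"
  proof (rule bounded_opsI[where B = C])
    fix x y assume xy: "x \<in> carrier K" "y \<in> carrier K"
    have "s x \<oplus>\<^bsub>H\<^esub> s y = s (x \<oplus>\<^bsub>K\<^esub> y)"
      by (rule uniq) (simp_all add: xy s(1,2,4))
    then show "S (x \<oplus>\<^bsub>K\<^esub> y) = S x \<oplus>\<^bsub>H\<^esub> S y" using xy by (simp add: S_def)
  next
    fix c x assume x: "x \<in> carrier K"
    have "c \<odot>\<^bsub>H\<^esub> s x = s (c \<odot>\<^bsub>K\<^esub> x)"
      by (rule uniq) (simp_all add: x s(1,2,4))
    then show "S (c \<odot>\<^bsub>K\<^esub> x) = c \<odot>\<^bsub>H\<^esub> S x" using x by (simp add: S_def)
  qed (simp_all add: S_def s(1,3))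
  define T where "T = adj K H S"
  have T: "T \<in> bounded_ops H K" unfolding T_def by (rule adj_in[OF K H S])
  have Tip: "ip K y (T x) = ip H (s y) x" if "x \<in> carrier H" "y \<in> carrier K" for x y
    using adj_ip'[OF K H S, of y x] that by (simp add: T_def S_def)
  show thesis
  proof (rule that[OF T])
    show "T (e i) = f i" for i
      using bounded_ops_in[OF T] by (intro K.vec_eqI) (simp_all add: Tip s(1,2))
    show "T x = \<zero>\<^bsub>K\<^esub>" if "x \<in> carrier H" "\<And>i. ip H (e i) x = 0" for x
      using that bounded_ops_in[OF T] by (intro K.vec_eqI) (simp_all add: Tip s(1,4))
  qed
qed

subsection \<open>Commutants\<close>

lemma op_mult_apply [simp]: "x \<in> carrier H \<Longrightarrow> op_mult H S T x = S (T x)"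
  by (simp add: op_mult_def compose_def)

lemma op_add_apply [simp]: "x \<in> carrier H \<Longrightarrow> op_add H S T x = S x \<oplus>\<^bsub>H\<^esub> T x"
  by (simp add: op_add_def)

lemma op_smult_apply [simp]: "x \<in> carrier H \<Longrightarrow> op_smult H c T x = c \<odot>\<^bsub>H\<^esub> T x"
  by (simp add: op_smult_def)

lemma op_one_apply [simp]: "x \<in> carrier H \<Longrightarrow> op_one H x = x"
  by (simp add: op_one_def)

lemma commutant_in: "T \<in> commutant H S \<Longrightarrow> T \<in> bounded_ops H H"
  by (simp add: commutant_def)

lemma commutantD:
  assumes "T \<in> commutant H S" "A \<in> S" "x \<in> carrier H"
  shows "T (A x) = A (T x)"
proof -
  have "op_mult H T A = op_mult H A T" using assms unfolding commutant_def by blast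
  then have "op_mult H T A x = op_mult H A T x" by (rule fun_cong)
  then show ?thesis using assms(3) by simp
qed

lemma commutantI:
  assumes "T \<in> bounded_ops H H" "\<And>A x. \<lbrakk>A \<in> S; x \<in> carrier H\<rbrakk> \<Longrightarrow> T (A x) = A (T x)"
  shows "T \<in> commutant H S"
  using assms by (auto simp: commutant_def op_mult_def compose_def)

lemma commutant_antimono: "S \<subseteq> S' \<Longrightarrow> commutant H S' \<subseteq> commutant H S"
  by (auto simp: commutant_def)

lemma subset_bicommutant: "S \<subseteq> bounded_ops H H \<Longrightarrow> S \<subseteq> commutant H (commutant H S)"
  by (auto simp: commutant_def)

lemma tricommutant:
  assumes "S \<subseteq> bounded_ops H H"
  shows "commutant H (commutant H (commutant H S)) = commutant H S"
proof
  show "commutant H (commutant H (commutant H S)) \<subseteq> commutant H S"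
    using commutant_antimono[OF subset_bicommutant[OF assms]] .
  show "commutant H S \<subseteq> commutant H (commutant H (commutant H S))"
    by (rule subset_bicommutant) (auto simp: commutant_def)
qed

lemma commutant_adj:
  assumes H: "hilbert_space H" and S: "S \<subseteq> bounded_ops H H" and adj: "\<And>A. A \<in> S \<Longrightarrow> adj H H A \<in> S"
    and T: "T \<in> commutant H S"
  shows "adj H H T \<in> commutant H S"
proof (rule commutantI)
  have Tb: "T \<in> bounded_ops H H" using T by (rule commutant_in)
  show "adj H H T \<in> bounded_ops H H" using adj_in[OF H H Tb] .
  fix A x assume A: "A \<in> S" and x: "x \<in> carrier H"
  have Ab: "A \<in> bounded_ops H H" using A S by blast
  interpret hilbert_space H by fact
  note [simp] = bounded_ops_in[OF Tb] bounded_ops_in[OF Ab] bounded_ops_in[OF adj_in[OF H H Tb]]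
    bounded_ops_in[OF adj_in[OF H H Ab]]
  show "adj H H T (A x) = A (adj H H T x)"
  proof (rule vec_eqI)
    fix w assume w: "w \<in> carrier H"
    have "ip H w (A (adj H H T x)) = ip H (adj H H A w) (adj H H T x)"
      using w x by (simp add: adj_ip[OF H H Ab])
    also have "\<dots> = ip H (T (adj H H A w)) x" using w x by (simp add: adj_ip'[OF H H Tb])
    also have "\<dots> = ip H (adj H H A (T w)) x" using commutantD[OF T adj[OF A] w] by simp
    also have "\<dots> = ip H w (adj H H T (A x))" using w x by (simp add: adj_ip[OF H H Ab] adj_ip'[OF H H Tb])
    finally show "ip H w (adj H H T (A x)) = ip H w (A (adj H H T x))" by simp
  qed (use x in simp_all)
qed

lemma
  assumes H: "hilbert_space H" and S: "S \<subseteq> bounded_ops H H"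
  shows commutant_one: "op_one H \<in> commutant H S"
    and commutant_mult: "\<lbrakk>T \<in> commutant H S; T' \<in> commutant H S\<rbrakk> \<Longrightarrow> op_mult H T T' \<in> commutant H S"
    and commutant_add: "\<lbrakk>T \<in> commutant H S; T' \<in> commutant H S\<rbrakk> \<Longrightarrow> op_add H T T' \<in> commutant H S"
    and commutant_smult: "T \<in> commutant H S \<Longrightarrow> op_smult H c T \<in> commutant H S"
proof -
  have Sin: "A x \<in> carrier H" if "A \<in> S" "x \<in> carrier H" for A x
    using S that bounded_ops_in[of A H H x] by blast
  have Sadd: "A (x \<oplus>\<^bsub>H\<^esub> y) = A x \<oplus>\<^bsub>H\<^esub> A y" "A (c \<odot>\<^bsub>H\<^esub> x) = c \<odot>\<^bsub>H\<^esub> A x"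
    if "A \<in> S" "x \<in> carrier H" "y \<in> carrier H" for A x y c
    using S that bounded_ops_add[of A H H x y] bounded_ops_smult[of A H H x c] by blast+
  show "op_one H \<in> commutant H S"
    by (rule commutantI[OF op_one_in[OF H]]) (simp add: Sin)
  show "op_mult H T T' \<in> commutant H S" if T: "T \<in> commutant H S" "T' \<in> commutant H S"
    by (rule commutantI[OF op_mult_in[OF H commutant_in[OF T(1)] commutant_in[OF T(2)]]])
      (simp add: Sin commutantD[OF T(1)] commutantD[OF T(2)] bounded_ops_in[OF commutant_in[OF T(2)]])
  show "op_add H T T' \<in> commutant H S" if T: "T \<in> commutant H S" "T' \<in> commutant H S"
    by (rule commutantI[OF op_add_in[OF H commutant_in[OF T(1)] commutant_in[OF T(2)]]])
      (simp add: Sin commutantD[OF T(1)] commutantD[OF T(2)] Sadd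
        bounded_ops_in[OF commutant_in[OF T(1)]] bounded_ops_in[OF commutant_in[OF T(2)]])
  show "op_smult H c T \<in> commutant H S" if T: "T \<in> commutant H S"
    by (rule commutantI[OF op_smult_in[OF H commutant_in[OF T(1)]]])
      (simp add: Sin commutantD[OF T(1)] Sadd bounded_ops_in[OF commutant_in[OF T(1)]])
qed

lemma vna_bicommutant:
  assumes H: "hilbert_space H" and S: "S \<subseteq> bounded_ops H H" and adj: "\<And>A. A \<in> S \<Longrightarrow> adj H H A \<in> S"
  shows "von_neumann_algebra H (commutant H (commutant H S))"
  unfolding von_neumann_algebra_def
proof (intro conjI ballI H)
  have S': "commutant H S \<subseteq> bounded_ops H H" by (auto simp: commutant_def)
  show "commutant H (commutant H S) \<subseteq> bounded_ops H H" by (auto simp: commutant_def)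
  show "commutant H (commutant H (commutant H (commutant H S))) = commutant H (commutant H S)"
    by (rule tricommutant[OF S'])
  show "adj H H T \<in> commutant H (commutant H S)" if "T \<in> commutant H (commutant H S)" for T
    by (rule commutant_adj[OF H S' _ that]) (rule commutant_adj[OF H S adj])
qed

lemma vna_bounded_ops: "hilbert_space H \<Longrightarrow> von_neumann_algebra H (bounded_ops H H)"
  unfolding von_neumann_algebra_def
  using subset_bicommutant[of "bounded_ops H H" H] commutant_in[of _ H "commutant H (bounded_ops H H)"]
    adj_in[of H H] by blast

lemma
  assumes "von_neumann_algebra H M"
  shows vna_hilbert: "hilbert_space H"
    and vna_in: "a \<in> M \<Longrightarrow> a \<in> bounded_ops H H"
    and vna_adj: "a \<in> M \<Longrightarrow> adj H H a \<in> M"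
    and vna_one: "op_one H \<in> M"
    and vna_mult: "\<lbrakk>a \<in> M; b \<in> M\<rbrakk> \<Longrightarrow> op_mult H a b \<in> M"
    and vna_add: "\<lbrakk>a \<in> M; b \<in> M\<rbrakk> \<Longrightarrow> op_add H a b \<in> M"
    and vna_smult: "a \<in> M \<Longrightarrow> op_smult H c a \<in> M"
proof -
  show H: "hilbert_space H" "a \<in> M \<Longrightarrow> a \<in> bounded_ops H H" "a \<in> M \<Longrightarrow> adj H H a \<in> M"
    using assms by (auto simp: von_neumann_algebra_def)
  have M: "commutant H (commutant H M) = M" using assms by (simp add: von_neumann_algebra_def)
  have S: "commutant H M \<subseteq> bounded_ops H H" by (auto simp: commutant_def)
  note c = commutant_one[OF H(1) S] commutant_mult[OF H(1) S] commutant_add[OF H(1) S] commutant_smult[OF H(1) S]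
  show "op_one H \<in> M" "\<lbrakk>a \<in> M; b \<in> M\<rbrakk> \<Longrightarrow> op_mult H a b \<in> M"
    "\<lbrakk>a \<in> M; b \<in> M\<rbrakk> \<Longrightarrow> op_add H a b \<in> M" "a \<in> M \<Longrightarrow> op_smult H c a \<in> M"
    using c unfolding M by blast+
qed

lemma vna_memI:
  assumes "von_neumann_algebra H M" "T \<in> bounded_ops H H"
    and "\<And>u x. \<lbrakk>u \<in> commutant H M; x \<in> carrier H\<rbrakk> \<Longrightarrow> T (u x) = u (T x)"
  shows "T \<in> M"
proof -
  have "T \<in> commutant H (commutant H M)" by (rule commutantI) fact+
  then show ?thesis using assms(1) by (simp add: von_neumann_algebra_def)
qed

subsection \<open>Self-adjoint operators\<close>

definition qf :: "'h hilbert \<Rightarrow> ('h \<Rightarrow> 'h) \<Rightarrow> 'h \<Rightarrow> real" where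
  "qf H T x = Re (ip H x (T x))"

lemma self_adjoint_in: "self_adjoint H T \<Longrightarrow> T \<in> bounded_ops H H"
  by (simp add: self_adjoint_def)

lemma self_adjoint_iff:
  assumes H: "hilbert_space H" and T: "T \<in> bounded_ops H H"
  shows "self_adjoint H T \<longleftrightarrow> (\<forall>x\<in>carrier H. \<forall>y\<in>carrier H. ip H (T x) y = ip H x (T y))"
proof
  assume "self_adjoint H T"
  then have "adj H H T = T" by (simp add: self_adjoint_def)
  then show "\<forall>x\<in>carrier H. \<forall>y\<in>carrier H. ip H (T x) y = ip H x (T y)"
    using adj_ip[OF H H T] by simp
next
  assume "\<forall>x\<in>carrier H. \<forall>y\<in>carrier H. ip H (T x) y = ip H x (T y)"
  then have "adj H H T = T" by (intro adj_eqI[OF H T]) simp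
  then show "self_adjoint H T" using T by (simp add: self_adjoint_def)
qed

lemma self_adjoint_ip:
  assumes "hilbert_space H" "self_adjoint H T" "x \<in> carrier H" "y \<in> carrier H"
  shows "ip H (T x) y = ip H x (T y)"
  using assms self_adjoint_iff[OF assms(1) self_adjoint_in[OF assms(2)]] by blast

lemma self_adjoint_qf:
  assumes "hilbert_space H" "self_adjoint H T" "x \<in> carrier H"
  shows "ip H x (T x) = of_real (qf H T x)"
proof -
  interpret hilbert_space H by fact
  show ?thesis
    using self_adjoint_ip[OF assms assms(3)] ip_cnj[of x "T x"] bounded_ops_in[OF self_adjoint_in[OF assms(2)] assms(3)] assms(3)
    by (simp add: qf_def complex_eq_iff)
qed

lemma polarization:
  assumes H: "hilbert_space H" and T: "T \<in> bounded_ops H H" and x: "x \<in> carrier H" and y: "y \<in> carrier H"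
  shows "ip H x (T y) = (let q = (\<lambda>v. ip H v (T v)) in
    (q (x \<oplus>\<^bsub>H\<^esub> y) - q (x \<oplus>\<^bsub>H\<^esub> (- 1) \<odot>\<^bsub>H\<^esub> y)
      - \<i> * q (x \<oplus>\<^bsub>H\<^esub> \<i> \<odot>\<^bsub>H\<^esub> y) + \<i> * q (x \<oplus>\<^bsub>H\<^esub> (- \<i>) \<odot>\<^bsub>H\<^esub> y)) / 4)"
proof -
  interpret hilbert_space H by fact
  show ?thesis using x y
    by (simp add: Let_def bounded_ops_in[OF T] bounded_ops_add[OF T] bounded_ops_smult[OF T] algebra_simps)
qed

lemma bounded_ops_eqI_qf:
  assumes H: "hilbert_space H" and T: "T \<in> bounded_ops H H" and S: "S \<in> bounded_ops H H"
    and eq: "\<And>x. x \<in> carrier H \<Longrightarrow> ip H x (T x) = ip H x (S x)"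
  shows "T = S"
proof (rule bounded_ops_eqI_ip[OF H T S])
  interpret hilbert_space H by fact
  fix x y assume "x \<in> carrier H" "y \<in> carrier H"
  then show "ip H y (T x) = ip H y (S x)"
    unfolding polarization[OF H T \<open>y \<in> carrier H\<close> \<open>x \<in> carrier H\<close>]
      polarization[OF H S \<open>y \<in> carrier H\<close> \<open>x \<in> carrier H\<close>] by (simp add: Let_def eq)
qed

lemma self_adjointI_qf:
  assumes H: "hilbert_space H" and T: "T \<in> bounded_ops H H"
    and re: "\<And>x. x \<in> carrier H \<Longrightarrow> Im (ip H x (T x)) = 0"
  shows "self_adjoint H T"
proof -
  interpret hilbert_space H by fact
  have "adj H H T = T"
  proof (rule bounded_ops_eqI_qf[OF H adj_in[OF H H T] T])
    fix x assume x: "x \<in> carrier H"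
    have "ip H x (adj H H T x) = ip H (T x) x" using adj_ip'[OF H H T x x] .
    also have "\<dots> = cnj (ip H x (T x))" using x bounded_ops_in[OF T] by (intro ip_cnj) auto
    also have "\<dots> = ip H x (T x)" using re[OF x] by (simp add: complex_eq_iff)
    finally show "ip H x (adj H H T x) = ip H x (T x)" .
  qed
  then show ?thesis using T by (simp add: self_adjoint_def)
qed

lemma op_le_iff:
  assumes "hilbert_space H" "self_adjoint H S" "self_adjoint H T"
  shows "op_le H S T \<longleftrightarrow> (\<forall>x\<in>carrier H. qf H S x \<le> qf H T x)"
  using assms by (simp add: op_le_def self_adjoint_qf complex_nonneg_Reals_iff)

lemma op_le_refl [simp]: "op_le H T T"
  by (simp add: op_le_def)

lemma op_le_trans: "\<lbrakk>op_le H R S; op_le H S T\<rbrakk> \<Longrightarrow> op_le H R T"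
  unfolding op_le_def using nonneg_Reals_add_I[of "ip H _ (S _) - ip H _ (R _)" "ip H _ (T _) - ip H _ (S _)"]
  by fastforce

lemma op_le_antisym:
  assumes "hilbert_space H" "self_adjoint H S" "self_adjoint H T" "op_le H S T" "op_le H T S"
  shows "S = T"
proof (rule bounded_ops_eqI_qf[OF assms(1) self_adjoint_in[OF assms(2)] self_adjoint_in[OF assms(3)]])
  fix x assume x: "x \<in> carrier H"
  then have "qf H S x = qf H T x" using assms by (force simp: op_le_iff intro: antisym)
  then show "ip H x (S x) = ip H x (T x)" using x assms by (simp add: self_adjoint_qf)
qed

lemma positive_cauchy_schwarz:
  assumes H: "hilbert_space H" and T: "self_adjoint H T" and pos: "\<And>x. x \<in> carrier H \<Longrightarrow> 0 \<le> qf H T x"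
    and x: "x \<in> carrier H" and y: "y \<in> carrier H"
  shows "(cmod (ip H x (T y)))\<^sup>2 \<le> qf H T x * qf H T y"
proof (rule quadratic_nonneg_imp_bound)
  interpret hilbert_space H by fact
  have Tb: "T \<in> bounded_ops H H" using T by (rule self_adjoint_in)
  note [simp] = bounded_ops_in[OF Tb] bounded_ops_add[OF Tb] bounded_ops_smult[OF Tb]
  fix t
  have yx: "ip H y (T x) = cnj (ip H x (T y))"
    using self_adjoint_ip[OF H T y x] ip_cnj[of "T y" x] x y by simp
  have "0 \<le> qf H T (x \<oplus>\<^bsub>H\<^esub> t \<odot>\<^bsub>H\<^esub> y)" using x y by (intro pos) simp
  also have "ip H (x \<oplus>\<^bsub>H\<^esub> t \<odot>\<^bsub>H\<^esub> y) (T (x \<oplus>\<^bsub>H\<^esub> t \<odot>\<^bsub>H\<^esub> y))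
     = of_real (qf H T x) + (t * ip H x (T y) + cnj (t * ip H x (T y))) + of_real ((cmod t)\<^sup>2 * qf H T y)"
    using x y yx complex_norm_square[of t] by (simp add: self_adjoint_qf[OF H T] algebra_simps)
  then have "qf H T (x \<oplus>\<^bsub>H\<^esub> t \<odot>\<^bsub>H\<^esub> y) = qf H T x + 2 * Re (t * ip H x (T y)) + (cmod t)\<^sup>2 * qf H T y"
    unfolding qf_def[of H T "x \<oplus>\<^bsub>H\<^esub> t \<odot>\<^bsub>H\<^esub> y"] complex_add_cnj by simp
  finally show "0 \<le> qf H T x + 2 * Re (t * ip H x (T y)) + (cmod t)\<^sup>2 * qf H T y" .
qed (use pos y in auto)

subsection \<open>Directed families of self-adjoint operators\<close>

definition directed_in :: "'h hilbert \<Rightarrow> ('h \<Rightarrow> 'h) set \<Rightarrow> ('h \<Rightarrow> 'h) set \<Rightarrow> bool" where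
  "directed_in H M D \<longleftrightarrow> D \<noteq> {} \<and> D \<subseteq> {a \<in> M. self_adjoint H a} \<and>
     (\<forall>a\<in>D. \<forall>b\<in>D. \<exists>c\<in>D. op_le H a c \<and> op_le H b c)"

text \<open>\<open>D\<close> serves as a net indexed by itself; this is the filter of its
  tails.\<close>

definition op_net :: "'h hilbert \<Rightarrow> ('h \<Rightarrow> 'h) set \<Rightarrow> ('h \<Rightarrow> 'h) filter" where
  "op_net H D = (INF a0\<in>D. principal {a \<in> D. op_le H a0 a})"

definition weak_lim :: "'h hilbert \<Rightarrow> ('h \<Rightarrow> 'h) set \<Rightarrow> ('h \<Rightarrow> 'h) \<Rightarrow> bool" where
  "weak_lim H D s \<longleftrightarrow> (\<forall>x\<in>carrier H. \<forall>y\<in>carrier H. ((\<lambda>a. ip H x (a y)) \<longlongrightarrow> ip H x (s y)) (op_net H D))"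

lemma eventually_op_net:
  assumes "directed_in H M D"
  shows "eventually P (op_net H D) \<longleftrightarrow> (\<exists>a0\<in>D. \<forall>a\<in>D. op_le H a0 a \<longrightarrow> P a)"
proof -
  have "eventually P (op_net H D) \<longleftrightarrow> (\<exists>a0\<in>D. eventually P (principal {a \<in> D. op_le H a0 a}))"
    unfolding op_net_def
  proof (rule eventually_INF_base)
    show "D \<noteq> {}" using assms by (simp add: directed_in_def)
    fix a b assume "a \<in> D" "b \<in> D"
    then obtain c where "c \<in> D" "op_le H a c" "op_le H b c" using assms unfolding directed_in_def by blast
    then show "\<exists>x\<in>D. principal {c \<in> D. op_le H x c} \<le> inf (principal {c \<in> D. op_le H a c}) (principal {c \<in> D. op_le H b c})"
      by (intro bexI[of _ c]) (auto intro: op_le_trans)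
  qed
  then show ?thesis by (auto simp: eventually_principal)
qed

lemma op_net_nontrivial: "directed_in H M D \<Longrightarrow> op_net H D \<noteq> bot"
  unfolding trivial_limit_def eventually_op_net using op_le_refl by blast

lemma eventually_op_net_above: "\<lbrakk>directed_in H M D; a0 \<in> D\<rbrakk> \<Longrightarrow> \<forall>\<^sub>F a in op_net H D. a \<in> D \<and> op_le H a0 a"
  by (auto simp: eventually_op_net)

lemma eventually_op_net_in: "directed_in H M D \<Longrightarrow> \<forall>\<^sub>F a in op_net H D. a \<in> D"
proof -
  assume D: "directed_in H M D"
  then obtain a0 where "a0 \<in> D" by (auto simp: directed_in_def)
  from eventually_op_net_above[OF D this] show ?thesis by (rule eventually_mono) simp
qed

lemma directed_inD:
  assumes "directed_in H M D" "a \<in> D"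
  shows "a \<in> M" "self_adjoint H a"
  using assms by (auto simp: directed_in_def)

lemma weak_limI:
  assumes H: "hilbert_space H" and D: "directed_in H M D" and s: "s \<in> bounded_ops H H"
    and lim: "\<And>x. x \<in> carrier H \<Longrightarrow> ((\<lambda>a. ip H x (a x)) \<longlongrightarrow> ip H x (s x)) (op_net H D)"
  shows "weak_lim H D s"
  unfolding weak_lim_def
proof (intro ballI)
  interpret hilbert_space H by fact
  fix x y assume xy: "x \<in> carrier H" "y \<in> carrier H"
  define p where "p T = (let q = (\<lambda>v. ip H v (T v)) in
    (q (x \<oplus>\<^bsub>H\<^esub> y) - q (x \<oplus>\<^bsub>H\<^esub> (- 1) \<odot>\<^bsub>H\<^esub> y)
      - \<i> * q (x \<oplus>\<^bsub>H\<^esub> \<i> \<odot>\<^bsub>H\<^esub> y) + \<i> * q (x \<oplus>\<^bsub>H\<^esub> (- \<i>) \<odot>\<^bsub>H\<^esub> y)) / 4)" for T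
  have p: "ip H x (T y) = p T" if "T \<in> bounded_ops H H" for T
    unfolding p_def by (rule polarization[OF H that xy])
  have "(p \<longlongrightarrow> p s) (op_net H D)"
    unfolding p_def Let_def using xy by (intro tendsto_intros lim) simp_all
  moreover have "\<forall>\<^sub>F a in op_net H D. p a = ip H x (a y)"
    using eventually_op_net_in[OF D] by (rule eventually_mono) (use p directed_inD[OF D] self_adjoint_in in metis)
  ultimately show "((\<lambda>a. ip H x (a y)) \<longlongrightarrow> ip H x (s y)) (op_net H D)"
    unfolding p[OF s] by (rule Lim_transform_eventually)
qed

lemma monotone_net_tendsto_Sup:
  fixes f :: "('h \<Rightarrow> 'h) \<Rightarrow> real"
  assumes D: "directed_in H M D" and mono: "\<And>a b. \<lbrakk>a \<in> D; b \<in> D; op_le H a b\<rbrakk> \<Longrightarrow> f a \<le> f b"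
    and bound: "\<And>a. a \<in> D \<Longrightarrow> f a \<le> B"
  shows "(f \<longlongrightarrow> Sup (f ` D)) (op_net H D)"
proof (rule order_tendstoI)
  have bdd: "bdd_above (f ` D)" using bound by (intro bdd_aboveI[of _ B]) auto
  have ne: "f ` D \<noteq> {}" using D by (auto simp: directed_in_def)
  fix c
  { assume "c < Sup (f ` D)"
    then obtain a0 where a0: "a0 \<in> D" "c < f a0" using less_cSup_iff[OF ne bdd] by auto
    show "\<forall>\<^sub>F a in op_net H D. c < f a"
      using eventually_op_net_above[OF D a0(1)] by (rule eventually_mono) (use mono a0 in force) }
  { assume c: "Sup (f ` D) < c"
    show "\<forall>\<^sub>F a in op_net H D. f a < c"
      using eventually_op_net_in[OF D] by (rule eventually_mono)
        (use c cSup_upper[OF _ bdd] in \<open>meson imageI le_less_trans\<close>) }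
qed

abbreviation op_diff :: "'h hilbert \<Rightarrow> ('h \<Rightarrow> 'h) \<Rightarrow> ('h \<Rightarrow> 'h) \<Rightarrow> 'h \<Rightarrow> 'h" where
  "op_diff H S T \<equiv> op_add H S (op_smult H (- 1) T)"

lemma qf_op_diff:
  assumes "hilbert_space H" "S \<in> bounded_ops H H" "T \<in> bounded_ops H H" "x \<in> carrier H"
  shows "qf H (op_diff H S T) x = qf H S x - qf H T x"
proof -
  interpret hilbert_space H by fact
  show ?thesis using assms bounded_ops_in[OF assms(2)] bounded_ops_in[OF assms(3)] by (simp add: qf_def)
qed

lemma self_adjoint_op_diff:
  assumes H: "hilbert_space H" and "self_adjoint H S" "self_adjoint H T"
  shows "self_adjoint H (op_diff H S T)"
proof -
  note b = self_adjoint_in[OF assms(2)] self_adjoint_in[OF assms(3)]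
  show ?thesis
    using assms(2,3) op_add_in[OF H b(1) op_smult_in[OF H b(2)]]
    by (simp add: self_adjoint_def adj_op_add[OF H b(1) op_smult_in[OF H b(2)]] adj_op_smult[OF H b(2) b(2)])
qed

lemma qf_le:
  assumes H: "hilbert_space H" and T: "T \<in> bounded_ops H H" and x: "x \<in> carrier H"
    and C: "hnorm H (T x) \<le> C * hnorm H x"
  shows "qf H T x \<le> C * (hnorm H x)\<^sup>2"
proof -
  interpret hilbert_space H by (rule H)
  have "qf H T x \<le> hnorm H x * hnorm H (T x)"
    unfolding qf_def using complex_Re_le_cmod cauchy_schwarz[OF x bounded_ops_in[OF T x]] order_trans by blast
  also have "\<dots> \<le> hnorm H x * (C * hnorm H x)" using C x by (intro mult_left_mono) auto
  finally show ?thesis by (simp add: power2_eq_square mult_ac)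
qed

text \<open>
  Quadratic forms converge by monotonicity, hence sesquilinear forms converge by polarization;
  the limit is bounded because \<open>\<bar>\<langle>x, (a - a\<^sub>0) y\<rangle>\<bar>\<^sup>2\<close> is at most the product of the values of the form
  of \<open>a - a\<^sub>0 \<ge> 0\<close> at \<open>x\<close> and \<open>y\<close>.
\<close>

lemma vigier:
  assumes H: "hilbert_space H" and D: "directed_in H M D"
    and b: "self_adjoint H b" and ub: "\<And>a. a \<in> D \<Longrightarrow> op_le H a b"
  obtains t where "t \<in> bounded_ops H H" "weak_lim H D t"
proof -
  interpret hilbert_space H by fact
  note Dsa = directed_inD(2)[OF D]
  have Dq: "qf H a x \<le> qf H c x" if "a \<in> D" "c \<in> D" "op_le H a c" "x \<in> carrier H" for a c x
    using that op_le_iff[OF H Dsa Dsa] by blast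
  have Dub: "qf H a x \<le> qf H b x" if "a \<in> D" "x \<in> carrier H" for a x
    using that ub op_le_iff[OF H Dsa b] by blast
  define L where "L x = Sup ((\<lambda>a. qf H a x) ` D)" for x
  have qlim: "((\<lambda>a. ip H x (a x)) \<longlongrightarrow> of_real (L x)) (op_net H D)" if x: "x \<in> carrier H" for x
  proof -
    have "((\<lambda>a. qf H a x) \<longlongrightarrow> L x) (op_net H D)"
      unfolding L_def by (rule monotone_net_tendsto_Sup[OF D]) (use Dq Dub x in auto)
    then have "((\<lambda>a. complex_of_real (qf H a x)) \<longlongrightarrow> of_real (L x)) (op_net H D)"
      by (rule tendsto_of_real)
    moreover have "\<forall>\<^sub>F a in op_net H D. complex_of_real (qf H a x) = ip H x (a x)"
      using eventually_op_net_in[OF D] by (rule eventually_mono) (simp add: self_adjoint_qf[OF H Dsa x])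
    ultimately show ?thesis by (rule Lim_transform_eventually)
  qed
  define l where "l x y = (let q = (\<lambda>v. complex_of_real (L v)) in
    (q (x \<oplus>\<^bsub>H\<^esub> y) - q (x \<oplus>\<^bsub>H\<^esub> (- 1) \<odot>\<^bsub>H\<^esub> y)
      - \<i> * q (x \<oplus>\<^bsub>H\<^esub> \<i> \<odot>\<^bsub>H\<^esub> y) + \<i> * q (x \<oplus>\<^bsub>H\<^esub> (- \<i>) \<odot>\<^bsub>H\<^esub> y)) / 4)" for x y
  have llim: "((\<lambda>a. ip H x (a y)) \<longlongrightarrow> l x y) (op_net H D)"
    if xy: "x \<in> carrier H" "y \<in> carrier H" for x y
  proof -
    define p where "p T = (let q = (\<lambda>v. ip H v (T v)) in
      (q (x \<oplus>\<^bsub>H\<^esub> y) - q (x \<oplus>\<^bsub>H\<^esub> (- 1) \<odot>\<^bsub>H\<^esub> y)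
        - \<i> * q (x \<oplus>\<^bsub>H\<^esub> \<i> \<odot>\<^bsub>H\<^esub> y) + \<i> * q (x \<oplus>\<^bsub>H\<^esub> (- \<i>) \<odot>\<^bsub>H\<^esub> y)) / 4)" for T
    have "(p \<longlongrightarrow> l x y) (op_net H D)"
      unfolding p_def l_def Let_def using xy by (intro tendsto_intros qlim) simp_all
    moreover have "p a = ip H x (a y)" if "a \<in> D" for a
      unfolding p_def by (rule polarization[OF H self_adjoint_in[OF Dsa[OF that]] xy, symmetric])
    then have "\<forall>\<^sub>F a in op_net H D. p a = ip H x (a y)"
      using eventually_op_net_in[OF D] by (auto elim: eventually_mono)
    ultimately show ?thesis by (rule Lim_transform_eventually)
  qed
  note nt = op_net_nontrivial[OF D]
  have Dev: "\<forall>\<^sub>F a in op_net H D. a \<in> bounded_ops H H"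
    using eventually_op_net_in[OF D] by (rule eventually_mono) (rule self_adjoint_in[OF Dsa])
  have l_add: "l y (x \<oplus>\<^bsub>H\<^esub> x') = l y x + l y x'"
    if c: "y \<in> carrier H" "x \<in> carrier H" "x' \<in> carrier H" for x x' y
  proof (rule tendsto_unique[OF nt llim])
    show "((\<lambda>a. ip H y (a (x \<oplus>\<^bsub>H\<^esub> x'))) \<longlongrightarrow> l y x + l y x') (op_net H D)"
      by (rule Lim_transform_eventually[OF tendsto_add[OF llim llim]])
        (use c in \<open>auto intro!: eventually_mono[OF Dev] simp: bounded_ops_add[of _ H H] bounded_ops_in[of _ H H]\<close>)
  qed (use c in auto)
  have l_smult: "l y (c \<odot>\<^bsub>H\<^esub> x) = c * l y x" if c: "y \<in> carrier H" "x \<in> carrier H" for x y c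
  proof (rule tendsto_unique[OF nt llim])
    show "((\<lambda>a. ip H y (a (c \<odot>\<^bsub>H\<^esub> x))) \<longlongrightarrow> c * l y x) (op_net H D)"
      by (rule Lim_transform_eventually[OF tendsto_mult[OF tendsto_const llim]])
        (use c in \<open>auto intro!: eventually_mono[OF Dev] simp: bounded_ops_smult[of _ H H] bounded_ops_in[of _ H H]\<close>)
  qed (use c in auto)
  have l_addl: "l (y \<oplus>\<^bsub>H\<^esub> y') x = l y x + l y' x"
    if c: "y \<in> carrier H" "y' \<in> carrier H" "x \<in> carrier H" for x y y'
  proof (rule tendsto_unique[OF nt llim])
    show "((\<lambda>a. ip H (y \<oplus>\<^bsub>H\<^esub> y') (a x)) \<longlongrightarrow> l y x + l y' x) (op_net H D)"
      by (rule Lim_transform_eventually[OF tendsto_add[OF llim llim]])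
        (use c in \<open>auto intro!: eventually_mono[OF Dev] simp: bounded_ops_in[of _ H H]\<close>)
  qed (use c in auto)
  have l_smultl: "l (c \<odot>\<^bsub>H\<^esub> y) x = cnj c * l y x" if c: "y \<in> carrier H" "x \<in> carrier H" for x y c
  proof (rule tendsto_unique[OF nt llim])
    show "((\<lambda>a. ip H (c \<odot>\<^bsub>H\<^esub> y) (a x)) \<longlongrightarrow> cnj c * l y x) (op_net H D)"
      by (rule Lim_transform_eventually[OF tendsto_mult[OF tendsto_const llim]])
        (use c in \<open>auto intro!: eventually_mono[OF Dev] simp: bounded_ops_in[of _ H H]\<close>)
  qed (use c in auto)
  obtain a0 where a0: "a0 \<in> D" using D by (auto simp: directed_in_def)
  note a0b = self_adjoint_in[OF Dsa[OF a0]] and bb = self_adjoint_in[OF b]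
  obtain B0 where B0: "1 \<le> B0" "\<And>x. x \<in> carrier H \<Longrightarrow> hnorm H (a0 x) \<le> B0 * hnorm H x"
    using bounded_ops_bound[OF H a0b] by blast
  \<comment> \<open>\<open>b - a0\<close> dominates \<open>a - a0\<close> for every \<open>a\<close>
    in \<open>D\<close>, so one constant \<open>C\<close> controls the positive forms of all
    \<open>a - a0\<close> with \<open>a \<ge> a0\<close>.\<close>
  define d where "d = op_diff H b a0"
  have d: "d \<in> bounded_ops H H" unfolding d_def by (intro op_add_in op_smult_in H bb a0b)
  obtain C where C: "1 \<le> C" "\<And>x. x \<in> carrier H \<Longrightarrow> hnorm H (d x) \<le> C * hnorm H x"
    using bounded_ops_bound[OF H d] by blast
  have qd: "qf H d x \<le> C * (hnorm H x)\<^sup>2" if x: "x \<in> carrier H" for x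
    by (rule qf_le[OF H d x C(2)[OF x]])
  have bound: "cmod (l y x) \<le> (B0 + C) * hnorm H y * hnorm H x"
    if y: "y \<in> carrier H" and x: "x \<in> carrier H" for x y
  proof -
    have *: "cmod (ip H y (a x)) \<le> (B0 + C) * hnorm H y * hnorm H x" if a: "a \<in> D" "op_le H a0 a" for a
    proof -
      note ab = self_adjoint_in[OF Dsa[OF a(1)]]
      define p where "p = op_diff H a a0"
      have p: "self_adjoint H p" unfolding p_def by (intro self_adjoint_op_diff H Dsa a a0)
      have pq: "qf H p v = qf H a v - qf H a0 v" if "v \<in> carrier H" for v
        unfolding p_def by (rule qf_op_diff[OF H ab a0b that])
      have p0: "0 \<le> qf H p v" if "v \<in> carrier H" for v
        using pq[OF that] Dq[OF a0 a that] by simp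
      have p1: "qf H p v \<le> C * (hnorm H v)\<^sup>2" if "v \<in> carrier H" for v
        using pq[OF that] Dub[OF a(1) that] qd[OF that] qf_op_diff[OF H bb a0b that] unfolding d_def by simp
      have "(cmod (ip H y (p x)))\<^sup>2 \<le> qf H p y * qf H p x"
        by (rule positive_cauchy_schwarz[OF H p p0 y x])
      also have "\<dots> \<le> (C * (hnorm H y)\<^sup>2) * (C * (hnorm H x)\<^sup>2)"
        using p0 p1 x y C(1) by (intro mult_mono) auto
      also have "\<dots> = (C * hnorm H y * hnorm H x)\<^sup>2" by (simp add: power2_eq_square mult_ac)
      finally have 1: "cmod (ip H y (p x)) \<le> C * hnorm H y * hnorm H x"
        by (rule power2_le_imp_le) (use C x y in auto)
      have "cmod (ip H y (a0 x)) \<le> hnorm H y * hnorm H (a0 x)"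
        using cauchy_schwarz[OF y bounded_ops_in[OF a0b x]] .
      also have "\<dots> \<le> hnorm H y * (B0 * hnorm H x)" using B0(2)[OF x] y by (intro mult_left_mono) auto
      finally have 2: "cmod (ip H y (a0 x)) \<le> B0 * hnorm H y * hnorm H x" by (simp add: mult_ac)
      have "ip H y (a x) = ip H y (p x) + ip H y (a0 x)"
        using x y bounded_ops_in[OF ab x] bounded_ops_in[OF a0b x] by (simp add: p_def)
      then show ?thesis
        using 1 2 norm_triangle_ineq[of "ip H y (p x)" "ip H y (a0 x)"] by (simp add: algebra_simps)
    qed
    show ?thesis
    proof (rule tendsto_upperbound[OF tendsto_norm[OF llim[OF y x]] _ nt])
      show "\<forall>\<^sub>F a in op_net H D. cmod (ip H y (a x)) \<le> (B0 + C) * hnorm H y * hnorm H x"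
        using eventually_op_net_above[OF D a0] by (rule eventually_mono) (use * in blast)
    qed
  qed
  obtain t where t: "t \<in> bounded_ops H H"
    "\<And>x y. \<lbrakk>x \<in> carrier H; y \<in> carrier H\<rbrakk> \<Longrightarrow> ip H y (t x) = l y x"
    by (rule sesquilinear_form_operator[OF H H l_add l_smult l_addl l_smultl bound]) (use B0 C in simp_all)
  have "weak_lim H D t"
    unfolding weak_lim_def using llim t(2) by simp
  then show thesis using that t(1) by blast
qed

text \<open>An operator of the commutant moves to the left argument of the inner product as its
  adjoint, so commutation survives weak limits.\<close>

lemma vna_weak_closed:
  assumes M: "von_neumann_algebra H M" and D: "directed_in H M D"
    and t: "t \<in> bounded_ops H H" and lim: "weak_lim H D t"
  shows "t \<in> M"
proof (rule vna_memI[OF M t])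
  note H = vna_hilbert[OF M]
  interpret hilbert_space H by (rule H)
  fix u x assume u: "u \<in> commutant H M" and x: "x \<in> carrier H"
  note ub = commutant_in[OF u] and uab = adj_in[OF H H commutant_in[OF u]]
  note [simp] = bounded_ops_in[OF ub] bounded_ops_in[OF uab] bounded_ops_in[OF t]
  show "t (u x) = u (t x)"
  proof (rule vec_eqI)
    fix w assume w: "w \<in> carrier H"
    have "((\<lambda>a. ip H w (a (u x))) \<longlongrightarrow> ip H (adj H H u w) (t x)) (op_net H D)"
    proof (rule Lim_transform_eventually)
      show "((\<lambda>a. ip H (adj H H u w) (a x)) \<longlongrightarrow> ip H (adj H H u w) (t x)) (op_net H D)"
        using lim w x by (simp add: weak_lim_def)
      have "ip H (adj H H u w) (a x) = ip H w (a (u x))" if "a \<in> D" for a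
        using commutantD[OF u directed_inD(1)[OF D that] x] w
          adj_ip[OF H H ub bounded_ops_in[OF vna_in[OF M directed_inD(1)[OF D that]] x] w] by simp
      then show "\<forall>\<^sub>F a in op_net H D. ip H (adj H H u w) (a x) = ip H w (a (u x))"
        using eventually_op_net_in[OF D] by (auto elim: eventually_mono)
    qed
    moreover have "((\<lambda>a. ip H w (a (u x))) \<longlongrightarrow> ip H w (t (u x))) (op_net H D)"
      using lim w x by (simp add: weak_lim_def)
    ultimately have "ip H (adj H H u w) (t x) = ip H w (t (u x))"
      by (rule tendsto_unique[OF op_net_nontrivial[OF D]])
    then show "ip H w (t (u x)) = ip H w (u (t x))"
      using adj_ip[OF H H ub _ w, of "t x"] x by simp
  qed (use x in simp_all)
qed

lemma weak_lim_self_adjoint: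
  assumes H: "hilbert_space H" and D: "directed_in H M D"
    and t: "t \<in> bounded_ops H H" and lim: "weak_lim H D t"
  shows "self_adjoint H t"
proof (rule self_adjointI_qf[OF H t])
  fix x assume x: "x \<in> carrier H"
  have "((\<lambda>a. Im (ip H x (a x))) \<longlongrightarrow> Im (ip H x (t x))) (op_net H D)"
    using lim x by (intro tendsto_intros) (simp add: weak_lim_def)
  moreover have "((\<lambda>a. Im (ip H x (a x))) \<longlongrightarrow> 0) (op_net H D)"
  proof (rule Lim_transform_eventually[OF tendsto_const])
    show "\<forall>\<^sub>F a in op_net H D. 0 = Im (ip H x (a x))"
      using eventually_op_net_in[OF D] by (rule eventually_mono) (simp add: self_adjoint_qf[OF H directed_inD(2)[OF D] x])
  qed
  ultimately show "Im (ip H x (t x)) = 0" by (rule tendsto_unique[OF op_net_nontrivial[OF D]])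
qed

lemma weak_lim_qf: "\<lbrakk>weak_lim H D t; x \<in> carrier H\<rbrakk> \<Longrightarrow> ((\<lambda>a. qf H a x) \<longlongrightarrow> qf H t x) (op_net H D)"
  unfolding qf_def by (intro tendsto_intros) (simp add: weak_lim_def)

lemma op_lub_of_weak_lim:
  assumes M: "von_neumann_algebra H M" and D: "directed_in H M D"
    and t: "t \<in> bounded_ops H H" and lim: "weak_lim H D t"
  shows "op_lub H M D t"
  unfolding op_lub_def
proof (intro conjI ballI impI)
  note H = vna_hilbert[OF M]
  show "t \<in> M" by (rule vna_weak_closed[OF M D t lim])
  show tsa: "self_adjoint H t" by (rule weak_lim_self_adjoint[OF H D t lim])
  note nt = op_net_nontrivial[OF D]
  show "op_le H a t" if a: "a \<in> D" for a
    unfolding op_le_iff[OF H directed_inD(2)[OF D a] tsa]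
  proof
    fix x assume x: "x \<in> carrier H"
    show "qf H a x \<le> qf H t x"
    proof (rule tendsto_lowerbound[OF weak_lim_qf[OF lim x] _ nt])
      show "\<forall>\<^sub>F c in op_net H D. qf H a x \<le> qf H c x"
        using eventually_op_net_above[OF D a] by (rule eventually_mono)
          (use op_le_iff[OF H directed_inD(2)[OF D a] directed_inD(2)[OF D]] x in blast)
    qed
  qed
  show "op_le H t b" if b: "self_adjoint H b" and ub: "\<forall>a\<in>D. op_le H a b" for b
    unfolding op_le_iff[OF H tsa b]
  proof
    fix x assume x: "x \<in> carrier H"
    show "qf H t x \<le> qf H b x"
    proof (rule tendsto_upperbound[OF weak_lim_qf[OF lim x] _ nt])
      show "\<forall>\<^sub>F c in op_net H D. qf H c x \<le> qf H b x"
        using eventually_op_net_in[OF D] by (rule eventually_mono)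
          (use op_le_iff[OF H directed_inD(2)[OF D] b] ub x in blast)
    qed
  qed
qed

text \<open>\<open>vigier\<close> provides some weak limit, which is itself a least upper bound in
  \<open>M\<close>, and least upper bounds are unique. From here on normality can be handled as weak
  continuity along increasing nets.\<close>

lemma weak_lim_of_op_lub:
  assumes M: "von_neumann_algebra H M" and D: "directed_in H M D" and s: "op_lub H M D s"
  shows "weak_lim H D s"
proof -
  note H = vna_hilbert[OF M]
  have ssa: "self_adjoint H s" and ub: "op_le H a s" if "a \<in> D" for a
    using s that by (auto simp: op_lub_def)
  have ssa: "self_adjoint H s" using s by (simp add: op_lub_def)
  obtain t where t: "t \<in> bounded_ops H H" "weak_lim H D t"
    using vigier[OF H D ssa ub] by blast
  have "op_lub H M D t" by (rule op_lub_of_weak_lim[OF M D t])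
  then have "s = t" using s op_le_antisym[OF H ssa] unfolding op_lub_def by blast
  then show ?thesis using t by simp
qed

text \<open>Convergence is required only for quadratic forms and only along \<open>D\<close>;
  polarization and monotonicity supply the rest.\<close>

lemma normal_mapI:
  assumes M: "von_neumann_algebra H M" and N: "von_neumann_algebra K N"
    and maps: "\<And>a. a \<in> M \<Longrightarrow> \<Phi> a \<in> N"
    and sa: "\<And>a. \<lbrakk>a \<in> M; self_adjoint H a\<rbrakk> \<Longrightarrow> self_adjoint K (\<Phi> a)"
    and mono: "\<And>a b. \<lbrakk>a \<in> M; b \<in> M; self_adjoint H a; self_adjoint H b; op_le H a b\<rbrakk> \<Longrightarrow> op_le K (\<Phi> a) (\<Phi> b)"
    and lim: "\<And>D s x. \<lbrakk>directed_in H M D; s \<in> M; weak_lim H D s; x \<in> carrier K\<rbrakk>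
      \<Longrightarrow> ((\<lambda>a. ip K x (\<Phi> a x)) \<longlongrightarrow> ip K x (\<Phi> s x)) (op_net H D)"
  shows "normal_map H M K N \<Phi>"
  unfolding normal_map_def
proof (intro allI impI)
  note K = vna_hilbert[OF N]
  fix D s
  assume D: "D \<noteq> {}" "D \<subseteq> {a \<in> M. self_adjoint H a}" "\<forall>a\<in>D. \<forall>b\<in>D. \<exists>c\<in>D. op_le H a c \<and> op_le H b c"
    and s: "op_lub H M D s"
  have dir: "directed_in H M D" using D by (simp add: directed_in_def)
  have sM: "s \<in> M" using s by (simp add: op_lub_def)
  have monoD: "op_le K (\<Phi> a) (\<Phi> b)" if "a \<in> D" "b \<in> D" "op_le H a b" for a b
    using that D(2) by (intro mono) auto
  have dir': "directed_in K N (\<Phi> ` D)"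
    unfolding directed_in_def
  proof (intro conjI)
    show "\<forall>a\<in>\<Phi> ` D. \<forall>b\<in>\<Phi> ` D. \<exists>c\<in>\<Phi> ` D. op_le K a c \<and> op_le K b c"
    proof (intro ballI)
      fix a b assume "a \<in> \<Phi> ` D" "b \<in> \<Phi> ` D"
      then obtain a' b' where ab: "a' \<in> D" "b' \<in> D" "a = \<Phi> a'" "b = \<Phi> b'" by blast
      then obtain c where "c \<in> D" "op_le H a' c" "op_le H b' c" using D(3) by blast
      then show "\<exists>c\<in>\<Phi> ` D. op_le K a c \<and> op_le K b c" using ab monoD by blast
    qed
  qed (use D maps sa in auto)
  have slim: "weak_lim H D s" by (rule weak_lim_of_op_lub[OF M dir s])
  have sb: "\<Phi> s \<in> bounded_ops K K" using vna_in[OF N maps[OF sM]] .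
  note sa' = directed_inD(2)[OF dir']
  have mono': "qf K a x \<le> qf K b x" if "a \<in> \<Phi> ` D" "b \<in> \<Phi> ` D" "op_le K a b" "x \<in> carrier K" for a b x
    using that op_le_iff[OF K sa' sa'] by blast
  have "weak_lim K (\<Phi> ` D) (\<Phi> s)"
  proof (rule weak_limI[OF K dir' sb])
    fix x assume x: "x \<in> carrier K"
    note l = lim[OF dir sM slim x]
    have rel: "((\<lambda>a. qf K (\<Phi> a) x) \<longlongrightarrow> qf K (\<Phi> s) x) (op_net H D)"
      unfolding qf_def by (intro tendsto_intros l)
    have up: "qf K (\<Phi> a) x \<le> qf K (\<Phi> s) x" if a: "a \<in> D" for a
    proof (rule tendsto_lowerbound[OF rel _ op_net_nontrivial[OF dir]])
      show "\<forall>\<^sub>F c in op_net H D. qf K (\<Phi> a) x \<le> qf K (\<Phi> c) x"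
        using eventually_op_net_above[OF dir a] by (rule eventually_mono) (use mono' monoD a x in blast)
    qed
    \<comment> \<open>A tail of the image in the order of \<open>K\<close> need not come from a tail
      of \<open>D\<close>. Since the values increase, their limit is recovered as a supremum, which
      depends only on the set of values.\<close>
    have "((\<lambda>a. qf K a x) \<longlongrightarrow> qf K (\<Phi> s) x) (op_net K (\<Phi> ` D))"
    proof (rule order_tendstoI)
      fix c assume "c < qf K (\<Phi> s) x"
      then have "\<forall>\<^sub>F a in op_net H D. c < qf K (\<Phi> a) x" using order_tendstoD(1)[OF rel] by blast
      then obtain a where a: "a \<in> D" "c < qf K (\<Phi> a) x"
        unfolding eventually_op_net[OF dir] using op_le_refl by blast
      have "\<forall>\<^sub>F b in op_net K (\<Phi> ` D). b \<in> \<Phi> ` D \<and> op_le K (\<Phi> a) b"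
        using a by (intro eventually_op_net_above[OF dir']) auto
      then show "\<forall>\<^sub>F b in op_net K (\<Phi> ` D). c < qf K b x"
        by (rule eventually_mono) (use mono'[of "\<Phi> a" _ x] a x in force)
    next
      fix c assume "qf K (\<Phi> s) x < c"
      then show "\<forall>\<^sub>F b in op_net K (\<Phi> ` D). qf K b x < c"
        using eventually_op_net_in[OF dir'] by (auto elim!: eventually_mono dest: up)
    qed
    then have 1: "((\<lambda>a. complex_of_real (qf K a x)) \<longlongrightarrow> of_real (qf K (\<Phi> s) x)) (op_net K (\<Phi> ` D))"
      by (rule tendsto_of_real)
    have 2: "complex_of_real (qf K (\<Phi> s) x) = ip K x (\<Phi> s x)"
    proof (rule tendsto_unique[OF op_net_nontrivial[OF dir] _ l])
      show "((\<lambda>a. ip K x (\<Phi> a x)) \<longlongrightarrow> complex_of_real (qf K (\<Phi> s) x)) (op_net H D)"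
      proof (rule Lim_transform_eventually[OF tendsto_of_real[OF rel]])
        show "\<forall>\<^sub>F a in op_net H D. complex_of_real (qf K (\<Phi> a) x) = ip K x (\<Phi> a x)"
          using eventually_op_net_in[OF dir] by (rule eventually_mono) (use self_adjoint_qf[OF K sa' x] in auto)
      qed
    qed
    show "((\<lambda>a. ip K x (a x)) \<longlongrightarrow> ip K x (\<Phi> s x)) (op_net K (\<Phi> ` D))"
      unfolding 2[symmetric]
    proof (rule Lim_transform_eventually[OF 1])
      show "\<forall>\<^sub>F a in op_net K (\<Phi> ` D). complex_of_real (qf K a x) = ip K x (a x)"
        using eventually_op_net_in[OF dir'] by (rule eventually_mono) (use self_adjoint_qf[OF K sa' x] in auto)
    qed
  qed
  then show "op_lub K N (\<Phi> ` D) (\<Phi> s)" by (rule op_lub_of_weak_lim[OF N dir' sb])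
qed

text \<open>Monotonicity comes from the directed set \<open>{a, b}\<close> for \<open>a \<le> b\<close>.\<close>

lemma
  assumes n: "normal_map H M K N \<Phi>" and a: "a \<in> M" "self_adjoint H a"
  shows normal_map_self_adjoint: "self_adjoint K (\<Phi> a)"
    and normal_map_mono: "\<lbrakk>b \<in> M; self_adjoint H b; op_le H b a\<rbrakk> \<Longrightarrow> op_le K (\<Phi> b) (\<Phi> a)"
proof -
  have lub: "op_lub K N (\<Phi> ` {b, a}) (\<Phi> a)" if b: "b \<in> M" "self_adjoint H b" "op_le H b a" for b
  proof -
    have "op_lub H M {b, a} a" using a b by (auto simp: op_lub_def)
    moreover have "{b, a} \<noteq> {}" "{b, a} \<subseteq> {a \<in> M. self_adjoint H a}"
      "\<forall>x\<in>{b, a}. \<forall>y\<in>{b, a}. \<exists>c\<in>{b, a}. op_le H x c \<and> op_le H y c"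
      using a b by auto
    ultimately show ?thesis
      using n[unfolded normal_map_def, THEN spec[of _ "{b, a}"], THEN spec[of _ a]] by blast
  qed
  show "self_adjoint K (\<Phi> a)" using lub[OF a op_le_refl] by (simp add: op_lub_def)
  show "op_le K (\<Phi> b) (\<Phi> a)" if "b \<in> M" "self_adjoint H b" "op_le H b a"
    using lub[OF that] by (simp add: op_lub_def)
qed

text \<open>Besides the limit itself, the lemma records that the image is directed with weak limit
  \<open>\<Phi> s\<close> and that \<open>\<Phi>\<close> carries tails to tails. These facts allow
  limits to be chained through several normal maps.\<close>

lemma normal_mapD:
  assumes M: "von_neumann_algebra H M" and N: "von_neumann_algebra K N"
    and n: "normal_map H M K N \<Phi>" and \<Phi>: "\<And>a. a \<in> M \<Longrightarrow> \<Phi> a \<in> N"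
    and D: "directed_in H M D" and s: "s \<in> M" "weak_lim H D s"
    and xy: "x \<in> carrier K" "y \<in> carrier K"
  shows "((\<lambda>a. ip K x (\<Phi> a y)) \<longlongrightarrow> ip K x (\<Phi> s y)) (op_net H D)"
    and "directed_in K N (\<Phi> ` D)" and "weak_lim K (\<Phi> ` D) (\<Phi> s)"
    and "filterlim \<Phi> (op_net K (\<Phi> ` D)) (op_net H D)"
proof -
  have Dsa: "a \<in> M" "self_adjoint H a" if "a \<in> D" for a using directed_inD[OF D that] by auto
  have mono: "op_le K (\<Phi> a) (\<Phi> b)" if "a \<in> D" "b \<in> D" "op_le H a b" for a b
    using that by (intro normal_map_mono[OF n Dsa Dsa]) auto
  show dir': "directed_in K N (\<Phi> ` D)"
    unfolding directed_in_def
  proof (intro conjI)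
    show "\<forall>a\<in>\<Phi> ` D. \<forall>b\<in>\<Phi> ` D. \<exists>c\<in>\<Phi> ` D. op_le K a c \<and> op_le K b c"
    proof (intro ballI)
      fix a b assume "a \<in> \<Phi> ` D" "b \<in> \<Phi> ` D"
      then obtain a' b' where ab: "a' \<in> D" "b' \<in> D" "a = \<Phi> a'" "b = \<Phi> b'" by blast
      then obtain c where "c \<in> D" "op_le H a' c" "op_le H b' c" using D unfolding directed_in_def by blast
      then show "\<exists>c\<in>\<Phi> ` D. op_le K a c \<and> op_le K b c" using ab mono by blast
    qed
    show "\<Phi> ` D \<noteq> {}" using D by (simp add: directed_in_def)
    show "\<Phi> ` D \<subseteq> {a \<in> N. self_adjoint K a}"
      using Dsa \<Phi> normal_map_self_adjoint[OF n] by auto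
  qed
  have "op_lub H M D s"
    by (rule op_lub_of_weak_lim[OF M D vna_in[OF M s(1)] s(2)])
  then have "op_lub K N (\<Phi> ` D) (\<Phi> s)"
    using n[unfolded normal_map_def, THEN spec[of _ D], THEN spec[of _ s]] D[unfolded directed_in_def] by blast
  then show wl: "weak_lim K (\<Phi> ` D) (\<Phi> s)" by (rule weak_lim_of_op_lub[OF N dir'])
  show "filterlim \<Phi> (op_net K (\<Phi> ` D)) (op_net H D)"
    unfolding filterlim_iff
  proof (intro allI impI)
    fix P assume "eventually P (op_net K (\<Phi> ` D))"
    then obtain a0 where a0: "a0 \<in> D" "\<And>b. \<lbrakk>b \<in> \<Phi> ` D; op_le K (\<Phi> a0) b\<rbrakk> \<Longrightarrow> P b"
      unfolding eventually_op_net[OF dir'] by blast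
    show "\<forall>\<^sub>F a in op_net H D. P (\<Phi> a)"
      using eventually_op_net_above[OF D a0(1)] by (rule eventually_mono) (use a0 mono in blast)
  qed
  then show "((\<lambda>a. ip K x (\<Phi> a y)) \<longlongrightarrow> ip K x (\<Phi> s y)) (op_net H D)"
    using wl xy filterlim_compose[of "\<lambda>b. ip K x (b y)" _ "op_net K (\<Phi> ` D)" \<Phi> "op_net H D"]
    by (simp add: weak_lim_def)
qed

subsection \<open>The Hilbert space of a positive definite kernel\<close>

text \<open>The sesquilinear form with Gram matrix \<open>k\<close>, namely the sum of all
  \<open>cnj c * d * k i j\<close>; the double conjugation expresses it through \<open>ev\<close>
  alone.\<close>

definition kf :: "('i \<Rightarrow> 'i \<Rightarrow> complex) \<Rightarrow> (complex \<times> 'i) list \<Rightarrow> (complex \<times> 'i) list \<Rightarrow> complex" where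
  "kf k xs ys = cnj (ev (\<lambda>i. cnj (ev (k i) ys)) xs)"

definition psd_kernel :: "('i \<Rightarrow> 'i \<Rightarrow> complex) \<Rightarrow> bool" where
  "psd_kernel k \<longleftrightarrow> (\<forall>xs. kf k xs xs \<in> \<real>\<^sub>\<ge>\<^sub>0)"

definition kn :: "('i \<Rightarrow> 'i \<Rightarrow> complex) \<Rightarrow> (complex \<times> 'i) list \<Rightarrow> real" where
  "kn k xs = sqrt (Re (kf k xs xs))"

abbreviation kdiff :: "(complex \<times> 'i) list \<Rightarrow> (complex \<times> 'i) list \<Rightarrow> (complex \<times> 'i) list" where
  "kdiff xs ys \<equiv> xs @ sc (- 1) ys"

lemma kf_simps [simp]:
  "kf k [] ys = 0" "kf k xs [] = 0"
  "kf k (xs @ xs') ys = kf k xs ys + kf k xs' ys" "kf k xs (ys @ ys') = kf k xs ys + kf k xs ys'"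
  "kf k (sc t xs) ys = cnj t * kf k xs ys" "kf k xs (sc t ys) = t * kf k xs ys"
proof -
  have "ev (\<lambda>i. 0) xs = 0" by (induction xs) auto
  then show "kf k xs [] = 0" by (simp add: kf_def)
qed (simp_all add: kf_def ev_add ev_scale)

lemma kf_Cons: "kf k ((c, i) # xs) ys = cnj c * ev (k i) ys + kf k xs ys"
  by (simp add: kf_def)

lemma kf_single: "kf k [(1, i)] ys = ev (k i) ys"
  by (simp add: kf_def)

definition kcauchy :: "('i \<Rightarrow> 'i \<Rightarrow> complex) \<Rightarrow> (nat \<Rightarrow> (complex \<times> 'i) list) \<Rightarrow> bool" where
  "kcauchy k c \<longleftrightarrow> (\<forall>e>0. \<exists>N. \<forall>m\<ge>N. \<forall>n\<ge>N. kn k (kdiff (c m) (c n)) < e)"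

text \<open>A vector of the completion is encoded by its inner products with the kernel vectors.\<close>

definition krep :: "('i \<Rightarrow> 'i \<Rightarrow> complex) \<Rightarrow> (nat \<Rightarrow> (complex \<times> 'i) list) \<Rightarrow> ('i \<Rightarrow> complex) \<Rightarrow> bool" where
  "krep k c f \<longleftrightarrow> kcauchy k c \<and> (\<forall>i. (\<lambda>n. ev (k i) (c n)) \<longlonglongrightarrow> f i)"

text \<open>\<open>SOME\<close> picks representing sequences; \<open>kip_tendsto\<close> shows that
  any other choice gives the same limit.\<close>

definition kip :: "('i \<Rightarrow> 'i \<Rightarrow> complex) \<Rightarrow> ('i \<Rightarrow> complex) \<Rightarrow> ('i \<Rightarrow> complex) \<Rightarrow> complex" where
  "kip k f g = lim (\<lambda>n. kf k ((SOME c. krep k c f) n) ((SOME c. krep k c g) n))"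

definition rkhs :: "('i \<Rightarrow> 'i \<Rightarrow> complex) \<Rightarrow> ('i \<Rightarrow> complex) hilbert" where
  "rkhs k = \<lparr>carrier = {f. \<exists>c. krep k c f}, monoid.mult = (\<lambda>f g. f), one = (\<lambda>_. 0), zero = (\<lambda>_. 0),
     add = (\<lambda>f g i. f i + g i), smult = (\<lambda>c f i. c * f i), ip = kip k\<rparr>"

context
  fixes k :: "'i \<Rightarrow> 'i \<Rightarrow> complex"
  assumes psd: "psd_kernel k"
begin

lemma kf_nonneg: "0 \<le> Re (kf k xs xs)" and kf_real: "Im (kf k xs xs) = 0"
  using psd by (auto simp: psd_kernel_def complex_nonneg_Reals_iff)

text \<open>Nonnegativity includes being real. Applied to the combinations with coefficients
  \<open>1, 1\<close> and \<open>1, \<i>\<close> this gives the real and the imaginary part of the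
  symmetry.\<close>

lemma psd_hermitian: "k i j = cnj (k j i)"
proof -
  have "Im (k l l) = 0" for l using kf_real[of "[(1, l)]"] by (simp add: kf_def)
  then show ?thesis
    using kf_real[of "[(1, i), (1, j)]"] kf_real[of "[(1, i), (\<i>, j)]"]
    by (simp add: kf_def complex_eq_iff)
qed

lemma kf_cnj: "kf k xs ys = cnj (kf k ys xs)"
proof (induction xs)
  case (Cons p xs)
  obtain c i where p: "p = (c, i)" by fastforce
  have "kf k ys [(c, i)] = c * cnj (ev (k i) ys)"
    unfolding kf_def by (simp add: ev_scale[of "cnj c"] psd_hermitian[of _ i])
  moreover have "kf k ys (p # xs) = kf k ys [(c, i)] + kf k ys xs"
    using kf_simps(4)[of k ys "[p]" xs] by (simp add: p)
  ultimately show ?case using Cons by (simp add: p kf_Cons)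
qed simp

lemma kn_nonneg: "0 \<le> kn k xs"
  by (simp add: kn_def kf_nonneg)

lemma kn_sq: "(kn k xs)\<^sup>2 = Re (kf k xs xs)"
  by (simp add: kn_def kf_nonneg)

lemma kf_self: "kf k xs xs = of_real ((kn k xs)\<^sup>2)"
  by (simp add: kn_sq complex_eq_iff kf_real)

lemma kf_cauchy_schwarz: "cmod (kf k xs ys) \<le> kn k xs * kn k ys"
proof -
  have "(cmod (kf k xs ys))\<^sup>2 \<le> (kn k xs)\<^sup>2 * (kn k ys)\<^sup>2"
  proof (rule quadratic_nonneg_imp_bound)
    fix t
    have "kf k (xs @ sc t ys) (xs @ sc t ys)
        = of_real ((kn k xs)\<^sup>2) + (t * kf k xs ys + cnj (t * kf k xs ys)) + of_real ((cmod t)\<^sup>2 * (kn k ys)\<^sup>2)"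
      using kf_cnj[of ys xs] complex_norm_square[of t] by (simp add: kf_self algebra_simps)
    then show "0 \<le> (kn k xs)\<^sup>2 + 2 * Re (t * kf k xs ys) + (cmod t)\<^sup>2 * (kn k ys)\<^sup>2"
      using kf_nonneg[of "xs @ sc t ys"] unfolding complex_add_cnj by simp
  qed simp
  then show ?thesis
    using kn_nonneg by (simp add: power_mult_distrib[symmetric] abs_le_square_iff[symmetric])
qed

lemma kn_append: "kn k (xs @ ys) \<le> kn k xs + kn k ys"
proof -
  have "Re (kf k xs ys) \<le> kn k xs * kn k ys"
    using kf_cauchy_schwarz complex_Re_le_cmod order_trans by blast
  moreover have "Re (kf k ys xs) = Re (kf k xs ys)" using kf_cnj[of ys xs] by simp
  ultimately have "(kn k (xs @ ys))\<^sup>2 \<le> (kn k xs + kn k ys)\<^sup>2"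
    by (simp add: power2_sum kn_sq)
  then show ?thesis using kn_nonneg by (simp add: abs_le_square_iff[symmetric])
qed

lemma kn_sc: "kn k (sc t xs) = cmod t * kn k xs"
proof -
  have "(kn k (sc t xs))\<^sup>2 = (cmod t * kn k xs)\<^sup>2"
    using cmod_power2[of t] by (simp add: kn_sq[of "sc t xs"] kf_self power_mult_distrib)
      (simp add: power2_eq_square algebra_simps)
  then show ?thesis using kn_nonneg by (simp add: power2_eq_iff_nonneg)
qed

text \<open>Lists with the same kernel values denote the same vector, so lists may be regrouped
  inside \<open>kn\<close>.\<close>

lemma kn_cong:
  assumes "\<And>i. ev (k i) xs = ev (k i) ys"
  shows "kn k xs = kn k ys"
proof -
  have "kf k zs xs = kf k zs ys" for zs unfolding kf_def assms ..
  then have "kf k xs xs = kf k ys ys" using kf_cnj[of xs ys] kf_cnj[of ys ys] by metis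
  then show ?thesis by (simp add: kn_def)
qed

lemma kcauchy_bounded:
  assumes "kcauchy k c"
  obtains B where "0 < B" "\<And>n. kn k (c n) \<le> B"
proof -
  obtain N where N: "\<And>n. n \<ge> N \<Longrightarrow> kn k (kdiff (c n) (c N)) < 1"
    using assms unfolding kcauchy_def by (meson order_refl zero_less_one)
  define B where "B = Max ((\<lambda>n. kn k (c n)) ` {..N}) + 1"
  have le: "kn k (c n) \<le> Max ((\<lambda>n. kn k (c n)) ` {..N})" if "n \<le> N" for n
    using that by (intro Max_ge) auto
  have "kn k (c n) \<le> B" for n
  proof (cases "n \<le> N")
    case True
    then show ?thesis using le[OF True] unfolding B_def by linarith
  next
    case False
    have "kn k (c n) = kn k (kdiff (c n) (c N) @ c N)" by (rule kn_cong) simp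
    then show ?thesis
      using kn_append[of "kdiff (c n) (c N)" "c N"] N[of n] le[OF order_refl] False
      unfolding B_def by linarith
  qed
  moreover have "0 < B" using le[of 0] kn_nonneg[of "c 0"] unfolding B_def by linarith
  ultimately show thesis using that by blast
qed

lemma kcauchy_append:
  assumes "kcauchy k c" "kcauchy k d"
  shows "kcauchy k (\<lambda>n. c n @ d n)"
  unfolding kcauchy_def
proof (intro allI impI)
  fix e :: real assume e: "0 < e"
  obtain N N' where N: "\<And>m n. \<lbrakk>m \<ge> N; n \<ge> N\<rbrakk> \<Longrightarrow> kn k (kdiff (c m) (c n)) < e / 2"
    "\<And>m n. \<lbrakk>m \<ge> N'; n \<ge> N'\<rbrakk> \<Longrightarrow> kn k (kdiff (d m) (d n)) < e / 2"
    using assms e unfolding kcauchy_def by (meson half_gt_zero)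
  have "kn k (kdiff (c m @ d m) (c n @ d n)) < e" if "m \<ge> max N N'" "n \<ge> max N N'" for m n
  proof -
    have "kn k (kdiff (c m @ d m) (c n @ d n)) = kn k (kdiff (c m) (c n) @ kdiff (d m) (d n))"
      by (rule kn_cong) simp
    also have "\<dots> \<le> kn k (kdiff (c m) (c n)) + kn k (kdiff (d m) (d n))" by (rule kn_append)
    also have "\<dots> < e" using N(1)[of m n] N(2)[of m n] that by simp
    finally show ?thesis .
  qed
  then show "\<exists>N. \<forall>m\<ge>N. \<forall>n\<ge>N. kn k (kdiff (c m @ d m) (c n @ d n)) < e" by blast
qed

lemma kcauchy_sc:
  assumes "kcauchy k c"
  shows "kcauchy k (\<lambda>n. sc t (c n))"
  unfolding kcauchy_def
proof (intro allI impI)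
  fix e :: real assume e: "0 < e"
  have p: "0 < cmod t + 1" using norm_ge_zero[of t] by linarith
  then have "0 < e / (cmod t + 1)" using e by simp
  then obtain N where N: "\<And>m n. \<lbrakk>m \<ge> N; n \<ge> N\<rbrakk> \<Longrightarrow> kn k (kdiff (c m) (c n)) < e / (cmod t + 1)"
    using assms unfolding kcauchy_def by meson
  have "kn k (kdiff (sc t (c m)) (sc t (c n))) < e" if "m \<ge> N" "n \<ge> N" for m n
  proof -
    have "kn k (kdiff (sc t (c m)) (sc t (c n))) = kn k (sc t (kdiff (c m) (c n)))"
      by (rule kn_cong) (simp add: algebra_simps)
    also have "\<dots> \<le> (cmod t + 1) * kn k (kdiff (c m) (c n))" by (simp add: kn_sc distrib_right kn_nonneg)
    also have "\<dots> < e" using N[OF that] p by (simp add: pos_less_divide_eq mult.commute)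
    finally show ?thesis .
  qed
  then show "\<exists>N. \<forall>m\<ge>N. \<forall>n\<ge>N. kn k (kdiff (sc t (c m)) (sc t (c n))) < e" by blast
qed

lemma krep_append: "\<lbrakk>krep k c f; krep k d g\<rbrakk> \<Longrightarrow> krep k (\<lambda>n. c n @ d n) (\<lambda>i. f i + g i)"
  by (auto simp: krep_def intro!: kcauchy_append tendsto_intros)

lemma krep_sc: "krep k c f \<Longrightarrow> krep k (\<lambda>n. sc t (c n)) (\<lambda>i. t * f i)"
  by (auto simp: krep_def intro!: kcauchy_sc tendsto_intros)

lemma krep_const: "krep k (\<lambda>_. xs) (\<lambda>i. ev (k i) xs)"
proof -
  have "kn k (kdiff xs xs) = kn k []" by (rule kn_cong) simp
  then show ?thesis by (simp add: krep_def kcauchy_def kn_def)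
qed

lemma kf_tendsto: "krep k c f \<Longrightarrow> (\<lambda>n. kf k xs (c n)) \<longlonglongrightarrow> cnj (ev (\<lambda>i. cnj (f i)) xs)"
  unfolding kf_def krep_def by (intro tendsto_cnj ev_tendsto) auto

text \<open>A norm-Cauchy sequence that tends weakly to zero tends to zero in norm:
  \<open>\<parallel>c\<^sub>n\<parallel>\<^sup>2\<close> is \<open>\<langle>c\<^sub>n - c\<^sub>N,
  c\<^sub>n\<rangle> + \<langle>c\<^sub>N, c\<^sub>n\<rangle>\<close>, where the first term is small
  by the Cauchy property and the second by weak convergence.\<close>

lemma krep_null:
  assumes c: "krep k c (\<lambda>_. 0)"
  shows "(\<lambda>n. kn k (c n)) \<longlonglongrightarrow> 0"
proof -
  have cau: "kcauchy k c" using c by (simp add: krep_def)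
  obtain B where B: "0 < B" "\<And>n. kn k (c n) \<le> B" using kcauchy_bounded[OF cau] by blast
  have "(\<lambda>n. (kn k (c n))\<^sup>2) \<longlonglongrightarrow> 0"
  proof (rule LIMSEQ_I)
    fix e :: real assume e: "0 < e"
    then have "0 < e / (2 * B)" using B by simp
    then obtain N where N: "\<And>n. n \<ge> N \<Longrightarrow> kn k (kdiff (c n) (c N)) < e / (2 * B)"
      using cau unfolding kcauchy_def by (meson order_refl)
    have ev0: "cnj (ev (\<lambda>i. cnj 0) xs) = 0" for xs :: "(complex \<times> 'i) list" by (induction xs) auto
    have "(\<lambda>n. kf k (c N) (c n)) \<longlonglongrightarrow> 0"
      using kf_tendsto[OF c, of "c N"] unfolding ev0 .
    then obtain N' where N': "\<And>n. n \<ge> N' \<Longrightarrow> cmod (kf k (c N) (c n)) < e / 2"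
      using LIMSEQ_D[of _ 0 "e / 2"] e by (metis diff_zero half_gt_zero)
    have "(kn k (c n))\<^sup>2 < e" if n: "n \<ge> max N N'" for n
    proof -
      have "kf k (c n) (c n) = kf k (kdiff (c n) (c N)) (c n) + kf k (c N) (c n)" by simp
      then have "(kn k (c n))\<^sup>2 \<le> cmod (kf k (kdiff (c n) (c N)) (c n)) + cmod (kf k (c N) (c n))"
        unfolding kn_sq by (metis complex_Re_le_cmod norm_triangle_ineq order_trans)
      also have "cmod (kf k (kdiff (c n) (c N)) (c n)) \<le> kn k (kdiff (c n) (c N)) * kn k (c n)"
        by (rule kf_cauchy_schwarz)
      also have "\<dots> \<le> e / (2 * B) * B"
        using N[of n] n B e kn_nonneg by (intro mult_mono) (auto intro: less_imp_le)
      also have "\<dots> = e / 2" using B by simp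
      also have "cmod (kf k (c N) (c n)) < e / 2" using N'[of n] n by simp
      finally show ?thesis by simp
    qed
    then show "\<exists>no. \<forall>n\<ge>no. norm ((kn k (c n))\<^sup>2 - 0) < e" by (intro exI[of _ "max N N'"]) simp
  qed
  then have "(\<lambda>n. sqrt ((kn k (c n))\<^sup>2)) \<longlonglongrightarrow> sqrt 0" by (rule tendsto_real_sqrt)
  then show ?thesis using kn_nonneg by simp
qed

lemma kf_null:
  assumes c: "krep k c (\<lambda>_. 0)" and d: "kcauchy k d"
  shows "(\<lambda>n. kf k (c n) (d n)) \<longlonglongrightarrow> 0"
proof -
  obtain B where B: "0 < B" "\<And>n. kn k (d n) \<le> B" using kcauchy_bounded[OF d] by blast
  show ?thesis
  proof (rule Lim_null_comparison)
    have "cmod (kf k (c n) (d n)) \<le> kn k (c n) * B" for n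
      using kf_cauchy_schwarz[of "c n" "d n"] mult_left_mono[OF B(2)[of n] kn_nonneg[of "c n"]] by linarith
    then show "\<forall>\<^sub>F n in sequentially. norm (kf k (c n) (d n)) \<le> kn k (c n) * B" by simp
    show "(\<lambda>n. kn k (c n) * B) \<longlonglongrightarrow> 0" using tendsto_mult_left_zero[OF krep_null[OF c]] .
  qed
qed

lemma kf_convergent:
  assumes c: "kcauchy k c" and d: "kcauchy k d"
  shows "convergent (\<lambda>n. kf k (c n) (d n))"
proof (rule Cauchy_convergent, rule CauchyI)
  fix e :: real assume e: "0 < e"
  obtain B where B: "0 < B" "\<And>n. kn k (d n) \<le> B" using kcauchy_bounded[OF d] by blast
  obtain C where C: "0 < C" "\<And>n. kn k (c n) \<le> C" using kcauchy_bounded[OF c] by blast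
  have "0 < e / (2 * B)" "0 < e / (2 * C)" using e B C by simp_all
  then obtain N N' where N: "\<And>m n. \<lbrakk>m \<ge> N; n \<ge> N\<rbrakk> \<Longrightarrow> kn k (kdiff (c m) (c n)) < e / (2 * B)"
    "\<And>m n. \<lbrakk>m \<ge> N'; n \<ge> N'\<rbrakk> \<Longrightarrow> kn k (kdiff (d m) (d n)) < e / (2 * C)"
    using c d unfolding kcauchy_def by meson
  have "cmod (kf k (c m) (d m) - kf k (c n) (d n)) < e" if mn: "m \<ge> max N N'" "n \<ge> max N N'" for m n
  proof -
    have "kf k (c m) (d m) - kf k (c n) (d n) = kf k (kdiff (c m) (c n)) (d m) + kf k (c n) (kdiff (d m) (d n))"
      by simp
    then have "cmod (kf k (c m) (d m) - kf k (c n) (d n))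
        \<le> cmod (kf k (kdiff (c m) (c n)) (d m)) + cmod (kf k (c n) (kdiff (d m) (d n)))"
      by (metis norm_triangle_ineq)
    also have "\<dots> \<le> kn k (kdiff (c m) (c n)) * kn k (d m) + kn k (c n) * kn k (kdiff (d m) (d n))"
      by (intro add_mono kf_cauchy_schwarz)
    also have "\<dots> \<le> kn k (kdiff (c m) (c n)) * B + C * kn k (kdiff (d m) (d n))"
      using B C kn_nonneg by (intro add_mono mult_left_mono mult_right_mono) auto
    also have "\<dots> < e / (2 * B) * B + C * (e / (2 * C))"
      using N(1)[of m n] N(2)[of m n] mn B C by (intro add_strict_mono mult_strict_right_mono mult_strict_left_mono) auto
    also have "\<dots> = e" using B C by simp
    finally show ?thesis .
  qed
  then show "\<exists>M. \<forall>m\<ge>M. \<forall>n\<ge>M. norm (kf k (c m) (d m) - kf k (c n) (d n)) < e" by blast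
qed

text \<open>Two sequences representing the same function differ by a sequence representing 0, which
  by \<open>kf_null\<close> contributes nothing to the limit.\<close>

lemma kip_tendsto:
  assumes c: "krep k c f" and d: "krep k d g"
  shows "(\<lambda>n. kf k (c n) (d n)) \<longlonglongrightarrow> kip k f g"
proof -
  define c' where "c' = (SOME c. krep k c f)"
  define d' where "d' = (SOME c. krep k c g)"
  have c': "krep k c' f" unfolding c'_def by (rule someI[of "\<lambda>c. krep k c f", OF c])
  have d': "krep k d' g" unfolding d'_def by (rule someI[of "\<lambda>c. krep k c g", OF d])
  have cau: "kcauchy k c'" "kcauchy k d'" "kcauchy k d" "kcauchy k c"
    using c' d' d c by (simp_all add: krep_def)
  have lim: "(\<lambda>n. kf k (c' n) (d' n)) \<longlonglongrightarrow> kip k f g"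
    using kf_convergent[OF cau(1,2)] unfolding kip_def c'_def d'_def convergent_LIMSEQ_iff .
  have z: "krep k (\<lambda>n. kdiff (c n) (c' n)) (\<lambda>_. 0)" "krep k (\<lambda>n. kdiff (d n) (d' n)) (\<lambda>_. 0)"
    using krep_append[OF c krep_sc[OF c', of "- 1"]] krep_append[OF d krep_sc[OF d', of "- 1"]] by simp_all
  have 1: "(\<lambda>n. kf k (kdiff (c n) (c' n)) (d n)) \<longlonglongrightarrow> 0" by (rule kf_null[OF z(1) cau(3)])
  have "(\<lambda>n. cnj (kf k (kdiff (d n) (d' n)) (c' n))) \<longlonglongrightarrow> cnj 0" by (intro tendsto_cnj kf_null z cau)
  then have 2: "(\<lambda>n. kf k (c' n) (kdiff (d n) (d' n))) \<longlonglongrightarrow> 0"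
    by (simp only: kf_cnj[symmetric] complex_cnj_zero)
  show ?thesis using tendsto_add[OF tendsto_add[OF 1 2] lim] by (simp add: algebra_simps)
qed

lemma rkhs_carrier_iff: "f \<in> carrier (rkhs k) \<longleftrightarrow> (\<exists>c. krep k c f)"
  by (simp add: rkhs_def)

lemma rkhs_simps [simp]:
  "f \<oplus>\<^bsub>rkhs k\<^esub> g = (\<lambda>i. f i + g i)" "c \<odot>\<^bsub>rkhs k\<^esub> f = (\<lambda>i. c * f i)" "\<zero>\<^bsub>rkhs k\<^esub> = (\<lambda>_. 0)"
  "ip (rkhs k) = kip k"
  by (simp_all add: rkhs_def)

lemma rkhs_add_in: "\<lbrakk>f \<in> carrier (rkhs k); g \<in> carrier (rkhs k)\<rbrakk> \<Longrightarrow> (\<lambda>i. f i + g i) \<in> carrier (rkhs k)"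
  unfolding rkhs_carrier_iff using krep_append by blast

lemma rkhs_smult_in: "f \<in> carrier (rkhs k) \<Longrightarrow> (\<lambda>i. c * f i) \<in> carrier (rkhs k)"
  unfolding rkhs_carrier_iff using krep_sc by blast

lemma rkhs_ev_in: "(\<lambda>i. ev (k i) xs) \<in> carrier (rkhs k)"
  unfolding rkhs_carrier_iff using krep_const by blast

lemma rkhs_module: "Module.module complex_ring (rkhs k)"
proof (intro Module.module.intro cring_complex_ring Module.module_axioms.intro)
  show "abelian_group (rkhs k)"
  proof (rule abelian_groupI)
    show "\<zero>\<^bsub>rkhs k\<^esub> \<in> carrier (rkhs k)" using rkhs_ev_in[of "[]"] by simp
    show "\<exists>y\<in>carrier (rkhs k). y \<oplus>\<^bsub>rkhs k\<^esub> x = \<zero>\<^bsub>rkhs k\<^esub>" if "x \<in> carrier (rkhs k)" for x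
      using rkhs_smult_in[OF that, of "- 1"] by (intro bexI[of _ "\<lambda>i. - 1 * x i"]) simp_all
  qed (simp_all add: rkhs_add_in algebra_simps)
qed (simp_all add: rkhs_smult_in algebra_simps)

lemma rkhs_inner_product_space: "inner_product_space (rkhs k)"
proof (intro inner_product_space.intro rkhs_module inner_product_space_axioms.intro)
  fix f g h c
  assume f: "f \<in> carrier (rkhs k)"
  then obtain cf where cf: "krep k cf f" by (auto simp: rkhs_carrier_iff)
  have self: "(\<lambda>n. kf k (cf n) (cf n)) \<longlonglongrightarrow> kip k f f" by (rule kip_tendsto[OF cf cf])
  show "0 \<le> Re (ip (rkhs k) f f)"
    using tendsto_Re[OF self] kf_nonneg by (auto intro: LIMSEQ_le_const)
  show "f = \<zero>\<^bsub>rkhs k\<^esub>" if "ip (rkhs k) f f = 0"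
  proof -
    have "(\<lambda>n. sqrt (Re (kf k (cf n) (cf n)))) \<longlonglongrightarrow> sqrt (Re 0)"
      using self that by (intro tendsto_intros) simp
    then have n: "(\<lambda>n. kn k (cf n)) \<longlonglongrightarrow> 0" by (simp add: kn_def)
    have "f i = 0" for i
    proof -
      have "(\<lambda>n. ev (k i) (cf n)) \<longlonglongrightarrow> 0"
      proof (rule Lim_null_comparison)
        show "\<forall>\<^sub>F n in sequentially. norm (ev (k i) (cf n)) \<le> kn k [(1, i)] * kn k (cf n)"
          using kf_cauchy_schwarz[of "[(1, i)]"] by (simp add: kf_single)
        show "(\<lambda>n. kn k [(1, i)] * kn k (cf n)) \<longlonglongrightarrow> 0" using tendsto_mult_right_zero[OF n] .
      qed
      then show ?thesis using cf LIMSEQ_unique unfolding krep_def by blast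
    qed
    then show ?thesis by auto
  qed
  assume g: "g \<in> carrier (rkhs k)"
  then obtain cg where cg: "krep k cg g" by (auto simp: rkhs_carrier_iff)
  have "(\<lambda>n. cnj (kf k (cg n) (cf n))) \<longlonglongrightarrow> cnj (kip k g f)" by (intro tendsto_cnj kip_tendsto cf cg)
  then have "(\<lambda>n. kf k (cf n) (cg n)) \<longlonglongrightarrow> cnj (kip k g f)" by (simp only: kf_cnj[symmetric])
  then show "ip (rkhs k) f g = cnj (ip (rkhs k) g f)"
    using kip_tendsto[OF cf cg] LIMSEQ_unique by simp
  show "ip (rkhs k) f (c \<odot>\<^bsub>rkhs k\<^esub> g) = c * ip (rkhs k) f g"
    using LIMSEQ_unique[OF kip_tendsto[OF cf krep_sc[OF cg, of c]]] tendsto_mult[OF tendsto_const kip_tendsto[OF cf cg], of c]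
    by simp
  assume h: "h \<in> carrier (rkhs k)"
  then obtain ch where ch: "krep k ch h" by (auto simp: rkhs_carrier_iff)
  show "ip (rkhs k) f (g \<oplus>\<^bsub>rkhs k\<^esub> h) = ip (rkhs k) f g + ip (rkhs k) f h"
    using LIMSEQ_unique[OF kip_tendsto[OF cf krep_append[OF cg ch]]]
      tendsto_add[OF kip_tendsto[OF cf cg] kip_tendsto[OF cf ch]]
    by simp
qed

lemma rkhs_diff:
  assumes "f \<in> carrier (rkhs k)" "g \<in> carrier (rkhs k)"
  shows "f \<ominus>\<^bsub>rkhs k\<^esub> g = (\<lambda>i. f i - g i)"
proof -
  interpret inner_product_space "rkhs k" by (rule rkhs_inner_product_space)
  have "\<ominus>\<^bsub>rkhs k\<^esub> g = (- 1) \<odot>\<^bsub>rkhs k\<^esub> g"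
    using assms by (intro vec_eqI) (simp_all del: rkhs_simps)
  then show ?thesis by (simp add: a_minus_def)
qed

lemma hnorm_rkhs_ev: "hnorm (rkhs k) (\<lambda>i. ev (k i) xs) = kn k xs"
proof -
  have "kip k (\<lambda>i. ev (k i) xs) (\<lambda>i. ev (k i) xs) = kf k xs xs"
    using kip_tendsto[OF krep_const[of xs] krep_const[of xs]] by (simp add: LIMSEQ_const_iff)
  then show ?thesis by (simp add: hnorm_def kn_def)
qed

lemma rkhs_dense:
  assumes f: "krep k c f" and e: "0 < e"
  shows "\<exists>N. \<forall>m\<ge>N. hnorm (rkhs k) (\<lambda>i. f i - ev (k i) (c m)) \<le> e"
proof -
  have "kcauchy k c" using f by (simp add: krep_def)
  then obtain N where N: "\<And>m n. \<lbrakk>m \<ge> N; n \<ge> N\<rbrakk> \<Longrightarrow> kn k (kdiff (c m) (c n)) < e"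
    using e unfolding kcauchy_def by meson
  have "hnorm (rkhs k) (\<lambda>i. f i - ev (k i) (c m)) \<le> e" if m: "m \<ge> N" for m
  proof -
    define d where "d = (\<lambda>n. kdiff (c n) (c m))"
    have "krep k d (\<lambda>i. f i - ev (k i) (c m))"
      using krep_append[OF f krep_sc[OF krep_const[of "c m"], of "- 1"]] by (simp add: d_def)
    then have "(\<lambda>n. sqrt (Re (kf k (d n) (d n)))) \<longlonglongrightarrow> hnorm (rkhs k) (\<lambda>i. f i - ev (k i) (c m))"
      unfolding hnorm_def by (intro tendsto_intros) (simp add: kip_tendsto)
    moreover have "sqrt (Re (kf k (d n) (d n))) \<le> e" if "n \<ge> N" for n
      using N[OF that m] unfolding kn_def d_def by (rule less_imp_le)
    ultimately show ?thesis by (intro LIMSEQ_le_const2) auto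
  qed
  then show ?thesis by blast
qed

text \<open>Diagonal argument: the \<open>n\<close>-th vector is replaced by a combination
  \<open>d n\<close> within \<open>1 / Suc n\<close>. The sequence \<open>d\<close> is then
  \<open>kcauchy\<close>, and the function that it represents is the limit.\<close>

lemma rkhs_hilbert: "hilbert_space (rkhs k)"
proof (rule hilbert_spaceI[OF rkhs_inner_product_space])
  interpret inner_product_space "rkhs k" by (rule rkhs_inner_product_space)
  fix s :: "nat \<Rightarrow> 'i \<Rightarrow> complex"
  assume s: "\<And>n. s n \<in> carrier (rkhs k)"
    and cau: "\<And>e. 0 < e \<Longrightarrow> \<exists>N. \<forall>m\<ge>N. \<forall>n\<ge>N. hnorm (rkhs k) (s m \<ominus>\<^bsub>rkhs k\<^esub> s n) < e"
  define E where "E xs = (\<lambda>i. ev (k i) xs)" for xs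
  have E: "E xs \<in> carrier (rkhs k)" for xs by (simp add: E_def rkhs_ev_in)
  have "\<exists>xs. hnorm (rkhs k) (s n \<ominus>\<^bsub>rkhs k\<^esub> E xs) \<le> 1 / Suc n" for n
  proof -
    obtain c where "krep k c (s n)" using s[of n] by (auto simp: rkhs_carrier_iff)
    from rkhs_dense[OF this, of "1 / Suc n"] show ?thesis
      using rkhs_diff[OF s E] by (auto simp: E_def)
  qed
  then obtain d where d: "hnorm (rkhs k) (s n \<ominus>\<^bsub>rkhs k\<^esub> E (d n)) \<le> 1 / Suc n" for n by metis
  have kE: "kn k (kdiff xs ys) = hnorm (rkhs k) (E xs \<ominus>\<^bsub>rkhs k\<^esub> E ys)" for xs ys
    using hnorm_rkhs_ev[of "kdiff xs ys"] rkhs_diff[OF E E] by (simp add: E_def)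
  have small: "\<exists>N. \<forall>n\<ge>N. 1 / real (Suc n) < e" if "0 < e" for e
    using LIMSEQ_D[OF LIMSEQ_inverse_real_of_nat that] by (simp add: inverse_eq_divide)
  have dc: "kcauchy k d"
    unfolding kcauchy_def
  proof (intro allI impI)
    fix e :: real assume "0 < e"
    then have e: "0 < e / 3" by simp
    obtain N1 where N1: "\<And>n. n \<ge> N1 \<Longrightarrow> 1 / real (Suc n) < e / 3" using small[OF e] by blast
    obtain N2 where N2: "\<And>m n. \<lbrakk>m \<ge> N2; n \<ge> N2\<rbrakk> \<Longrightarrow> hnorm (rkhs k) (s m \<ominus>\<^bsub>rkhs k\<^esub> s n) < e / 3"
      using cau[OF e] by blast
    have "kn k (kdiff (d m) (d n)) < e" if mn: "m \<ge> max N1 N2" "n \<ge> max N1 N2" for m n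
    proof -
      have "kn k (kdiff (d m) (d n)) \<le> hnorm (rkhs k) (E (d m) \<ominus>\<^bsub>rkhs k\<^esub> s m)
          + (hnorm (rkhs k) (s m \<ominus>\<^bsub>rkhs k\<^esub> s n) + hnorm (rkhs k) (s n \<ominus>\<^bsub>rkhs k\<^esub> E (d n)))"
        unfolding kE using hnorm_diff_triangle[OF E s E] hnorm_diff_triangle[OF s s E] by (meson add_left_mono order_trans)
      also have "hnorm (rkhs k) (E (d m) \<ominus>\<^bsub>rkhs k\<^esub> s m) = hnorm (rkhs k) (s m \<ominus>\<^bsub>rkhs k\<^esub> E (d m))"
        by (rule hnorm_diff_commute[OF E s])
      finally show ?thesis using d[of m] d[of n] N1[of m] N1[of n] N2[of m n] mn by simp
    qed
    then show "\<exists>N. \<forall>m\<ge>N. \<forall>n\<ge>N. kn k (kdiff (d m) (d n)) < e" by blast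
  qed
  have "convergent (\<lambda>n. ev (k i) (d n))" for i
    using kf_convergent[of "\<lambda>_. [(1, i)]", OF _ dc] krep_const[of "[(1, i)]"]
    by (simp add: kf_single krep_def)
  then have x: "krep k d (\<lambda>i. lim (\<lambda>n. ev (k i) (d n)))"
    using dc by (simp add: krep_def convergent_LIMSEQ_iff)
  define x where "x = (\<lambda>i. lim (\<lambda>n. ev (k i) (d n)))"
  have xin: "x \<in> carrier (rkhs k)" using x by (auto simp: x_def rkhs_carrier_iff)
  have "(\<lambda>n. hnorm (rkhs k) (s n \<ominus>\<^bsub>rkhs k\<^esub> x)) \<longlonglongrightarrow> 0"
  proof (rule LIMSEQ_I)
    fix e :: real assume "0 < e"
    then have e: "0 < e / 3" by simp
    obtain N1 where N1: "\<And>n. n \<ge> N1 \<Longrightarrow> 1 / real (Suc n) < e / 3" using small[OF e] by blast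
    obtain N2 where N2: "\<And>n. n \<ge> N2 \<Longrightarrow> hnorm (rkhs k) (x \<ominus>\<^bsub>rkhs k\<^esub> E (d n)) \<le> e / 3"
      using rkhs_dense[OF x e] rkhs_diff[OF xin E] by (auto simp: x_def E_def)
    have "hnorm (rkhs k) (s n \<ominus>\<^bsub>rkhs k\<^esub> x) < e" if n: "n \<ge> max N1 N2" for n
      using hnorm_diff_triangle[OF s E xin, of n "d n"] hnorm_diff_commute[OF E xin, of "d n"]
        d[of n] N1[of n] N2[of n] n \<open>0 < e\<close> by simp
    then show "\<exists>no. \<forall>n\<ge>no. norm (hnorm (rkhs k) (s n \<ominus>\<^bsub>rkhs k\<^esub> x) - 0) < e"
      using s xin by (intro exI[of _ "max N1 N2"]) simp
  qed
  then show "\<exists>x\<in>carrier (rkhs k). (\<lambda>n. hnorm (rkhs k) (s n \<ominus>\<^bsub>rkhs k\<^esub> x)) \<longlonglongrightarrow> 0"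
    using xin by blast
qed

lemma rkhs_vector_in: "(\<lambda>j. k j i) \<in> carrier (rkhs k)"
  using rkhs_ev_in[of "[(1, i)]"] by simp

lemma rkhs_reproducing:
  assumes "f \<in> carrier (rkhs k)"
  shows "ip (rkhs k) (\<lambda>j. k j i) f = f i"
proof -
  obtain c where c: "krep k c f" using assms by (auto simp: rkhs_carrier_iff)
  have "(\<lambda>n. kf k [(1, i)] (c n)) \<longlonglongrightarrow> kip k (\<lambda>j. k j i) f"
    using kip_tendsto[OF krep_const[of "[(1, i)]"] c] by simp
  then show ?thesis using c LIMSEQ_unique unfolding kf_single krep_def rkhs_simps by blast
qed

lemma rkhs_total: "total_family (rkhs k) (\<lambda>i j. k j i)"
  by (auto simp: total_family_def rkhs_vector_in rkhs_reproducing simp del: rkhs_simps(4))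

end

lemma kernel_hilbert_space:
  fixes k :: "'i \<Rightarrow> 'i \<Rightarrow> complex"
  assumes "psd_kernel k"
  obtains H :: "('i \<Rightarrow> complex) hilbert" and e where "hilbert_space H" "total_family H e" "\<And>i j. ip H (e i) (e j) = k i j"
  using that[OF rkhs_hilbert[OF assms] rkhs_total[OF assms]]
    rkhs_reproducing[OF assms rkhs_vector_in[OF assms]] by blast

lemma ip_lc_lc:
  assumes "hilbert_space H" "\<And>i. e i \<in> carrier H" "\<And>i. f i \<in> carrier H"
  shows "ip H (lc H e xs) (lc H f ys) = kf (\<lambda>i j. ip H (e i) (f j)) xs ys"
proof -
  interpret hilbert_space H by fact
  have "ip H (lc H e xs) w = cnj (ev (\<lambda>i. cnj (ip H (e i) w)) xs)" if "w \<in> carrier H" for w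
    using ip_cnj[of "lc H e xs" w] ip_cnj[of w "e _"] ip_lc[of e w] assms(2) that by simp
  from this[of "lc H f ys"] show ?thesis
    using ip_lc[of f "e _" ys] assms(2,3) by (simp add: kf_def)
qed

subsection \<open>Normal representations are quasi-contained in the defining one\<close>

definition unit_interval :: "'h hilbert \<Rightarrow> ('h \<Rightarrow> 'h) set \<Rightarrow> ('h \<Rightarrow> 'h) set" where
  "unit_interval H M = {a \<in> M. self_adjoint H a \<and> (\<forall>x\<in>carrier H. 0 \<le> qf H a x \<and> qf H a x \<le> (hnorm H x)\<^sup>2)}"

lemma self_adjoint_op_one: "hilbert_space H \<Longrightarrow> self_adjoint H (op_one H)"
  by (simp add: self_adjoint_def op_one_in adj_op_one)

lemma self_adjoint_op_add:
  assumes "hilbert_space H" "self_adjoint H S" "self_adjoint H T"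
  shows "self_adjoint H (op_add H S T)"
  using assms op_add_in[OF assms(1), of S T] by (simp add: self_adjoint_def adj_op_add)

lemma self_adjoint_op_smult:
  assumes "hilbert_space H" "self_adjoint H S"
  shows "self_adjoint H (op_smult H (of_real r) S)"
  using assms op_smult_in[OF assms(1), of S "of_real r"] by (simp add: self_adjoint_def adj_op_smult[of _ _ S])

lemma self_adjoint_sandwich:
  assumes H: "hilbert_space H" and S: "S \<in> bounded_ops H H" and T: "self_adjoint H T"
  shows "self_adjoint H (op_mult H (adj H H S) (op_mult H T S))"
proof (rule self_adjointI_qf[OF H])
  note Tb = self_adjoint_in[OF T]
  show "op_mult H (adj H H S) (op_mult H T S) \<in> bounded_ops H H"
    by (intro op_mult_in H adj_in S Tb)
  fix x assume x: "x \<in> carrier H"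
  then show "Im (ip H x (op_mult H (adj H H S) (op_mult H T S) x)) = 0"
    using self_adjoint_qf[OF H T bounded_ops_in[OF S x]] adj_ip'[OF H H S x bounded_ops_in[OF Tb bounded_ops_in[OF S x]]]
    by simp
qed

lemma qf_sandwich:
  assumes H: "hilbert_space H" and S: "S \<in> bounded_ops H H" and T: "T \<in> bounded_ops H H" and x: "x \<in> carrier H"
  shows "qf H (op_mult H (adj H H S) (op_mult H T S)) x = qf H T (S x)"
  using adj_ip'[OF H H S x bounded_ops_in[OF T bounded_ops_in[OF S x]]] x by (simp add: qf_def)

lemma qf_op_add:
  assumes "hilbert_space H" "S \<in> bounded_ops H H" "T \<in> bounded_ops H H" "x \<in> carrier H"
  shows "qf H (op_add H S T) x = qf H S x + qf H T x"
proof -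
  interpret hilbert_space H by fact
  show ?thesis using assms bounded_ops_in[OF assms(2)] bounded_ops_in[OF assms(3)] by (simp add: qf_def)
qed

lemma qf_op_smult:
  assumes "hilbert_space H" "S \<in> bounded_ops H H" "x \<in> carrier H"
  shows "qf H (op_smult H (of_real r) S) x = r * qf H S x"
proof -
  interpret hilbert_space H by fact
  show ?thesis using assms bounded_ops_in[OF assms(2)] by (simp add: qf_def)
qed

lemma qf_op_one: "\<lbrakk>hilbert_space H; x \<in> carrier H\<rbrakk> \<Longrightarrow> qf H (op_one H) x = (hnorm H x)\<^sup>2"
proof -
  assume "hilbert_space H" and x: "x \<in> carrier H"
  interpret hilbert_space H by fact
  show ?thesis using x by (simp add: qf_def hnorm_sq)
qed

lemma unit_interval_complement:
  assumes M: "von_neumann_algebra H M" and a: "a \<in> unit_interval H M"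
  shows "op_diff H (op_one H) a \<in> unit_interval H M"
proof -
  note H = vna_hilbert[OF M]
  have a': "a \<in> M" "self_adjoint H a" using a by (auto simp: unit_interval_def)
  show ?thesis
    using a vna_add[OF M vna_one[OF M] vna_smult[OF M a'(1)], of "- 1"]
      self_adjoint_op_diff[OF H self_adjoint_op_one[OF H] a'(2)]
    by (simp add: unit_interval_def qf_op_diff[OF H op_one_in[OF H] self_adjoint_in[OF a'(2)]] qf_op_one[OF H])
qed

text \<open>This is \<open>f\<^sup>2 \<le> f\<close> for \<open>0 \<le> f \<le> 1\<close>, obtained
  without square roots: Cauchy-Schwarz for the form of \<open>f\<close> at \<open>f x\<close> and
  \<open>x\<close> bounds \<open>\<parallel>f x\<parallel>\<^sup>4\<close> by
  \<open>\<parallel>f x\<parallel>\<^sup>2\<close> times the value of the form at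
  \<open>x\<close>.\<close>

lemma unit_interval_square:
  assumes H: "hilbert_space H" and f: "f \<in> unit_interval H M" and x: "x \<in> carrier H"
  shows "(hnorm H (f x))\<^sup>2 \<le> qf H f x"
proof -
  interpret hilbert_space H by (rule H)
  have sa: "self_adjoint H f" and q: "\<And>v. v \<in> carrier H \<Longrightarrow> 0 \<le> qf H f v"
    "\<And>v. v \<in> carrier H \<Longrightarrow> qf H f v \<le> (hnorm H v)\<^sup>2"
    using f by (auto simp: unit_interval_def)
  have fx: "f x \<in> carrier H" using bounded_ops_in[OF self_adjoint_in[OF sa] x] .
  define r where "r = (hnorm H (f x))\<^sup>2"
  have r: "0 \<le> r" by (simp add: r_def)
  have "r\<^sup>2 = (cmod (ip H (f x) (f x)))\<^sup>2"
    using r by (simp add: ip_self[OF fx] r_def norm_power)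
  also have "\<dots> \<le> qf H f (f x) * qf H f x"
    by (rule positive_cauchy_schwarz[OF H sa q(1) fx x])
  also have "\<dots> \<le> r * qf H f x"
    unfolding r_def using q(1)[OF x] q(2)[OF fx] by (rule mult_right_mono[rotated])
  finally have "r * r \<le> r * qf H f x" by (simp add: power2_eq_square)
  then show ?thesis
    using r q(1)[OF x] unfolding r_def[symmetric] by (cases "r = 0") auto
qed

text \<open>Zorn's lemma: a nonempty chain is directed and bounded by 1, so it has a weak limit in
  \<open>M\<close>, and the continuity of \<open>\<psi>\<close> preserves
  \<open>0 \<le> \<psi>\<close>. The empty chain is bounded by the zero operator.\<close>

lemma maximal_in_unit_interval:
  fixes \<psi> :: "('h \<Rightarrow> 'h) \<Rightarrow> real"
  assumes M: "von_neumann_algebra H M"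
    and cont: "\<And>D s. \<lbrakk>directed_in H M D; s \<in> M; weak_lim H D s\<rbrakk> \<Longrightarrow> (\<psi> \<longlongrightarrow> \<psi> s) (op_net H D)"
    and zero: "0 \<le> \<psi> (op_smult H 0 (op_one H))"
  obtains m where "m \<in> unit_interval H M" "0 \<le> \<psi> m"
    "\<And>a. \<lbrakk>a \<in> unit_interval H M; 0 \<le> \<psi> a; op_le H m a\<rbrakk> \<Longrightarrow> a = m"
proof -
  note H = vna_hilbert[OF M]
  define S where "S = {a \<in> unit_interval H M. 0 \<le> \<psi> a}"
  have S: "a \<in> M" "self_adjoint H a" "a \<in> bounded_ops H H" "0 \<le> \<psi> a"
    "\<And>x. x \<in> carrier H \<Longrightarrow> 0 \<le> qf H a x" "\<And>x. x \<in> carrier H \<Longrightarrow> qf H a x \<le> (hnorm H x)\<^sup>2" if "a \<in> S" for a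
    using that by (auto simp: S_def unit_interval_def self_adjoint_in)
  have zero_in: "op_smult H 0 (op_one H) \<in> S"
    using zero vna_smult[OF M vna_one[OF M], of 0] self_adjoint_op_smult[OF H self_adjoint_op_one[OF H], of 0]
      qf_op_smult[OF H op_one_in[OF H], of _ 0] by (simp add: S_def unit_interval_def)
  have "\<exists>m\<in>S. \<forall>a\<in>S. op_le H m a \<longrightarrow> a = m"
  proof (rule predicate_Zorn)
    show "partial_order_on S (relation_of (op_le H) S)"
    proof (rule partial_order_on_relation_ofI)
      fix a b assume "a \<in> S" "b \<in> S" "op_le H a b" "op_le H b a"
      then show "a = b" using op_le_antisym[OF H S(2) S(2)] by blast
    qed (auto intro: op_le_trans)
  next
    fix C assume C: "C \<in> Chains (relation_of (op_le H) S)"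
    then have sub: "C \<subseteq> S" by (auto simp: Chains_def relation_of_def)
    show "\<exists>u\<in>S. \<forall>a\<in>C. op_le H a u"
    proof (cases "C = {}")
      case True
      then show ?thesis using zero_in by auto
    next
      case False
      have dir: "directed_in H M C"
        unfolding directed_in_def
      proof (intro conjI ballI)
        show "C \<subseteq> {a \<in> M. self_adjoint H a}" using sub S(1,2) by blast
        fix a b assume ab: "a \<in> C" "b \<in> C"
        then have "op_le H a b \<or> op_le H b a" using C by (auto simp: Chains_def relation_of_def)
        then show "\<exists>c\<in>C. op_le H a c \<and> op_le H b c" using ab op_le_refl by blast
      qed (fact False)
      have "op_le H a (op_one H)" if "a \<in> C" for a
        using S(2,6)[of a] sub that by (auto simp: op_le_iff[OF H _ self_adjoint_op_one[OF H]] qf_op_one[OF H])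
      then obtain t where t: "t \<in> bounded_ops H H" "weak_lim H C t"
        using vigier[OF H dir self_adjoint_op_one[OF H]] by blast
      have lub: "op_lub H M C t" by (rule op_lub_of_weak_lim[OF M dir t])
      then have tM: "t \<in> M" "self_adjoint H t" by (auto simp: op_lub_def)
      note nt = op_net_nontrivial[OF dir]
      have ev: "\<forall>\<^sub>F a in op_net H C. a \<in> S" using eventually_op_net_in[OF dir] by (rule eventually_mono) (use sub in blast)
      have q: "0 \<le> qf H t x \<and> qf H t x \<le> (hnorm H x)\<^sup>2" if x: "x \<in> carrier H" for x
        using tendsto_lowerbound[OF weak_lim_qf[OF t(2) x] eventually_mono[OF ev S(5)[OF _ x]] nt]
          tendsto_upperbound[OF weak_lim_qf[OF t(2) x] eventually_mono[OF ev S(6)[OF _ x]] nt] by blast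
      have "0 \<le> \<psi> t"
        using tendsto_lowerbound[OF cont[OF dir tM(1) t(2)] eventually_mono[OF ev S(4)] nt] .
      then have "t \<in> S" using tM q by (simp add: S_def unit_interval_def)
      then show ?thesis using lub by (auto simp: op_lub_def)
    qed
  qed
  then show thesis using that unfolding S_def by blast
qed

text \<open>Both \<open>C A\<close> and \<open>A' C\<close> vanish on the orthogonal complement of
  the family, which \<open>inv\<close> makes invariant under \<open>A\<close>. Agreement on the
  family therefore suffices although the family need not be total.\<close>

lemma extension_intertwines:
  assumes H: "hilbert_space H" and K: "hilbert_space K"
    and C: "C \<in> bounded_ops H K" and A: "A \<in> bounded_ops H H" and A': "A' \<in> bounded_ops K K"
    and e: "\<And>i. e i \<in> carrier H"
    and null: "\<And>x. \<lbrakk>x \<in> carrier H; \<And>i. ip H (e i) x = 0\<rbrakk> \<Longrightarrow> C x = \<zero>\<^bsub>K\<^esub>"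
    and eq: "\<And>i. C (A (e i)) = A' (C (e i))"
    and inv: "\<And>x i. \<lbrakk>x \<in> carrier H; \<And>i. ip H (e i) x = 0\<rbrakk> \<Longrightarrow> ip H (e i) (A x) = 0"
    and x: "x \<in> carrier H"
  shows "C (A x) = A' (C x)"
proof -
  interpret H: hilbert_space H by (rule H)
  interpret K: hilbert_space K by (rule K)
  define D1 D2 where "D1 = compose (carrier H) C A" and "D2 = compose (carrier H) A' C"
  have D1: "D1 \<in> bounded_ops H K" unfolding D1_def by (rule compose_in[OF H H K A C])
  have D2: "D2 \<in> bounded_ops H K" unfolding D2_def by (rule compose_in[OF H K K C A'])
  have D1x: "D1 v = C (A v)" and D2x: "D2 v = A' (C v)" if "v \<in> carrier H" for v
    using that by (simp_all add: D1_def D2_def compose_def)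
  have A'0: "A' \<zero>\<^bsub>K\<^esub> = \<zero>\<^bsub>K\<^esub>"
    using lc_bounded_op[OF K K A', of "\<lambda>_. \<zero>\<^bsub>K\<^esub>" "[]"] by simp
  have "adj H K D1 \<eta> = adj H K D2 \<eta>" if \<eta>: "\<eta> \<in> carrier K" for \<eta>
  proof -
    note in1 = bounded_ops_in[OF adj_in[OF H K D1] \<eta>] and in2 = bounded_ops_in[OF adj_in[OF H K D2] \<eta>]
    define w where "w = adj H K D1 \<eta> \<ominus>\<^bsub>H\<^esub> adj H K D2 \<eta>"
    have w: "w \<in> carrier H" using in1 in2 by (simp add: w_def)
    have "ip H (e i) w = 0" for i
      using in1 in2 e \<eta> by (simp add: w_def adj_ip'[OF H K D1] adj_ip'[OF H K D2] D1x D2x eq)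
    then have "D1 w = \<zero>\<^bsub>K\<^esub>" "D2 w = \<zero>\<^bsub>K\<^esub>"
      using w null[OF w] null[OF bounded_ops_in[OF A w]] inv[OF w] by (simp_all add: D1x D2x A'0)
    moreover have "ip H w w = ip K \<eta> (D1 w) - ip K \<eta> (D2 w)"
      using in1 in2 w \<eta> by (subst (1) w_def) (simp add: adj_ip[OF H K D1] adj_ip[OF H K D2])
    ultimately have "w = \<zero>\<^bsub>H\<^esub>" using w \<eta> by (intro H.ip_definite) simp_all
    then show ?thesis
      using in1 in2 H.M.minus_equality[of "adj H K D1 \<eta>" "\<ominus>\<^bsub>H\<^esub> adj H K D2 \<eta>"] by (simp add: w_def a_minus_def)
  qed
  then have "adj H K D1 = adj H K D2"
    by (rule bounded_ops_eqI[OF adj_in[OF H K D1] adj_in[OF H K D2]])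
  then have "D1 = D2" using adj_adj[OF H K D1] adj_adj[OF H K D2] by metis
  then show ?thesis using D1x[OF x] D2x[OF x] by simp
qed

section \<open>Normal representations and intertwiners into them\<close>

locale normal_rep = H0: hilbert_space H0 + H: hilbert_space H
  for H0 :: "'h hilbert" and H :: "'k hilbert" and M and \<pi> :: "('h \<Rightarrow> 'h) \<Rightarrow> ('k \<Rightarrow> 'k)" +
  assumes vna: "von_neumann_algebra H0 M"
    and hom: "star_hom H0 M H (bounded_ops H H) \<pi>"
    and unit: "\<pi> (op_one H0) = op_one H"
    and normal: "normal_map H0 M H (bounded_ops H H) \<pi>"
begin

lemmas H0 = H0.hilbert_space_axioms
lemmas H = H.hilbert_space_axioms
lemmas M_in = vna_in[OF vna]

lemma pi_in: "a \<in> M \<Longrightarrow> \<pi> a \<in> bounded_ops H H"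
  using hom by (auto simp: star_hom_def linear_map_def)

lemma pi_closed [simp]: "\<lbrakk>a \<in> M; x \<in> carrier H\<rbrakk> \<Longrightarrow> \<pi> a x \<in> carrier H"
  by (rule bounded_ops_in[OF pi_in])

lemma M_closed [simp]: "\<lbrakk>a \<in> M; x \<in> carrier H0\<rbrakk> \<Longrightarrow> a x \<in> carrier H0"
  by (rule bounded_ops_in[OF M_in])

lemma
  assumes "a \<in> M" "x \<in> carrier H"
  shows pi_mult: "b \<in> M \<Longrightarrow> \<pi> (op_mult H0 a b) x = \<pi> a (\<pi> b x)"
    and pi_add: "b \<in> M \<Longrightarrow> \<pi> (op_add H0 a b) x = \<pi> a x \<oplus>\<^bsub>H\<^esub> \<pi> b x"
    and pi_smult: "\<pi> (op_smult H0 c a) x = c \<odot>\<^bsub>H\<^esub> \<pi> a x"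
    and pi_adj: "y \<in> carrier H \<Longrightarrow> ip H y (\<pi> (adj H0 H0 a) x) = ip H (\<pi> a y) x"
  using hom assms adj_ip'[OF H H pi_in[OF assms(1)]] by (auto simp: star_hom_def linear_map_def)

lemma pi_one: "x \<in> carrier H \<Longrightarrow> \<pi> (op_one H0) x = x"
  by (simp add: unit)

lemma pi_self_adjoint: "\<lbrakk>a \<in> M; self_adjoint H0 a\<rbrakk> \<Longrightarrow> self_adjoint H (\<pi> a)"
  by (rule normal_map_self_adjoint[OF normal])

lemma pi_mono:
  assumes "a \<in> M" "b \<in> M" "self_adjoint H0 a" "self_adjoint H0 b" "\<And>x. x \<in> carrier H0 \<Longrightarrow> qf H0 a x \<le> qf H0 b x"
    and "x \<in> carrier H"
  shows "qf H (\<pi> a) x \<le> qf H (\<pi> b) x"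
  using normal_map_mono[OF normal assms(2,4,1,3)] assms
  by (simp add: op_le_iff[OF H0] op_le_iff[OF H] pi_self_adjoint)

lemma pi_zero: "x \<in> carrier H \<Longrightarrow> \<pi> (op_smult H0 0 (op_one H0)) x = \<zero>\<^bsub>H\<^esub>"
  by (rule H.vec_eqI) (simp_all add: pi_smult vna_one[OF vna] vna_smult[OF vna])

lemma pi_pos:
  assumes "a \<in> M" "self_adjoint H0 a" "\<And>x. x \<in> carrier H0 \<Longrightarrow> 0 \<le> qf H0 a x" and x: "x \<in> carrier H"
  shows "0 \<le> qf H (\<pi> a) x"
proof -
  have "qf H (\<pi> (op_smult H0 0 (op_one H0))) x \<le> qf H (\<pi> a) x"
    using assms self_adjoint_op_smult[OF H0 self_adjoint_op_one[OF H0], of 0] qf_op_smult[OF H0 op_one_in[OF H0], of _ 0]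
    by (intro pi_mono) (simp_all add: vna_one[OF vna] vna_smult[OF vna])
  then show ?thesis using x by (simp add: qf_def pi_zero)
qed

text \<open>Cauchy-Schwarz for the positive form of \<open>\<pi> a\<close>: a vector on which the
  form vanishes lies in the kernel.\<close>

lemma pi_null:
  assumes "a \<in> M" "self_adjoint H0 a" "\<And>x. x \<in> carrier H0 \<Longrightarrow> 0 \<le> qf H0 a x"
    and x: "x \<in> carrier H" and "qf H (\<pi> a) x = 0"
  shows "\<pi> a x = \<zero>\<^bsub>H\<^esub>"
proof (rule H.vec_eqI)
  fix w assume w: "w \<in> carrier H"
  have "(cmod (ip H w (\<pi> a x)))\<^sup>2 \<le> qf H (\<pi> a) w * qf H (\<pi> a) x"
    using assms by (intro positive_cauchy_schwarz[OF H _ _ w x]) (auto intro: pi_self_adjoint pi_pos)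
  then show "ip H w (\<pi> a x) = ip H w \<zero>\<^bsub>H\<^esub>" using assms(5) w by simp
qed (use assms in simp_all)

lemma pi_cont:
  assumes "directed_in H0 M D" "s \<in> M" "weak_lim H0 D s" "x \<in> carrier H"
  shows "((\<lambda>a. qf H (\<pi> a) x) \<longlongrightarrow> qf H (\<pi> s) x) (op_net H0 D)"
  unfolding qf_def
  by (intro tendsto_intros normal_mapD(1)[OF vna vna_bounded_ops[OF H] normal pi_in]) (use assms in auto)

text \<open>
  For a vector \<open>\<xi>\<close> orthogonal to all intertwiner ranges let \<open>\<phi>\<close> be its vector functional. The
  maximal \<open>e\<close> with \<open>\<phi> e = 0\<close> is the complement of the support of \<open>\<phi>\<close>, so \<open>x\<close> lies in the support.
  A maximal \<open>a0\<close> with \<open>\<phi> a0 \<ge> \<langle>x, a0 x\<rangle>\<close> makes \<open>\<phi> \<le> \<langle>x, \<cdot> x\<rangle>\<close> below \<open>b = 1 - a0\<close>, whence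
  \<open>y b x \<mapsto> \<pi> (y b) \<xi>\<close> is a contractive intertwiner.
\<close>

lemma intertwiners_total:
  assumes \<xi>: "\<xi> \<in> carrier H"
    and orth: "\<And>C x. \<lbrakk>C \<in> bounded_ops H0 H; \<And>a v. \<lbrakk>a \<in> M; v \<in> carrier H0\<rbrakk> \<Longrightarrow> C (a v) = \<pi> a (C v); x \<in> carrier H0\<rbrakk>
      \<Longrightarrow> ip H \<xi> (C x) = 0"
  shows "\<xi> = \<zero>\<^bsub>H\<^esub>"
proof (rule ccontr)
  assume ne: "\<xi> \<noteq> \<zero>\<^bsub>H\<^esub>"
  define \<phi> where "\<phi> a = qf H (\<pi> a) \<xi>" for a
  note one = vna_one[OF vna] and add = vna_add[OF vna] and smult = vna_smult[OF vna] and mult = vna_mult[OF vna]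
    and adjM = vna_adj[OF vna]
  have \<phi>_add: "\<phi> (op_add H0 a b) = \<phi> a + \<phi> b" if "a \<in> M" "b \<in> M" for a b
    using that \<xi> by (simp add: \<phi>_def qf_def pi_add)
  have \<phi>_one: "\<phi> (op_one H0) = (hnorm H \<xi>)\<^sup>2"
    using \<xi> by (simp add: \<phi>_def qf_def pi_one H.hnorm_sq)
  have \<phi>_zero: "\<phi> (op_smult H0 0 (op_one H0)) = 0"
    using \<xi> by (simp add: \<phi>_def qf_def pi_zero)
  have \<phi>_diff: "\<phi> (op_diff H0 (op_one H0) a) = (hnorm H \<xi>)\<^sup>2 - \<phi> a" if "a \<in> M" for a
    using that \<xi> by (simp add: \<phi>_add one smult \<phi>_one) (simp add: \<phi>_def qf_def pi_smult)
  have \<phi>_cont: "(\<phi> \<longlongrightarrow> \<phi> s) (op_net H0 D)" if "directed_in H0 M D" "s \<in> M" "weak_lim H0 D s" for D s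
    using pi_cont[OF that \<xi>] unfolding \<phi>_def .
  note I = unit_interval_def[of H0 M]
  have neg_cont: "((\<lambda>a. - \<phi> a) \<longlongrightarrow> - \<phi> s) (op_net H0 D)" if "directed_in H0 M D" "s \<in> M" "weak_lim H0 D s" for D s
    by (intro tendsto_minus \<phi>_cont that)
  have neg_zero: "0 \<le> - \<phi> (op_smult H0 0 (op_one H0))" unfolding \<phi>_zero by simp
  \<comment> \<open>\<open>\<phi>\<close> is nonnegative on the unit interval, so
    \<open>0 \<le> - \<phi> a\<close> means \<open>\<phi> a = 0\<close>.\<close>
  obtain e where e: "e \<in> unit_interval H0 M" "0 \<le> - \<phi> e"
    "\<And>a. \<lbrakk>a \<in> unit_interval H0 M; 0 \<le> - \<phi> a; op_le H0 e a\<rbrakk> \<Longrightarrow> a = e"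
    by (rule maximal_in_unit_interval[OF vna neg_cont neg_zero]) (assumption+, erule that, assumption+)
  have eM: "e \<in> M" "self_adjoint H0 e" and eq: "\<And>x. x \<in> carrier H0 \<Longrightarrow> 0 \<le> qf H0 e x"
    using e(1) by (auto simp: I)
  have "0 \<le> \<phi> e" unfolding \<phi>_def using pi_pos[OF eM eq \<xi>] by simp
  then have "\<phi> e = 0" using e(2) by simp
  then have e\<xi>: "\<pi> e \<xi> = \<zero>\<^bsub>H\<^esub>" using pi_null[OF eM eq \<xi>] by (simp add: \<phi>_def)
  define f where "f = op_diff H0 (op_one H0) e"
  have f: "f \<in> unit_interval H0 M" unfolding f_def by (rule unit_interval_complement[OF vna e(1)])
  have fM: "f \<in> M" "self_adjoint H0 f" using f by (auto simp: I)
  have fq: "qf H0 f x = (hnorm H0 x)\<^sup>2 - qf H0 e x" if "x \<in> carrier H0" for x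
    unfolding f_def using qf_op_diff[OF H0 op_one_in[OF H0] self_adjoint_in[OF eM(2)] that] by (simp add: qf_op_one[OF H0 that])
  have f\<xi>: "\<pi> f \<xi> = \<xi>"
    unfolding f_def using \<xi> by (intro H.vec_eqI) (simp_all add: pi_add pi_smult one smult add eM(1) pi_one e\<xi>)
  have supp: "qf H0 b (f x) = 0" if b: "b \<in> unit_interval H0 M" "\<phi> b = 0" and x: "x \<in> carrier H0" for b x
  proof -
    have bM: "b \<in> M" "self_adjoint H0 b" and bq: "\<And>x. x \<in> carrier H0 \<Longrightarrow> 0 \<le> qf H0 b x"
      "\<And>x. x \<in> carrier H0 \<Longrightarrow> qf H0 b x \<le> (hnorm H0 x)\<^sup>2" using b by (auto simp: I)
    have b\<xi>: "\<pi> b \<xi> = \<zero>\<^bsub>H\<^esub>" using pi_null[OF bM bq(1) \<xi>] b(2) by (simp add: \<phi>_def)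
    \<comment> \<open>With \<open>g = f b f\<close>, the sum \<open>e + g\<close> stays in the unit
      interval because \<open>g \<le> f\<^sup>2 \<le> f = 1 - e\<close>, and \<open>\<phi>\<close>
      vanishes on it because \<open>\<pi> f \<xi> = \<xi>\<close> and
      \<open>\<pi> b \<xi> = 0\<close>. Maximality of \<open>e\<close> forces
      \<open>g = 0\<close>.\<close>
    define g where "g = op_mult H0 (adj H0 H0 f) (op_mult H0 b f)"
    have g: "g \<in> M" "self_adjoint H0 g"
      unfolding g_def by (intro mult adjM bM fM) (intro self_adjoint_sandwich H0 bM M_in fM)
    have gq: "qf H0 g v = qf H0 b (f v)" if "v \<in> carrier H0" for v
      unfolding g_def by (rule qf_sandwich[OF H0 M_in M_in]) (use fM bM that in auto)
    have "op_add H0 e g = e"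
    proof (rule e(3))
      have "0 \<le> qf H0 (op_add H0 e g) v \<and> qf H0 (op_add H0 e g) v \<le> (hnorm H0 v)\<^sup>2" if v: "v \<in> carrier H0" for v
        using qf_op_add[OF H0 M_in[OF eM(1)] M_in[OF g(1)] v] gq[OF v] eq[OF v] bq[of "f v"] fq[OF v]
          unit_interval_square[OF H0 f v] v fM by simp
      then show "op_add H0 e g \<in> unit_interval H0 M"
        using add[OF eM(1) g(1)] self_adjoint_op_add[OF H0 eM(2) g(2)] by (simp add: I)
      have "\<pi> g \<xi> = \<zero>\<^bsub>H\<^esub>"
      proof (rule H.vec_eqI)
        fix w assume w: "w \<in> carrier H"
        then show "ip H w (\<pi> g \<xi>) = ip H w \<zero>\<^bsub>H\<^esub>"
          using \<xi> fM bM by (simp add: g_def pi_mult mult adjM pi_adj f\<xi> b\<xi>)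
      qed (use \<xi> g in simp_all)
      then show "0 \<le> - \<phi> (op_add H0 e g)"
        using \<open>\<phi> e = 0\<close> \<xi> \<phi>_add[OF eM(1) g(1)] by (simp add: \<phi>_def[of g] qf_def)
      show "op_le H0 e (op_add H0 e g)"
        using op_le_iff[OF H0 eM(2) self_adjoint_op_add[OF H0 eM(2) g(2)]] qf_op_add[OF H0 M_in[OF eM(1)] M_in[OF g(1)]]
          gq bq fM by simp
    qed
    then have "qf H0 g x = 0" using qf_op_add[OF H0 M_in[OF eM(1)] M_in[OF g(1)] x] by simp
    then show ?thesis using gq[OF x] by simp
  qed
  have "\<exists>y\<in>carrier H0. f y \<noteq> \<zero>\<^bsub>H0\<^esub>"
  proof (rule ccontr)
    assume "\<not> ?thesis"
    then have z: "f y = \<zero>\<^bsub>H0\<^esub>" if "y \<in> carrier H0" for y using that by blast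
    have "f = op_smult H0 0 (op_one H0)"
      by (rule bounded_ops_eqI_ip[OF H0 M_in[OF fM(1)] op_smult_in[OF H0 op_one_in[OF H0]]]) (simp add: z)
    then show False using f\<xi> pi_zero[OF \<xi>] ne by simp
  qed
  then obtain y where y: "y \<in> carrier H0" "f y \<noteq> \<zero>\<^bsub>H0\<^esub>" by blast
  have fy: "f y \<in> carrier H0" using y fM by simp
  have ny: "0 < hnorm H0 (f y)" using H0.hnorm_eq_0[OF fy] y(2) H0.hnorm_nonneg[OF fy] by linarith
  \<comment> \<open>This factor gives
    \<open>\<parallel>x\<parallel> = \<parallel>\<xi>\<parallel> + 1\<close>, so that the vector
    functional of \<open>x\<close> strictly exceeds \<open>\<phi>\<close> at the identity; the final
    contradiction uses this gap.\<close>
  define t where "t = (hnorm H \<xi> + 1) / hnorm H0 (f y)"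
  define x where "x = f (of_real t \<odot>\<^bsub>H0\<^esub> y)"
  have x: "x \<in> carrier H0" using y fM by (simp add: x_def)
  have t: "0 \<le> t" using ny \<xi> by (simp add: t_def)
  have "hnorm H0 x = t * hnorm H0 (f y)"
    using t y fy by (simp add: x_def bounded_ops_smult[OF M_in[OF fM(1)]])
  then have "hnorm H0 x = hnorm H \<xi> + 1" using ny by (simp add: t_def)
  then have big: "(hnorm H \<xi>)\<^sup>2 < (hnorm H0 x)\<^sup>2" using \<xi> by (simp add: power2_eq_square algebra_simps add_pos_nonneg)
  define \<psi> where "\<psi> a = \<phi> a - qf H0 a x" for a
  have zb: "qf H0 (op_smult H0 0 (op_one H0)) v = 0" if "v \<in> carrier H0" for v
    using qf_op_smult[OF H0 op_one_in[OF H0] that, of 0] by simp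
  have \<psi>_cont: "(\<psi> \<longlongrightarrow> \<psi> s) (op_net H0 D)" if "directed_in H0 M D" "s \<in> M" "weak_lim H0 D s" for D s
    unfolding \<psi>_def by (intro tendsto_diff \<phi>_cont weak_lim_qf that x)
  have \<psi>0: "\<psi> (op_smult H0 0 (op_one H0)) = 0" by (simp add: \<psi>_def \<phi>_zero zb x)
  have \<psi>_zero: "0 \<le> \<psi> (op_smult H0 0 (op_one H0))" unfolding \<psi>0 by simp
  obtain a0 where a0: "a0 \<in> unit_interval H0 M" "0 \<le> \<psi> a0"
    "\<And>a. \<lbrakk>a \<in> unit_interval H0 M; 0 \<le> \<psi> a; op_le H0 a0 a\<rbrakk> \<Longrightarrow> a = a0"
    by (rule maximal_in_unit_interval[OF vna \<psi>_cont \<psi>_zero]) (assumption+, erule that, assumption+)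
  have a0M: "a0 \<in> M" "self_adjoint H0 a0" and a0q: "\<And>x. x \<in> carrier H0 \<Longrightarrow> 0 \<le> qf H0 a0 x" using a0(1) by (auto simp: I)
  define b where "b = op_diff H0 (op_one H0) a0"
  have b: "b \<in> unit_interval H0 M" unfolding b_def by (rule unit_interval_complement[OF vna a0(1)])
  have bM: "b \<in> M" "self_adjoint H0 b" using b by (auto simp: I)
  have bq: "qf H0 b v = (hnorm H0 v)\<^sup>2 - qf H0 a0 v" if "v \<in> carrier H0" for v
    unfolding b_def using qf_op_diff[OF H0 op_one_in[OF H0] self_adjoint_in[OF a0M(2)] that] by (simp add: qf_op_one[OF H0 that])
  \<comment> \<open>Otherwise \<open>a0 + c\<close> would be a larger element with
    \<open>0 \<le> \<psi>\<close>; maximality then makes \<open>c\<close> zero, where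
    \<open>\<psi>\<close> vanishes.\<close>
  have below: "\<psi> c \<le> 0" if c: "c \<in> M" "self_adjoint H0 c" "\<And>v. v \<in> carrier H0 \<Longrightarrow> 0 \<le> qf H0 c v"
      "\<And>v. v \<in> carrier H0 \<Longrightarrow> qf H0 c v \<le> qf H0 b v" for c
  proof (rule ccontr)
    assume "\<not> ?thesis"
    then have pos: "0 < \<psi> c" by simp
    note qadd = qf_op_add[OF H0 M_in[OF a0M(1)] M_in[OF c(1)]]
    have "op_add H0 a0 c = a0"
    proof (rule a0(3))
      show "op_add H0 a0 c \<in> unit_interval H0 M"
        using add[OF a0M(1) c(1)] self_adjoint_op_add[OF H0 a0M(2) c(2)] c(3,4) a0q bq qadd by (force simp: I)
      show "0 \<le> \<psi> (op_add H0 a0 c)"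
        using a0(2) pos \<phi>_add[OF a0M(1) c(1)] qadd[OF x] by (simp add: \<psi>_def)
      show "op_le H0 a0 (op_add H0 a0 c)"
        using op_le_iff[OF H0 a0M(2) self_adjoint_op_add[OF H0 a0M(2) c(2)]] qadd c(3) by simp
    qed
    then have "qf H0 c v = 0" if "v \<in> carrier H0" for v using qadd[OF that] by simp
    then have "c = op_smult H0 0 (op_one H0)"
      by (intro bounded_ops_eqI_qf[OF H0 M_in[OF c(1)] op_smult_in[OF H0 op_one_in[OF H0]]])
        (simp add: self_adjoint_qf[OF H0 c(2)])
    then show False using pos \<psi>0 by simp
  qed
  define \<eta> where "\<eta> = \<pi> b \<xi>"
  have \<eta>: "\<eta> \<in> carrier H" using \<xi> bM by (simp add: \<eta>_def)
  have bx: "b x \<in> carrier H0" using x bM by simp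
  have dom: "hnorm H (\<pi> Y \<eta>) \<le> hnorm H0 (Y (b x))" if Y: "Y \<in> M" for Y
  proof -
    obtain B where B: "1 \<le> B" "\<And>v. v \<in> carrier H0 \<Longrightarrow> hnorm H0 (Y v) \<le> B * hnorm H0 v"
      using bounded_ops_bound[OF H0 M_in[OF Y]] by blast
    define Yb where "Yb = op_mult H0 Y b"
    have Yb: "Yb \<in> M" unfolding Yb_def by (rule mult[OF Y bM(1)])
    \<comment> \<open>The scale \<open>1 / B\<^sup>2\<close> brings
      \<open>(Y b)\<^sup>* (Y b)\<close> below \<open>b\<^sup>2\<close>, hence below
      \<open>b\<close>, which is what \<open>below\<close> asks for.\<close>
    define r where "r = 1 / B\<^sup>2"
    have r: "0 < r" using B by (simp add: r_def)
    define p where "p = op_mult H0 (adj H0 H0 Yb) (op_mult H0 (op_one H0) Yb)"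
    define c where "c = op_smult H0 (of_real r) p"
    have p: "p \<in> M" "self_adjoint H0 p"
      unfolding p_def by (intro mult adjM Yb one) (intro self_adjoint_sandwich H0 M_in[OF Yb] self_adjoint_op_one)
    have c: "c \<in> M" "self_adjoint H0 c"
      unfolding c_def by (intro smult p) (intro self_adjoint_op_smult H0 p)
    have cq: "qf H0 c v = r * (hnorm H0 (Y (b v)))\<^sup>2" if v: "v \<in> carrier H0" for v
    proof -
      have "qf H0 c v = r * qf H0 p v" unfolding c_def by (rule qf_op_smult[OF H0 M_in[OF p(1)] v])
      also have "qf H0 p v = qf H0 (op_one H0) (Yb v)"
        unfolding p_def by (rule qf_sandwich[OF H0 M_in[OF Yb] op_one_in[OF H0] v])
      also have "\<dots> = (hnorm H0 (Y (b v)))\<^sup>2" using qf_op_one[OF H0, of "Yb v"] v Y bM by (simp add: Yb_def)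
      finally show ?thesis .
    qed
    have "\<psi> c \<le> 0"
    proof (rule below[OF c])
      fix v assume v: "v \<in> carrier H0"
      have bv: "b v \<in> carrier H0" using v bM by simp
      show "0 \<le> qf H0 c v" using cq[OF v] r by simp
      have "(hnorm H0 (Y (b v)))\<^sup>2 \<le> (B * hnorm H0 (b v))\<^sup>2"
        using B(2)[OF bv] bv Y by (intro power_mono) auto
      then have "r * (hnorm H0 (Y (b v)))\<^sup>2 \<le> r * (B * hnorm H0 (b v))\<^sup>2" using r by (intro mult_left_mono) auto
      also have "\<dots> = (hnorm H0 (b v))\<^sup>2" using B(1) by (simp add: r_def power_mult_distrib)
      also have "\<dots> \<le> qf H0 b v" by (rule unit_interval_square[OF H0 b v])
      finally show "qf H0 c v \<le> qf H0 b v" using cq[OF v] by simp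
    qed
    moreover have "\<phi> c = r * (hnorm H (\<pi> Y \<eta>))\<^sup>2"
      using \<xi> \<eta> Y bM p Yb
      by (simp add: \<phi>_def qf_def c_def pi_smult) (simp add: p_def pi_mult pi_adj one mult adjM pi_one Yb_def \<eta>_def H.hnorm_sq)
    ultimately have "r * (hnorm H (\<pi> Y \<eta>))\<^sup>2 \<le> r * (hnorm H0 (Y (b x)))\<^sup>2"
      using cq[OF x] by (simp add: \<psi>_def)
    then have "(hnorm H (\<pi> Y \<eta>))\<^sup>2 \<le> (hnorm H0 (Y (b x)))\<^sup>2" using r by simp
    then show ?thesis by (rule power2_le_imp_le) (use bx Y in simp)
  qed
  define z0 where "z0 = op_smult H0 0 (op_one H0)"
  have z0: "z0 \<in> M" unfolding z0_def by (intro smult one)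
  define e' where "e' Y = (if Y \<in> M then Y (b x) else \<zero>\<^bsub>H0\<^esub>)" for Y
  define f' where "f' Y = (if Y \<in> M then \<pi> Y \<eta> else \<zero>\<^bsub>H\<^esub>)" for Y
  have e' [simp]: "e' Y \<in> carrier H0" for Y using bx by (simp add: e'_def)
  have f' [simp]: "f' Y \<in> carrier H" for Y using \<eta> by (simp add: f'_def)
  have e'M: "e' Y = Y (b x)" "f' Y = \<pi> Y \<eta>" if "Y \<in> M" for Y using that by (simp_all add: e'_def f'_def)
  have e'0: "e' Y = \<zero>\<^bsub>H0\<^esub>" "f' Y = \<zero>\<^bsub>H\<^esub>" if "Y \<notin> M" for Y using that by (simp_all add: e'_def f'_def)
  \<comment> \<open>A combination of orbit vectors is the orbit vector of a single element of
    \<open>M\<close>, so the estimate \<open>dom\<close> for one element covers all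
    combinations.\<close>
  have lcY: "\<exists>Y\<in>M. lc H0 e' xs = Y (b x) \<and> lc H f' xs = \<pi> Y \<eta>" for xs
  proof (induction xs)
    case Nil
    have "z0 (b x) = \<zero>\<^bsub>H0\<^esub>" using bx by (intro H0.vec_eqI) (simp_all add: z0_def)
    then show ?case using z0 pi_zero[OF \<eta>] by (intro bexI[of _ z0]) (simp_all add: z0_def)
  next
    case (Cons q xs)
    then obtain Y where Y: "Y \<in> M" "lc H0 e' xs = Y (b x)" "lc H f' xs = \<pi> Y \<eta>" by blast
    show ?case
    proof (cases "snd q \<in> M")
      case True
      show ?thesis
        by (rule bexI[of _ "op_add H0 (op_smult H0 (fst q) (snd q)) Y"])
          (use True Y bx \<eta> in \<open>simp_all add: e'M pi_add pi_smult smult add\<close>)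
    next
      case False
      have "fst q \<odot>\<^bsub>H0\<^esub> \<zero>\<^bsub>H0\<^esub> = \<zero>\<^bsub>H0\<^esub>" "fst q \<odot>\<^bsub>H\<^esub> \<zero>\<^bsub>H\<^esub> = \<zero>\<^bsub>H\<^esub>"
        by (rule H0.vec_eqI; simp) (rule H.vec_eqI; simp)
      then show ?thesis using False Y bx \<eta> by (intro bexI[of _ Y]) (simp_all add: e'0)
    qed
  qed
  have "hnorm H (lc H f' xs) \<le> 1 * hnorm H0 (lc H0 e' xs)" for xs
    using lcY[of xs] dom by auto
  then obtain C where C: "C \<in> bounded_ops H0 H" "\<And>Y. C (e' Y) = f' Y"
    "\<And>v. \<lbrakk>v \<in> carrier H0; \<And>Y. ip H0 (e' Y) v = 0\<rbrakk> \<Longrightarrow> C v = \<zero>\<^bsub>H\<^esub>"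
    by (rule gram_extension[OF H0 H e' f' zero_le_one]) blast
  have Cint: "C (a v) = \<pi> a (C v)" if a: "a \<in> M" and v: "v \<in> carrier H0" for a v
  proof (rule extension_intertwines[OF H0 H C(1) M_in[OF a] pi_in[OF a] e' C(3) _ _ v])
    fix Y
    show "C (a (e' Y)) = \<pi> a (C (e' Y))"
    proof (cases "Y \<in> M")
      case True
      then have "a (e' Y) = e' (op_mult H0 a Y)" using a bx by (simp add: e'_def mult)
      then show ?thesis using True a \<eta> by (simp add: C(2)) (simp add: f'_def mult pi_mult)
    next
      case False
      have "a \<zero>\<^bsub>H0\<^esub> = \<zero>\<^bsub>H0\<^esub>" "\<pi> a \<zero>\<^bsub>H\<^esub> = \<zero>\<^bsub>H\<^esub>"
        using lc_bounded_op[OF H0 H0 M_in[OF a], of "\<lambda>_. \<zero>\<^bsub>H0\<^esub>" "[]"]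
          lc_bounded_op[OF H H pi_in[OF a], of "\<lambda>_. \<zero>\<^bsub>H\<^esub>" "[]"] by simp_all
      then show ?thesis using False C(2)[of Y] by (simp add: e'_def f'_def)
    qed
  next
    fix w Y assume w: "w \<in> carrier H0" "\<And>Y. ip H0 (e' Y) w = 0"
    show "ip H0 (e' Y) (a w) = 0"
    proof (cases "Y \<in> M")
      case True
      have "ip H0 (e' Y) (a w) = ip H0 (e' (op_mult H0 (adj H0 H0 a) Y)) w"
        using True a w bx adj_ip[OF H0 H0 M_in[OF a] w(1), of "Y (b x)"] by (simp add: e'_def mult adjM)
      then show ?thesis using w by simp
    qed (use a w in \<open>simp add: e'_def\<close>)
  qed
  \<comment> \<open>\<open>C (b x)\<close> is \<open>\<pi> b \<xi>\<close>, so orthogonality gives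
    \<open>\<phi> b = 0\<close>, and \<open>supp\<close> makes the form of \<open>b\<close> vanish
    at \<open>x\<close>. Then \<open>a0 = 1 - b\<close> has the values
    \<open>\<parallel>\<xi>\<parallel>\<^sup>2\<close> under \<open>\<phi>\<close> and
    \<open>\<parallel>x\<parallel>\<^sup>2\<close> at \<open>x\<close>, against
    \<open>0 \<le> \<psi> a0\<close>.\<close>
  have "ip H \<xi> (C (b x)) = 0" by (rule orth[OF C(1) Cint bx])
  moreover have "C (b x) = \<pi> b \<xi>"
    using C(2)[of "op_one H0"] bx \<eta> by (simp add: e'_def f'_def one pi_one) (simp add: \<eta>_def)
  ultimately have \<phi>b: "\<phi> b = 0" by (simp add: \<phi>_def qf_def)
  have "qf H0 b x = 0" unfolding x_def by (rule supp[OF b \<phi>b]) (use y in simp)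
  moreover have "\<phi> a0 = (hnorm H \<xi>)\<^sup>2" using \<phi>_diff[OF a0M(1)] \<phi>b by (simp add: b_def)
  ultimately show False using a0(2) bq[OF x] big by (simp add: \<psi>_def)
qed

end

section \<open>The image of a normal representation as a von Neumann algebra\<close>

context normal_rep
begin

text \<open>\<open>J\<close> embeds the defining representation into \<open>\<pi>\<close>, so its
  adjoint turns every intertwiner \<open>C\<close> into an element \<open>C J\<^sup>*\<close> of the
  commutant. An element of the bicommutant is thereby determined by its compression along
  \<open>J\<close>, and that compression lies in \<open>M\<close>.\<close>

lemma image_vna:
  assumes J: "J \<in> bounded_ops H0 H"
    and iso: "\<And>x y. \<lbrakk>x \<in> carrier H0; y \<in> carrier H0\<rbrakk> \<Longrightarrow> ip H (J x) (J y) = ip H0 x y"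
    and Jint: "\<And>a x. \<lbrakk>a \<in> M; x \<in> carrier H0\<rbrakk> \<Longrightarrow> J (a x) = \<pi> a (J x)"
  shows "von_neumann_algebra H (\<pi> ` M)"
proof -
  have sub: "\<pi> ` M \<subseteq> bounded_ops H H" using pi_in by blast
  have closed: "adj H H T \<in> \<pi> ` M" if T: "T \<in> \<pi> ` M" for T
  proof -
    obtain a where a: "a \<in> M" "T = \<pi> a" using T by blast
    then have "adj H H T = \<pi> (adj H0 H0 a)" using hom by (simp add: star_hom_def)
    then show ?thesis using vna_adj[OF vna a(1)] by simp
  qed
  define J' where "J' = adj H0 H J"
  have J': "J' \<in> bounded_ops H H0" unfolding J'_def by (rule adj_in[OF H0 H J])
  note [simp] = bounded_ops_in[OF J] bounded_ops_in[OF J']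
  have J'ip: "ip H0 x (J' y) = ip H (J x) y" if "x \<in> carrier H0" "y \<in> carrier H" for x y
    unfolding J'_def by (rule adj_ip'[OF H0 H J that])
  have J'J: "J' (J x) = x" if "x \<in> carrier H0" for x
    using that by (intro H0.vec_eqI) (simp_all add: J'ip iso)
  have J'int: "J' (\<pi> a y) = a (J' y)" if a: "a \<in> M" and y: "y \<in> carrier H" for a y
  proof (rule H0.vec_eqI)
    fix w assume w: "w \<in> carrier H0"
    have aw: "adj H0 H0 a w \<in> carrier H0" using vna_adj[OF vna a] w by simp
    have "ip H0 w (a (J' y)) = ip H0 (adj H0 H0 a w) (J' y)"
      using adj_ip[OF H0 H0 M_in[OF a], of "J' y" w] w y by simp
    also have "\<dots> = ip H (\<pi> (adj H0 H0 a) (J w)) y"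
      using aw y Jint[OF vna_adj[OF vna a] w] by (simp add: J'ip)
    also have "\<dots> = cnj (ip H y (\<pi> (adj H0 H0 a) (J w)))"
      using w y vna_adj[OF vna a] by (intro H.ip_cnj) simp_all
    also have "\<dots> = cnj (ip H (\<pi> a y) (J w))" using a w y by (simp add: pi_adj)
    also have "\<dots> = ip H0 w (J' (\<pi> a y))"
      using H.ip_cnj[of "J w" "\<pi> a y"] a w y by (simp add: J'ip)
    finally show "ip H0 w (J' (\<pi> a y)) = ip H0 w (a (J' y))" by simp
  qed (use a y in simp_all)
  have transfer: "compose (carrier H) C J' \<in> commutant H (\<pi> ` M)"
    if C: "C \<in> bounded_ops H0 H" and Cint: "\<And>a v. \<lbrakk>a \<in> M; v \<in> carrier H0\<rbrakk> \<Longrightarrow> C (a v) = \<pi> a (C v)" for C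
  proof (rule commutantI)
    show "compose (carrier H) C J' \<in> bounded_ops H H" by (rule compose_in[OF H H0 H J' C])
    show "compose (carrier H) C J' (A x) = A (compose (carrier H) C J' x)" if "A \<in> \<pi> ` M" "x \<in> carrier H" for A x
      using that by (auto simp: compose_def J'int Cint)
  qed
  have bicomm: "commutant H (commutant H (\<pi> ` M)) = \<pi> ` M"
  proof
    show "\<pi> ` M \<subseteq> commutant H (commutant H (\<pi> ` M))" by (rule subset_bicommutant[OF sub])
    show "commutant H (commutant H (\<pi> ` M)) \<subseteq> \<pi> ` M"
    proof
      fix T assume T: "T \<in> commutant H (commutant H (\<pi> ` M))"
      have Tb: "T \<in> bounded_ops H H" by (rule commutant_in[OF T])
      note [simp] = bounded_ops_in[OF Tb]
      have TC: "T (C (J' x)) = C (J' (T x))"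
        if "C \<in> bounded_ops H0 H" "\<And>a v. \<lbrakk>a \<in> M; v \<in> carrier H0\<rbrakk> \<Longrightarrow> C (a v) = \<pi> a (C v)" "x \<in> carrier H" for C x
        using commutantD[OF T transfer[OF that(1,2)] that(3)] that(3) by (simp add: compose_def)
      define T0 where "T0 = compose (carrier H0) J' (compose (carrier H0) T J)"
      have T0: "T0 \<in> bounded_ops H0 H0"
        unfolding T0_def by (rule compose_in[OF H0 H H0 compose_in[OF H0 H H J Tb] J'])
      have T0x: "T0 x = J' (T (J x))" if "x \<in> carrier H0" for x using that by (simp add: T0_def compose_def)
      have T0M: "T0 \<in> M"
      proof (rule vna_memI[OF vna T0])
        fix u x assume u: "u \<in> commutant H0 M" and x: "x \<in> carrier H0"
        note ub = commutant_in[OF u]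
        note [simp] = bounded_ops_in[OF ub]
        \<comment> \<open>\<open>J u\<close> is again an intertwiner, so \<open>T\<close> commutes
          with \<open>J u J'\<close>; compressing this relation along \<open>J\<close> shows that
          \<open>T0\<close> commutes with \<open>u\<close>.\<close>
        have Ju: "compose (carrier H0) J u \<in> bounded_ops H0 H" by (rule compose_in[OF H0 H0 H ub J])
        have "T (compose (carrier H0) J u (J' (J x))) = compose (carrier H0) J u (J' (T (J x)))"
          by (rule TC[OF Ju]) (use x in \<open>simp_all add: compose_def commutantD[OF u] Jint\<close>)
        then have "T (J (u x)) = J (u (J' (T (J x))))" using x by (simp add: J'J compose_def)
        then show "T0 (u x) = u (T0 x)" using x by (simp add: T0x J'J)
      qed
      \<comment> \<open>Passing to adjoints turns the agreement of \<open>T\<close> and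
        \<open>\<pi> T0\<close> on all ranges of intertwiners into the orthogonality of one vector
        to those ranges, where \<open>intertwiners_total\<close> applies.\<close>
      have "adj H H T \<eta> = adj H H (\<pi> T0) \<eta>" if \<eta>: "\<eta> \<in> carrier H" for \<eta>
      proof -
        note in1 = bounded_ops_in[OF adj_in[OF H H Tb] \<eta>] and in2 = bounded_ops_in[OF adj_in[OF H H pi_in[OF T0M]] \<eta>]
        have "adj H H T \<eta> \<ominus>\<^bsub>H\<^esub> adj H H (\<pi> T0) \<eta> = \<zero>\<^bsub>H\<^esub>"
        proof (rule intertwiners_total)
          show "adj H H T \<eta> \<ominus>\<^bsub>H\<^esub> adj H H (\<pi> T0) \<eta> \<in> carrier H" using in1 in2 by simp
          fix C x
          assume C: "C \<in> bounded_ops H0 H" and Cint: "\<And>a v. \<lbrakk>a \<in> M; v \<in> carrier H0\<rbrakk> \<Longrightarrow> C (a v) = \<pi> a (C v)"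
            and x: "x \<in> carrier H0"
          have Cx: "C x \<in> carrier H" using bounded_ops_in[OF C x] .
          have "T (C x) = C (T0 x)" using TC[OF C Cint, of "J x"] x by (simp add: J'J T0x)
          then have "T (C x) = \<pi> T0 (C x)" using Cint[OF T0M x] by simp
          then show "ip H (adj H H T \<eta> \<ominus>\<^bsub>H\<^esub> adj H H (\<pi> T0) \<eta>) (C x) = 0"
            using in1 in2 Cx \<eta> adj_ip[OF H H Tb Cx \<eta>] adj_ip[OF H H pi_in[OF T0M] Cx \<eta>] by simp
        qed
        then show ?thesis
          using in1 in2 H.M.minus_equality[of "adj H H T \<eta>" "\<ominus>\<^bsub>H\<^esub> adj H H (\<pi> T0) \<eta>"] by (simp add: a_minus_def)
      qed
      then have "adj H H T = adj H H (\<pi> T0)"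
        by (rule bounded_ops_eqI[OF adj_in[OF H H Tb] adj_in[OF H H pi_in[OF T0M]]])
      then have "T = \<pi> T0" using adj_adj[OF H H Tb] adj_adj[OF H H pi_in[OF T0M]] by metis
      then show "T \<in> \<pi> ` M" using T0M by simp
    qed
  qed
  show ?thesis unfolding von_neumann_algebra_def using H sub closed bicomm by blast
qed

end

subsection \<open>Compression of a bicommutant\<close>

text \<open>
  Every \<open>u\<close> in the commutant of \<open>M\<close> lifts to \<open>\<Sum> w\<^sub>i z h\<^sub>i \<mapsto> \<Sum> w\<^sub>i z u h\<^sub>i\<close>. The lift \<open>\<rho> u\<close> of a fixed
  combination satisfies \<open>\<parallel>\<rho> u\<parallel>\<^sup>2 = \<langle>\<rho> 1, \<rho> (u\<^sup>* u)\<rangle>\<close>, and iterating this with powers of \<open>u\<^sup>* u\<close> bounds it.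
\<close>

lemma power_iteration_bound:
  fixes r :: "nat \<Rightarrow> real"
  assumes r: "\<And>n. 0 \<le> r n" and step: "\<And>n. (r n)\<^sup>2 \<le> r 0 * r (2 * n)"
    and bound: "\<And>n. r n \<le> A * \<tau> ^ n" and \<tau>: "0 < \<tau>"
  shows "r 1 \<le> r 0 * \<tau>"
proof (cases "r 0 = 0")
  case True
  then show ?thesis using step[of 1] by simp
next
  case False
  then have p: "0 < r 0" using r[of 0] by simp
  \<comment> \<open>After normalisation \<open>q n ^ 2 \<le> q (2 * n)\<close>, hence
    \<open>q 1 ^ (2 ^ m) \<le> q (2 ^ m)\<close>. If \<open>q 1\<close> exceeded
    \<open>\<tau>\<close>, it would outgrow the bound \<open>A / r 0 * \<tau> ^ n\<close> along the
    powers of two, whatever \<open>A\<close> is.\<close>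
  define q where "q n = r n / r 0" for n
  have q0: "0 \<le> q n" for n using p r by (simp add: q_def)
  have qs: "(q n)\<^sup>2 \<le> q (2 * n)" for n
    using step[of n] p by (simp add: q_def power2_eq_square field_simps)
  have pow: "q 1 ^ (2 ^ m) \<le> q (2 ^ m)" for m
  proof (induction m)
    case (Suc m)
    have "q 1 ^ (2 ^ Suc m) = (q 1 ^ (2 ^ m))\<^sup>2" by (simp add: power_mult[symmetric] mult.commute)
    also have "\<dots> \<le> (q (2 ^ m))\<^sup>2" using Suc q0 by (intro power_mono) auto
    also have "\<dots> \<le> q (2 ^ Suc m)" using qs[of "2 ^ m"] by simp
    finally show ?case .
  qed simp
  have "q 1 \<le> \<tau>"
  proof (rule ccontr)
    assume "\<not> ?thesis"
    then have "1 < q 1 / \<tau>" using \<tau> by simp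
    then obtain n where n: "A / r 0 < (q 1 / \<tau>) ^ n" using real_arch_pow by blast
    also have "(q 1 / \<tau>) ^ n \<le> (q 1 / \<tau>) ^ (2 ^ n)"
      using \<open>1 < q 1 / \<tau>\<close> by (intro power_increasing) auto
    also have "\<dots> \<le> q (2 ^ n) / \<tau> ^ (2 ^ n)" using pow[of n] \<tau> by (simp add: power_divide divide_right_mono)
    also have "\<dots> \<le> A / r 0" using bound[of "2 ^ n"] p \<tau> by (simp add: q_def field_simps)
    finally show False by simp
  qed
  then show ?thesis using p by (simp add: q_def field_simps)
qed


lemma compress_op_apply:
  "x \<in> carrier H \<Longrightarrow> compress_op H K z X x = adj H K z (X (z x))"
  by (simp add: compress_op_def compose_def)

lemma compress_op_in:
  assumes H: "hilbert_space H" and K: "hilbert_space K" and z: "z \<in> bounded_ops H K" and X: "X \<in> bounded_ops K K"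
  shows "compress_op H K z X \<in> bounded_ops H H"
  unfolding compress_op_def
  by (rule compose_in[OF H K H compose_in[OF H K K z X] adj_in[OF H K z]])

text \<open>Membership in \<open>M\<close> is tested against an element \<open>u\<close> of its
  commutant. The lift \<open>C\<close> commutes with \<open>W\<close>, hence with \<open>T\<close>,
  and it satisfies \<open>C z = z u\<close> and \<open>C\<^sup>* z = z u\<^sup>*\<close>; moving
  \<open>C\<close> across \<open>T\<close> moves \<open>u\<close> across the compression.\<close>

lemma compress_bicommutant:
  fixes H :: "'h hilbert" and K :: "'k hilbert"
  assumes K: "hilbert_space K" and M: "von_neumann_algebra H M"
    and z: "z \<in> bounded_ops H K" and W: "W \<subseteq> bounded_ops K K" and one: "op_one K \<in> W"
    and mult: "\<And>v w. \<lbrakk>v \<in> W; w \<in> W\<rbrakk> \<Longrightarrow> op_mult K v w \<in> W" and adj: "\<And>w. w \<in> W \<Longrightarrow> adj K K w \<in> W"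
    and mem: "\<And>w. w \<in> W \<Longrightarrow> compress_op H K z w \<in> M"
    and T: "T \<in> commutant K (commutant K W)"
  shows "compress_op H K z T \<in> M"
proof (rule vna_memI[OF M])
  note H = vna_hilbert[OF M] and Tb = commutant_in[OF T]
  interpret H: hilbert_space H by (rule H)
  interpret K: hilbert_space K by (rule K)
  show "compress_op H K z T \<in> bounded_ops H H" by (rule compress_op_in[OF H K z Tb])
  fix u x assume u: "u \<in> commutant H M" and x: "x \<in> carrier H"
  define u' where "u' = adj H H u"
  have u': "u' \<in> commutant H M" unfolding u'_def
    by (rule commutant_adj[OF H _ _ u]) (use vna_in[OF M] vna_adj[OF M] in auto)
  have Wb: "w \<in> bounded_ops K K" if "w \<in> W" for w using W that by blast
  have Wc [simp]: "w y \<in> carrier K" if "w \<in> W" "y \<in> carrier K" for w y using bounded_ops_in[OF Wb] that .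
  note [simp] = bounded_ops_in[OF z] bounded_ops_in[OF commutant_in[OF u]] bounded_ops_in[OF commutant_in[OF u']]
    bounded_ops_in[OF Tb] bounded_ops_in[OF adj_in[OF H K z]]
  have u'ip: "ip H (u' x) y = ip H x (u y)" "ip H (u x) y = ip H x (u' y)" if "x \<in> carrier H" "y \<in> carrier H" for x y
    using adj_ip[OF H H commutant_in[OF u] that(2,1)] adj_ip'[OF H H commutant_in[OF u] that] by (simp_all add: u'_def)
  \<comment> \<open>The Gram matrix of the vectors \<open>w z h\<close> has its entries in
    \<open>M\<close>; this is what lets \<open>u\<close> pass through it.\<close>
  define m where "m v w = compress_op H K z (op_mult K (adj K K v) w)" for v w
  have mM: "m v w \<in> M" if "v \<in> W" "w \<in> W" for v w
    unfolding m_def by (intro mem mult adj that)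
  have mip: "ip K (v (z h)) (w (z h')) = ip H h (m v w h')"
    if "v \<in> W" "w \<in> W" "h \<in> carrier H" "h' \<in> carrier H" for v w h h'
    using that adj[OF that(1)] adj_ip'[OF K K Wb[OF that(1)], of "z h" "w (z h')"]
      adj_ip'[OF H K z, of h "adj K K v (w (z h'))"] by (simp add: m_def compress_op_apply)
  have mc [simp]: "m v w h \<in> carrier H" if "v \<in> W" "w \<in> W" "h \<in> carrier H" for v w h
    using bounded_ops_in[OF vna_in[OF M mM]] that .
  define g :: "('h \<Rightarrow> 'h) \<Rightarrow> ('k \<Rightarrow> 'k) \<times> 'h \<Rightarrow> 'k"
    where "g v p = (if fst p \<in> W \<and> snd p \<in> carrier H then fst p (z (v (snd p))) else \<zero>\<^bsub>K\<^esub>)" for v p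
  define e where "e = g (\<lambda>h. h)"
  have gW: "g v (w, h) = w (z (v h))" if "w \<in> W" "h \<in> carrier H" for v w h using that by (simp add: g_def)
  have g0: "g v (w, h) = \<zero>\<^bsub>K\<^esub>" if "\<not> (w \<in> W \<and> h \<in> carrier H)" for v w h using that by (auto simp: g_def)
  have g: "g v p \<in> carrier K" if "\<And>h. h \<in> carrier H \<Longrightarrow> v h \<in> carrier H" for v p
    using that by (simp add: g_def)
  have e [simp]: "e p \<in> carrier K" for p unfolding e_def by (rule g)
  \<comment> \<open>\<open>v'\<close> is the adjoint of \<open>v\<close> and commutes with the
    entries of the Gram matrix, so both copies of \<open>v\<close> can be collected in one
    argument.\<close>
  have gg: "ip K (g v p) (g v p') = ip K (e p) (g (\<lambda>h. v' (v h)) p')"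
    if v: "\<And>h. h \<in> carrier H \<Longrightarrow> v h \<in> carrier H" and v': "\<And>h. h \<in> carrier H \<Longrightarrow> v' h \<in> carrier H"
      and c: "\<And>a h. \<lbrakk>a \<in> M; h \<in> carrier H\<rbrakk> \<Longrightarrow> v' (a h) = a (v' h)"
      and ad: "\<And>x y. \<lbrakk>x \<in> carrier H; y \<in> carrier H\<rbrakk> \<Longrightarrow> ip H (v x) y = ip H x (v' y)" for v v' p p'
  proof (cases "fst p \<in> W \<and> snd p \<in> carrier H \<and> fst p' \<in> W \<and> snd p' \<in> carrier H")
    case True
    then obtain w h w' h' where p: "p = (w, h)" "p' = (w', h')" and val: "w \<in> W" "h \<in> carrier H" "w' \<in> W" "h' \<in> carrier H"
      by (metis prod.collapse)
    have "ip K (g v p) (g v p') = ip H h (v' (m w w' (v h')))"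
      using val v by (simp add: p gW mip ad)
    also have "\<dots> = ip K (e p) (g (\<lambda>h. v' (v h)) p')"
      using val v v' by (simp add: p gW mip e_def c mM)
    finally show ?thesis .
  next
    case False
    then show ?thesis by (auto simp: g_def e_def v v')
  qed
  have lcgg: "ip K (lc K (g v) xs) (lc K (g v) xs) = ip K (lc K e xs) (lc K (g (\<lambda>h. v' (v h))) xs)"
    if v: "\<And>h. h \<in> carrier H \<Longrightarrow> v h \<in> carrier H" and v': "\<And>h. h \<in> carrier H \<Longrightarrow> v' h \<in> carrier H"
      and c: "\<And>a h. \<lbrakk>a \<in> M; h \<in> carrier H\<rbrakk> \<Longrightarrow> v' (a h) = a (v' h)"
      and ad: "\<And>x y. \<lbrakk>x \<in> carrier H; y \<in> carrier H\<rbrakk> \<Longrightarrow> ip H (v x) y = ip H x (v' y)" for v v' xs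
  proof -
    have gi: "g v i \<in> carrier K" "g (\<lambda>h. v' (v h)) i \<in> carrier K" for i by (rule g, simp add: v v')+
    have "ip K (lc K (g v) xs) (lc K (g v) xs) = kf (\<lambda>i j. ip K (g v i) (g v j)) xs xs"
      by (rule ip_lc_lc[OF K gi(1) gi(1)])
    also have "(\<lambda>i j. ip K (g v i) (g v j)) = (\<lambda>i j. ip K (e i) (g (\<lambda>h. v' (v h)) j))"
      by (intro ext gg v v' c ad)
    also have "kf \<dots> xs xs = ip K (lc K e xs) (lc K (g (\<lambda>h. v' (v h))) xs)"
      by (rule ip_lc_lc[OF K e gi(2), symmetric])
    finally show ?thesis .
  qed
  define t where "t h = u' (u h)" for h
  have tx: "t h = u' (u h)" for h by (simp add: t_def)
  have tc: "(t ^^ n) h \<in> carrier H" if "h \<in> carrier H" for n h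
    by (induction n) (simp_all add: t_def that)
  have tcomm: "(t ^^ n) (a h) = a ((t ^^ n) h)" if a: "a \<in> M" and h: "h \<in> carrier H" for a h n
    by (induction n) (simp_all add: t_def h commutantD[OF u a] commutantD[OF u' a] tc[unfolded t_def])
  have tad: "ip H ((t ^^ n) x) y = ip H x ((t ^^ n) y)" if x: "x \<in> carrier H" and y: "y \<in> carrier H" for x y n
    using x
  proof (induction n arbitrary: x)
    case (Suc n)
    have "ip H ((t ^^ Suc n) x) y = ip H ((t ^^ n) (t x)) y" by (simp only: funpow_Suc_right comp_apply)
    also have "\<dots> = ip H (t x) ((t ^^ n) y)" using Suc.IH[of "t x"] tc[OF Suc.prems, of 1] by simp
    also have "\<dots> = ip H x (t ((t ^^ n) y))" using Suc.prems tc[OF y, of n] by (simp add: tx u'ip)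
    finally show ?case by simp
  qed simp
  have tb: "compose (carrier H) u' u \<in> bounded_ops H H"
    by (rule compose_in[OF H H H commutant_in[OF u] commutant_in[OF u']])
  obtain \<tau> where \<tau>: "1 \<le> \<tau>" "\<And>h. h \<in> carrier H \<Longrightarrow> hnorm H (compose (carrier H) u' u h) \<le> \<tau> * hnorm H h"
    using bounded_ops_bound[OF H tb] by blast
  have tn: "hnorm H ((t ^^ n) h) \<le> \<tau> ^ n * hnorm H h" if h: "h \<in> carrier H" for n h
  proof (induction n)
    case (Suc n)
    have "hnorm H (t ((t ^^ n) h)) \<le> \<tau> * hnorm H ((t ^^ n) h)"
      using \<tau>(2)[OF tc[OF h]] tc[OF h] by (simp add: compose_def t_def)
    also have "\<dots> \<le> \<tau> * (\<tau> ^ n * hnorm H h)" using Suc \<tau>(1) by (intro mult_left_mono) auto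
    finally show ?case by simp
  qed simp
  have gt: "g (t ^^ n) p \<in> carrier K" for n p by (rule g[OF tc])
  have gu: "g u p \<in> carrier K" for p by (rule g) simp
  define r where "r xs n = hnorm K (lc K (g (t ^^ n)) xs)" for xs n
  have r0: "r xs 0 = hnorm K (lc K e xs)" for xs by (simp add: r_def e_def id_def)
  have r_nonneg: "0 \<le> r xs n" for xs n unfolding r_def using gt by (intro K.hnorm_nonneg K.lc_in)
  have r_step: "(r xs n)\<^sup>2 \<le> r xs 0 * r xs (2 * n)" for xs n
  proof -
    have "ip K (lc K (g (t ^^ n)) xs) (lc K (g (t ^^ n)) xs) = ip K (lc K e xs) (lc K (g (\<lambda>h. (t ^^ n) ((t ^^ n) h))) xs)"
      by (rule lcgg) (simp_all add: tc tcomm tad)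
    also have "(\<lambda>h. (t ^^ n) ((t ^^ n) h)) = t ^^ (2 * n)" by (simp add: mult_2 funpow_add comp_def)
    finally have "(r xs n)\<^sup>2 = Re (ip K (lc K e xs) (lc K (g (t ^^ (2 * n))) xs))"
      unfolding r_def using gt by (simp add: K.hnorm_sq)
    also have "\<dots> \<le> cmod (ip K (lc K e xs) (lc K (g (t ^^ (2 * n))) xs))" by (rule complex_Re_le_cmod)
    also have "\<dots> \<le> hnorm K (lc K e xs) * hnorm K (lc K (g (t ^^ (2 * n))) xs)"
      by (intro K.cauchy_schwarz K.lc_in e gt)
    finally show ?thesis unfolding r0 by (simp add: r_def)
  qed
  \<comment> \<open>Only the triangle inequality: \<open>A\<close> depends on the combination
    \<open>xs\<close>, and it is \<open>power_iteration_bound\<close> that removes the dependence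
    and leaves the uniform constant \<open>\<tau>\<close>.\<close>
  have r_bound: "\<exists>A. \<forall>n. r xs n \<le> A * \<tau> ^ n" for xs
  proof (induction xs)
    case (Cons q xs)
    obtain A where A: "\<And>n. r xs n \<le> A * \<tau> ^ n" using Cons by blast
    obtain c w h where q: "q = (c, (w, h))" by (metis prod.collapse)
    have "\<exists>B. \<forall>n. hnorm K (g (t ^^ n) (w, h)) \<le> B * \<tau> ^ n"
    proof (cases "w \<in> W \<and> h \<in> carrier H")
      case True
      then have wz: "compose (carrier H) w z \<in> bounded_ops H K" using compose_in[OF H K K z Wb] by simp
      obtain B where B: "1 \<le> B" "\<And>v. v \<in> carrier H \<Longrightarrow> hnorm K (compose (carrier H) w z v) \<le> B * hnorm H v"
        using bounded_ops_bound[OF H wz] by blast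
      have "hnorm K (g (t ^^ n) (w, h)) \<le> (B * hnorm H h) * \<tau> ^ n" for n
      proof -
        have "hnorm K (g (t ^^ n) (w, h)) \<le> B * hnorm H ((t ^^ n) h)"
          using B(2)[OF tc, of h n] True tc[of h n] by (simp add: gW compose_def)
        also have "\<dots> \<le> B * (\<tau> ^ n * hnorm H h)" using B(1) tn[of h n] True by (intro mult_left_mono) auto
        finally show ?thesis by (simp add: mult_ac)
      qed
      then show ?thesis by blast
    next
      case False
      then show ?thesis by (intro exI[of _ 0]) (simp add: g0)
    qed
    then obtain B where B: "\<And>n. hnorm K (g (t ^^ n) (w, h)) \<le> B * \<tau> ^ n" by blast
    have "r (q # xs) n \<le> (cmod c * B + A) * \<tau> ^ n" for n
    proof -
      have "r (q # xs) n \<le> cmod c * hnorm K (g (t ^^ n) (w, h)) + r xs n"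
        unfolding r_def q using K.hnorm_triangle[of "c \<odot>\<^bsub>K\<^esub> g (t ^^ n) (w, h)" "lc K (g (t ^^ n)) xs"] gt by simp
      also have "\<dots> \<le> cmod c * (B * \<tau> ^ n) + A * \<tau> ^ n" by (intro add_mono mult_left_mono A B) simp
      finally show ?thesis by (simp add: algebra_simps)
    qed
    then show ?case by blast
  qed (auto simp: r_def intro: exI[of _ 0])
  have dom: "hnorm K (lc K (g u) xs) \<le> sqrt \<tau> * hnorm K (lc K e xs)" for xs
  proof -
    obtain A where A: "\<And>n. r xs n \<le> A * \<tau> ^ n" using r_bound by blast
    have r1: "r xs 1 \<le> r xs 0 * \<tau>"
      by (rule power_iteration_bound[OF r_nonneg r_step A]) (use \<tau> in simp)
    have "ip K (lc K (g u) xs) (lc K (g u) xs) = ip K (lc K e xs) (lc K (g (\<lambda>h. u' (u h))) xs)"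
      by (rule lcgg) (simp_all add: u'ip commutantD[OF u'])
    also have "(\<lambda>h. u' (u h)) = t ^^ 1" by (simp add: t_def fun_eq_iff)
    finally have "(hnorm K (lc K (g u) xs))\<^sup>2 = Re (ip K (lc K e xs) (lc K (g (t ^^ 1)) xs))"
      using gu by (simp add: K.hnorm_sq)
    also have "\<dots> \<le> cmod (ip K (lc K e xs) (lc K (g (t ^^ 1)) xs))" by (rule complex_Re_le_cmod)
    also have "\<dots> \<le> r xs 0 * r xs 1"
      unfolding r0 unfolding r_def by (intro K.cauchy_schwarz K.lc_in e gt)
    also have "\<dots> \<le> r xs 0 * (r xs 0 * \<tau>)" by (intro mult_left_mono r1 r_nonneg)
    also have "\<dots> = (sqrt \<tau> * hnorm K (lc K e xs))\<^sup>2" using \<tau>(1) by (simp add: r0 power_mult_distrib) (simp add: power2_eq_square)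
    finally show ?thesis by (rule power2_le_imp_le) (use \<tau> in simp)
  qed
  have s\<tau>: "0 \<le> sqrt \<tau>" using \<tau>(1) by simp
  obtain C where C: "C \<in> bounded_ops K K" and Ce: "\<And>i. C (e i) = g u i"
    and C0: "\<And>x. \<lbrakk>x \<in> carrier K; \<And>i. ip K (e i) x = 0\<rbrakk> \<Longrightarrow> C x = \<zero>\<^bsub>K\<^esub>"
    by (rule gram_extension[OF K K e gu s\<tau> dom]) blast
  note [simp] = bounded_ops_in[OF C] bounded_ops_in[OF adj_in[OF K K C]]
  have CW: "C \<in> commutant K W"
  proof (rule commutantI[OF C])
    fix w0 y assume w0: "w0 \<in> W" and y: "y \<in> carrier K"
    have w00: "w0 \<zero>\<^bsub>K\<^esub> = \<zero>\<^bsub>K\<^esub>"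
      using lc_bounded_op[OF K K Wb[OF w0], of "\<lambda>_. \<zero>\<^bsub>K\<^esub>" "[]"] by simp
    show "C (w0 y) = w0 (C y)"
    proof (rule extension_intertwines[OF K K C Wb[OF w0] Wb[OF w0] e C0 _ _ y])
      fix i :: "('k \<Rightarrow> 'k) \<times> 'h"
      obtain w h where i: "i = (w, h)" by (metis prod.collapse)
      show "C (w0 (e i)) = w0 (C (e i))"
      proof (cases "w \<in> W \<and> h \<in> carrier H")
        case True
        then have "w0 (e i) = e (op_mult K w0 w, h)" using mult[OF w0] by (simp add: i e_def gW)
        then show ?thesis using True mult[OF w0] by (simp add: Ce) (simp add: i gW)
      next
        case False
        then have "e i = \<zero>\<^bsub>K\<^esub>" "g u i = \<zero>\<^bsub>K\<^esub>" by (simp_all add: i e_def g0)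
        then show ?thesis using Ce[of i] w00 by simp
      qed
    next
      fix v and i :: "('k \<Rightarrow> 'k) \<times> 'h"
      assume v: "v \<in> carrier K" "\<And>i. ip K (e i) v = 0"
      obtain w h where i: "i = (w, h)" by (metis prod.collapse)
      show "ip K (e i) (w0 v) = 0"
      proof (cases "w \<in> W \<and> h \<in> carrier H")
        case True
        then have "ip K (e i) (w0 v) = ip K (e (op_mult K (adj K K w0) w, h)) v"
          using mult[OF adj[OF w0]] adj_ip[OF K K Wb[OF w0] v(1), of "e i"] by (simp add: i e_def gW)
        then show ?thesis using v by simp
      next
        case False
        then have "e i = \<zero>\<^bsub>K\<^esub>" by (simp add: i e_def g0)
        then show ?thesis using v w0 by simp
      qed
    qed
  qed
  have Cz: "C (z h) = z (u h)" if "h \<in> carrier H" for h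
    using Ce[of "(op_one K, h)"] that one by (simp add: e_def gW)
  \<comment> \<open>The difference \<open>d\<close> is orthogonal to every \<open>e i\<close>, and
    \<open>C\<close> vanishes on such vectors. Pairing \<open>d\<close> with itself therefore gives
    0, since \<open>z (u' h)\<close> is itself one of the \<open>e i\<close>.\<close>
  have Cadj: "adj K K C (z h) = z (u' h)" if h: "h \<in> carrier H" for h
  proof -
    define d where "d = adj K K C (z h) \<ominus>\<^bsub>K\<^esub> z (u' h)"
    have d: "d \<in> carrier K" using h by (simp add: d_def)
    have "ip K d (e i) = 0" for i
    proof -
      obtain w k where i: "i = (w, k)" by (metis prod.collapse)
      show ?thesis
      proof (cases "w \<in> W \<and> k \<in> carrier H")
        case True
        have m1: "ip K (z h1) (w (z h2)) = ip H h1 (m (op_one K) w h2)" if "h1 \<in> carrier H" "h2 \<in> carrier H" for h1 h2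
          using mip[OF one, of w h1 h2] True that by simp
        have "ip K (adj K K C (z h)) (e i) = ip K (z h) (g u i)"
          using h adj_ip[OF K K C e, of "z h" i] by (simp add: Ce)
        also have "\<dots> = ip K (z (u' h)) (e i)"
          using True h one by (simp add: i gW e_def m1 u'ip commutantD[OF u mM])
        finally show ?thesis using h by (simp add: d_def)
      next
        case False
        then have "e i = \<zero>\<^bsub>K\<^esub>" by (simp add: i e_def g0)
        then show ?thesis using d by simp
      qed
    qed
    then have od: "ip K (e i) d = 0" for i using K.ip_cnj[of "e i" d] d by simp
    have "ip K d d = ip K (adj K K C (z h)) d - ip K (z (u' h)) d"
      using d h by (subst (1) d_def) simp
    also have "ip K (adj K K C (z h)) d = 0" using adj_ip[OF K K C d, of "z h"] C0[OF d od] h by simp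
    also have "ip K (z (u' h)) d = 0" using od[of "(op_one K, u' h)"] h one by (simp add: e_def gW)
    finally have "d = \<zero>\<^bsub>K\<^esub>" using d by (intro K.ip_definite) simp_all
    then show ?thesis using h K.M.minus_equality[of "adj K K C (z h)" "\<ominus>\<^bsub>K\<^esub> z (u' h)"] by (simp add: d_def a_minus_def)
  qed
  show "compress_op H K z T (u x) = u (compress_op H K z T x)"
  proof (rule H.vec_eqI)
    fix h assume h: "h \<in> carrier H"
    have "ip H h (compress_op H K z T (u x)) = ip K (z h) (T (C (z x)))"
      using h x adj_ip'[OF H K z h, of "T (z (u x))"] by (simp add: compress_op_apply Cz)
    also have "\<dots> = ip K (z h) (C (T (z x)))" using commutantD[OF T CW, of "z x"] x by simp
    also have "\<dots> = ip K (z (u' h)) (T (z x))"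
      using adj_ip[OF K K C, of "T (z x)" "z h"] h x by (simp add: Cadj)
    also have "\<dots> = ip H (u' h) (compress_op H K z T x)"
      using h x adj_ip'[OF H K z, of "u' h" "T (z x)"] by (simp add: compress_op_apply)
    also have "\<dots> = ip H h (u (compress_op H K z T x))"
      using h x by (simp add: u'ip compress_op_apply)
    finally show "ip H h (compress_op H K z T (u x)) = ip H h (u (compress_op H K z T x))" .
  qed (use x in \<open>simp_all add: compress_op_apply\<close>)
qed

subsection \<open>Conjugation by isometries\<close>

text \<open>Preservation of inner products is the form that interacts with adjoints; the condition
  in \<open>isometric_embedding\<close> follows by taking norms.\<close>

definition isometric :: "'h hilbert \<Rightarrow> 'k hilbert \<Rightarrow> ('h \<Rightarrow> 'k) \<Rightarrow> bool" where
  "isometric H K z \<longleftrightarrow> z \<in> bounded_ops H K \<and> (\<forall>x\<in>carrier H. \<forall>y\<in>carrier H. ip K (z x) (z y) = ip H x y)"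

lemma isometric_in: "isometric H K z \<Longrightarrow> z \<in> bounded_ops H K"
  by (simp add: isometric_def)

lemma isometric_ip: "\<lbrakk>isometric H K z; x \<in> carrier H; y \<in> carrier H\<rbrakk> \<Longrightarrow> ip K (z x) (z y) = ip H x y"
  by (simp add: isometric_def)

lemma isometric_adj:
  assumes H: "hilbert_space H" and K: "hilbert_space K" and z: "isometric H K z" and x: "x \<in> carrier H"
  shows "adj H K z (z x) = x"
proof -
  interpret hilbert_space H by (rule H)
  note zb = isometric_in[OF z]
  show ?thesis
    using x bounded_ops_in[OF zb] bounded_ops_in[OF adj_in[OF H K zb]]
    by (intro vec_eqI) (simp_all add: adj_ip'[OF H K zb] isometric_ip[OF z])
qed

lemma compress_ip:
  assumes "hilbert_space H" "hilbert_space K" "z \<in> bounded_ops H K" "X \<in> bounded_ops K K" "x \<in> carrier H" "y \<in> carrier H"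
  shows "ip H y (compress_op H K z X x) = ip K (z y) (X (z x))"
  using adj_ip'[OF assms(1-3,6), of "X (z x)"] assms
  by (simp add: compress_op_apply bounded_ops_in[OF assms(3)] bounded_ops_in[OF assms(4)])

lemma conjugation_linear_map:
  assumes K: "hilbert_space K" and R: "von_neumann_algebra K R" and U: "U \<in> bounded_ops K K"
    and inv: "\<And>X. X \<in> R \<Longrightarrow> compress_op K K U X \<in> R"
  shows "linear_map K R K R (compress_op K K U)"
proof -
  interpret hilbert_space K by (rule K)
  note Rb = vna_in[OF R] and c = compress_op_in[OF K K U]
  show ?thesis
    unfolding linear_map_def
  proof (intro conjI ballI allI)
    fix a b k assume a: "a \<in> R" and b: "b \<in> R"
    show "compress_op K K U (op_add K a b) = op_add K (compress_op K K U a) (compress_op K K U b)"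
      by (rule bounded_ops_eqI_ip[OF K c[OF Rb[OF vna_add[OF R a b]]] op_add_in[OF K c[OF Rb[OF a]] c[OF Rb[OF b]]]])
        (simp add: compress_ip[OF K K U] Rb a b vna_add[OF R] bounded_ops_in[OF U] bounded_ops_in[OF Rb[OF a]]
          bounded_ops_in[OF Rb[OF b]] bounded_ops_in[OF c[OF Rb[OF a]]] bounded_ops_in[OF c[OF Rb[OF b]]])
  next
    fix k a assume a: "a \<in> R"
    show "compress_op K K U (op_smult K k a) = op_smult K k (compress_op K K U a)"
      by (rule bounded_ops_eqI_ip[OF K c[OF Rb[OF vna_smult[OF R a]]] op_smult_in[OF K c[OF Rb[OF a]]]])
        (simp add: compress_ip[OF K K U] Rb a vna_smult[OF R] bounded_ops_in[OF U] bounded_ops_in[OF Rb[OF a]]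
          bounded_ops_in[OF c[OF Rb[OF a]]])
  qed (use inv in auto)
qed

text \<open>\<open>U\<close> is an arbitrary bounded operator, so that the result also covers
  \<open>x \<mapsto> c\<^sup>* x c\<close> for an element \<open>c\<close> of the algebra.\<close>

lemma conjugation_normal_map:
  assumes K: "hilbert_space K" and R: "von_neumann_algebra K R" and Ub: "U \<in> bounded_ops K K"
    and inv: "\<And>X. X \<in> R \<Longrightarrow> compress_op K K U X \<in> R"
  shows "normal_map K R K R (compress_op K K U)"
proof -
  interpret hilbert_space K by (rule K)
  note Rb = vna_in[OF R] and c = compress_op_in[OF K K Ub] and cip = compress_ip[OF K K Ub]
  note [simp] = bounded_ops_in[OF Ub]
  show ?thesis
  proof (rule normal_mapI[OF R R inv])
    show "self_adjoint K (compress_op K K U a)" if a: "a \<in> R" "self_adjoint K a" for a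
      by (rule self_adjointI_qf[OF K c[OF Rb[OF a(1)]]])
        (simp add: cip[OF Rb[OF a(1)]] self_adjoint_qf[OF K a(2)])
    show "op_le K (compress_op K K U a) (compress_op K K U b)" if ab: "a \<in> R" "b \<in> R" "op_le K a b" for a b
      using ab(3) by (simp add: op_le_def cip[OF Rb[OF ab(1)]] cip[OF Rb[OF ab(2)]])
    fix D s x assume D: "directed_in K R D" and s: "s \<in> R" "weak_lim K D s" and x: "x \<in> carrier K"
    have "((\<lambda>a. ip K (U x) (a (U x))) \<longlongrightarrow> ip K (U x) (s (U x))) (op_net K D)"
      using s(2) x by (simp add: weak_lim_def)
    moreover have "\<forall>\<^sub>F a in op_net K D. ip K (U x) (a (U x)) = ip K x (compress_op K K U a x)"
      using eventually_op_net_in[OF D] by (rule eventually_mono) (use cip[OF Rb[OF directed_inD(1)[OF D]] x x] in simp)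
    ultimately show "((\<lambda>a. ip K x (compress_op K K U a x)) \<longlongrightarrow> ip K x (compress_op K K U s x)) (op_net K D)"
      unfolding cip[OF Rb[OF s(1)] x x] by (rule Lim_transform_eventually)
  qed
qed

lemma conjugation_quantum_process:
  assumes K: "hilbert_space K" and R: "von_neumann_algebra K R" and U: "isometric K K U"
    and inv: "\<And>X. X \<in> R \<Longrightarrow> compress_op K K U X \<in> R"
  shows "quantum_process K R (compress_op K K U)"
  unfolding quantum_process_def
proof (intro conjI R)
  interpret hilbert_space K by (rule K)
  note Ub = isometric_in[OF U]
  note Rb = vna_in[OF R] and c = compress_op_in[OF K K Ub] and cip = compress_ip[OF K K Ub]
  note [simp] = bounded_ops_in[OF Ub]
  have pos: "positive_matrix K n (\<lambda>i j. compress_op K K U (a i j))"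
    if a: "\<forall>i<n. \<forall>j<n. a i j \<in> R" and p: "positive_matrix K n a" for n a
    unfolding positive_matrix_def
  proof (intro allI impI)
    fix \<xi> assume \<xi>: "\<forall>i<n. \<xi> i \<in> carrier K"
    have "(\<Sum>i<n. \<Sum>j<n. ip K (U (\<xi> i)) (a i j (U (\<xi> j)))) \<in> \<real>\<^sub>\<ge>\<^sub>0"
      using p[unfolded positive_matrix_def, THEN spec, of "\<lambda>i. U (\<xi> i)"] \<xi> by simp
    moreover have "(\<Sum>i<n. \<Sum>j<n. ip K (\<xi> i) (compress_op K K U (a i j) (\<xi> j)))
        = (\<Sum>i<n. \<Sum>j<n. ip K (U (\<xi> i)) (a i j (U (\<xi> j))))"
      using a \<xi> by (intro sum.cong refl cip) (auto intro: Rb)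
    ultimately show "(\<Sum>i<n. \<Sum>j<n. ip K (\<xi> i) (compress_op K K U (a i j) (\<xi> j))) \<in> \<real>\<^sub>\<ge>\<^sub>0" by simp
  qed
  show "completely_positive K R K R (compress_op K K U)"
    unfolding completely_positive_def using conjugation_linear_map[OF K R Ub inv] pos by blast
  show "compress_op K K U (op_one K) = op_one K"
    by (rule bounded_ops_eqI_ip[OF K c[OF op_one_in[OF K]] op_one_in[OF K]])
      (simp add: cip[OF op_one_in[OF K]] isometric_ip[OF U])
  show "normal_map K R K R (compress_op K K U)" by (rule conjugation_normal_map[OF K R Ub inv])
qed

section \<open>Conjugation by a unitary as a homomorphism, and its powers\<close>

definition unitary :: "'h hilbert \<Rightarrow> ('h \<Rightarrow> 'h) \<Rightarrow> bool" where
  "unitary H U \<longleftrightarrow> isometric H H U \<and> (\<forall>x\<in>carrier H. U (adj H H U x) = x)"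

text \<open>The product formula inserts \<open>U U\<^sup>* = 1\<close> between the two factors; this
  is the step that fails for a mere isometry.\<close>

lemma
  assumes K: "hilbert_space K" and U: "unitary K U" and X: "X \<in> bounded_ops K K"
  shows conjugation_mult: "Y \<in> bounded_ops K K \<Longrightarrow>
      compress_op K K U (op_mult K X Y) = op_mult K (compress_op K K U X) (compress_op K K U Y)"
    and conjugation_adj: "compress_op K K U (adj K K X) = adj K K (compress_op K K U X)"
proof -
  interpret hilbert_space K by (rule K)
  have iso: "isometric K K U" using U by (simp add: unitary_def)
  note Ub = isometric_in[OF iso] and Ua = adj_in[OF K K isometric_in[OF iso]]
  note c = compress_op_in[OF K K Ub] and cip = compress_ip[OF K K Ub]
  note [simp] = bounded_ops_in[OF Ub] bounded_ops_in[OF Ua] bounded_ops_in[OF X]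
  show "compress_op K K U (op_mult K X Y) = op_mult K (compress_op K K U X) (compress_op K K U Y)"
    if Y: "Y \<in> bounded_ops K K"
    by (rule bounded_ops_eqI[OF c[OF op_mult_in[OF K X Y]] op_mult_in[OF K c[OF X] c[OF Y]]])
      (use U in \<open>simp add: compress_op_apply bounded_ops_in[OF Y] unitary_def\<close>)
  note Xa = adj_in[OF K K X]
  show "compress_op K K U (adj K K X) = adj K K (compress_op K K U X)"
  proof (rule adj_eqI[OF K c[OF Xa], symmetric])
    fix x y assume xy: "x \<in> carrier K" "y \<in> carrier K"
    have "ip K (compress_op K K U (adj K K X) y) x = cnj (ip K (U x) (adj K K X (U y)))"
      using xy bounded_ops_in[OF c[OF Xa]] cip[OF Xa xy(2,1)] ip_cnj[of "compress_op K K U (adj K K X) y" x] by simp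
    also have "\<dots> = cnj (ip K (X (U x)) (U y))" using adj_ip'[OF K K X, of "U x" "U y"] xy by simp
    also have "\<dots> = ip K (U y) (X (U x))" using ip_cnj[of "U y" "X (U x)"] xy by simp
    finally show "ip K (compress_op K K U (adj K K X) y) x = ip K y (compress_op K K U X x)"
      using cip[OF X xy] by simp
  qed
qed

lemma conjugation_star_hom:
  assumes K: "hilbert_space K" and R: "von_neumann_algebra K R" and U: "unitary K U"
    and inv: "\<And>X. X \<in> R \<Longrightarrow> compress_op K K U X \<in> R"
  shows "star_hom K R K R (compress_op K K U)"
proof -
  have Ub: "U \<in> bounded_ops K K" using U by (simp add: unitary_def isometric_in)
  show ?thesis
    unfolding star_hom_def
    using conjugation_linear_map[OF K R Ub inv] conjugation_mult[OF K U] conjugation_adj[OF K U] vna_in[OF R] by blast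
qed

lemma compress_funpow:
  assumes K: "hilbert_space K" and U: "U \<in> bounded_ops K K" and X: "X \<in> bounded_ops K K"
  shows "(compress_op K K U ^^ n) X \<in> bounded_ops K K"
    and "x \<in> carrier K \<Longrightarrow> (compress_op K K U ^^ n) X x = (adj K K U ^^ n) (X ((U ^^ n) x))"
proof -
  show in_n: "(compress_op K K U ^^ n) X \<in> bounded_ops K K" for n
    by (induction n) (simp_all add: X compress_op_in[OF K K U])
  show "x \<in> carrier K \<Longrightarrow> (compress_op K K U ^^ n) X x = (adj K K U ^^ n) (X ((U ^^ n) x))"
  proof (induction n arbitrary: x)
    case (Suc n)
    have "(compress_op K K U ^^ Suc n) X x = adj K K U ((compress_op K K U ^^ n) X (U x))"
      using Suc.prems by (simp add: compress_op_apply)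
    also have "\<dots> = adj K K U ((adj K K U ^^ n) (X ((U ^^ n) (U x))))"
      using Suc bounded_ops_in[OF U] by simp
    finally show ?case by (simp add: funpow_swap1)
  qed simp
qed

subsection \<open>Unitary extension of an isometry\<close>

text \<open>Equal Gram matrices give combinations of equal norm, so \<open>gram_extension\<close>
  applies with constant 1; the identity \<open>T\<^sup>* T = 1\<close> then has to be checked only
  on the total family.\<close>

lemma isometric_extension:
  assumes H: "hilbert_space H" and K: "hilbert_space K" and e: "total_family H e"
    and f: "\<And>i. f i \<in> carrier K" and gram: "\<And>i j. ip K (f i) (f j) = ip H (e i) (e j)"
  obtains T where "isometric H K T" "\<And>i. T (e i) = f i"
proof -
  interpret H: hilbert_space H by (rule H)
  interpret K: hilbert_space K by (rule K)
  note ei = total_in[OF e]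
  have "hnorm K (lc K f xs) = hnorm H (lc H e xs)" for xs
    unfolding hnorm_def ip_lc_lc[of K f f, OF K f f] ip_lc_lc[of H e e, OF H ei ei] gram ..
  then have dom: "hnorm K (lc K f xs) \<le> 1 * hnorm H (lc H e xs)" for xs by simp
  obtain T where T: "T \<in> bounded_ops H K" "\<And>i. T (e i) = f i"
    by (rule gram_extension[OF H K ei f zero_le_one dom]) blast
  note Ta = adj_in[OF H K T(1)]
  have TT1: "compose (carrier H) (adj H K T) T = op_one H"
  proof (rule total_op_eqI[OF H H e compose_in[OF H K H T(1) Ta] op_one_in[OF H]])
    fix i
    show "compose (carrier H) (adj H K T) T (e i) = op_one H (e i)"
      by (rule total_vec_eqI[OF H e])
        (simp_all add: compose_def ei T(2) f bounded_ops_in[OF Ta] adj_ip'[OF H K T(1)] gram)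
  qed
  have TT: "adj H K T (T y) = y" if "y \<in> carrier H" for y
    using fun_cong[OF TT1, of y] that by (simp add: compose_def)
  have "ip K (T x) (T y) = ip H x y" if "x \<in> carrier H" "y \<in> carrier H" for x y
    using adj_ip'[OF H K T(1) that(1) bounded_ops_in[OF T(1) that(2)]] TT[OF that(2)] by simp
  then have "isometric H K T" using T(1) by (simp add: isometric_def)
  then show thesis using that T(2) by blast
qed

text \<open>Lets a family indexed by \<open>nat \<times> 'i\<close> be reindexed by
  \<open>'i\<close>, so that its kernel space keeps the type of a kernel space over
  \<open>'i\<close>.\<close>

lemma infinite_times_nat_bij:
  assumes "infinite (UNIV :: 'i set)"
  obtains f :: "'i \<Rightarrow> nat \<times> 'i" where "bij f"
proof -
  have "ordLeq3 (card_of (UNIV :: nat set)) (card_of (UNIV :: 'i set))"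
    using assms infinite_iff_card_of_nat by blast
  then have "ordIso2 (card_of ((UNIV :: nat set) \<times> (UNIV :: 'i set))) (card_of (UNIV :: 'i set))"
    using card_of_Times_infinite[OF assms] by blast
  then have "ordIso2 (card_of (UNIV :: 'i set)) (card_of ((UNIV :: nat set) \<times> (UNIV :: 'i set)))"
    by (rule ordIso_symmetric)
  then obtain f :: "'i \<Rightarrow> nat \<times> 'i" where "bij_betw f UNIV (UNIV \<times> UNIV)"
    using card_of_ordIso by blast
  then show thesis using that by simp
qed

lemma kf_cong:
  assumes "\<And>i j. \<lbrakk>i \<in> snd ` set xs; j \<in> snd ` set ys\<rbrakk> \<Longrightarrow> k i j = k' i j"
  shows "kf k xs ys = kf k' xs ys"
proof -
  have ev_cong: "ev f zs = ev g zs" if "\<And>i. i \<in> snd ` set zs \<Longrightarrow> f i = g i" for f g and zs :: "(complex \<times> 'i) list"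
    using that by (induction zs) auto
  show ?thesis unfolding kf_def by (intro arg_cong[of _ _ cnj] ev_cong) (use assms in blast)
qed

lemma isometric_funpow:
  assumes V: "isometric H H V"
  shows "x \<in> carrier H \<Longrightarrow> (V ^^ n) x \<in> carrier H"
    and "\<lbrakk>x \<in> carrier H; y \<in> carrier H\<rbrakk> \<Longrightarrow> ip H ((V ^^ n) x) ((V ^^ n) y) = ip H x y"
proof -
  show c: "(V ^^ n) x \<in> carrier H" if "x \<in> carrier H" for x n
    by (induction n) (simp_all add: that bounded_ops_in[OF isometric_in[OF V]])
  show "\<lbrakk>x \<in> carrier H; y \<in> carrier H\<rbrakk> \<Longrightarrow> ip H ((V ^^ n) x) ((V ^^ n) y) = ip H x y"
    by (induction n) (simp_all add: isometric_ip[OF V] c)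
qed

lemma adj_funpow:
  assumes H: "hilbert_space H" and V: "V \<in> bounded_ops H H"
  shows "y \<in> carrier H \<Longrightarrow> (adj H H V ^^ n) y \<in> carrier H"
    and "\<lbrakk>x \<in> carrier H; y \<in> carrier H\<rbrakk> \<Longrightarrow> ip H x ((adj H H V ^^ n) y) = ip H ((V ^^ n) x) y"
proof -
  note Va = adj_in[OF H H V]
  show c: "(adj H H V ^^ n) y \<in> carrier H" if "y \<in> carrier H" for y n
    by (induction n) (simp_all add: that bounded_ops_in[OF Va])
  show "\<lbrakk>x \<in> carrier H; y \<in> carrier H\<rbrakk> \<Longrightarrow> ip H x ((adj H H V ^^ n) y) = ip H ((V ^^ n) x) y"
  proof (induction n arbitrary: x)
    case (Suc n)
    then show ?case
      using adj_ip'[OF H H V, of x "(adj H H V ^^ n) y"] c[of y n] bounded_ops_in[OF V, of x]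
      by (simp add: funpow_swap1)
  qed simp
qed

text \<open>
  The extension lives on the span of vectors \<open>u (n, i) = U\<^sup>-\<^sup>n e\<^sub>i\<close>, whose Gram matrix is dictated
  by \<open>V\<close>; an index set of the size of \<open>nat \<times> 'i\<close> is again \<open>'i\<close>.
\<close>

lemma unitary_extension:
  fixes H :: "'h hilbert" and e :: "'i \<Rightarrow> 'h"
  assumes H: "hilbert_space H" and e: "total_family H e" and V: "isometric H H V" and inf: "infinite (UNIV :: 'i set)"
  obtains K :: "('i \<Rightarrow> complex) hilbert" and z U where "hilbert_space K" "isometric H K z" "unitary K U"
    "\<And>x. x \<in> carrier H \<Longrightarrow> U (z x) = z (V x)"
proof -
  interpret H: hilbert_space H by (rule H)
  note Vb = isometric_in[OF V] and ei = total_in[OF e]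
  note Vn = isometric_funpow[OF V] and [simp] = isometric_funpow(1)[OF V] total_in[OF e] bounded_ops_in[OF Vb]
  obtain f :: "'i \<Rightarrow> nat \<times> 'i" where f: "bij f" using infinite_times_nat_bij[OF inf] by blast
  \<comment> \<open>The inner products of \<open>U\<^sup>-\<^sup>m e\<^sub>i\<close> and
    \<open>U\<^sup>-\<^sup>n e\<^sub>j\<close> that a unitary \<open>U\<close> extending
    \<open>V\<close> must have: only the difference of the exponents matters, and \<open>V\<close>
    acts on the side with the smaller one.\<close>
  define k0 where "k0 p q = (if fst q \<le> fst p then ip H (e (snd p)) ((V ^^ (fst p - fst q)) (e (snd q)))
     else ip H ((V ^^ (fst q - fst p)) (e (snd p))) (e (snd q)))" for p q
  \<comment> \<open>Multiplying by the power \<open>N\<close> of \<open>U\<close>, for a common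
    bound \<open>N\<close> of the exponents, would move finitely many of these vectors into
    \<open>H\<close>; every finite Gram matrix is thus one of vectors of \<open>H\<close>, hence
    positive.\<close>
  have k0: "k0 p q = ip H ((V ^^ (N - fst p)) (e (snd p))) ((V ^^ (N - fst q)) (e (snd q)))"
    if "fst p \<le> N" "fst q \<le> N" for p q N
  proof (cases "fst q \<le> fst p")
    case True
    have N: "V ^^ (N - fst q) = (V ^^ (N - fst p)) \<circ> (V ^^ (fst p - fst q))"
      unfolding funpow_add[symmetric] using True that by simp
    show ?thesis using True by (simp add: k0_def N Vn(2))
  next
    case False
    have N: "V ^^ (N - fst p) = (V ^^ (N - fst q)) \<circ> (V ^^ (fst q - fst p))"
      unfolding funpow_add[symmetric] using False that by simp
    show ?thesis using False by (simp add: k0_def N Vn(2))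
  qed
  have "psd_kernel (\<lambda>i j. k0 (f i) (f j))"
    unfolding psd_kernel_def
  proof
    fix xs :: "(complex \<times> 'i) list"
    define N where "N = Max (insert 0 ((\<lambda>i. fst (f i)) ` snd ` set xs))"
    have N: "fst (f i) \<le> N" if "i \<in> snd ` set xs" for i
      unfolding N_def using that by (intro Max_ge) auto
    define d where "d i = (V ^^ (N - fst (f i))) (e (snd (f i)))" for i
    have d: "d i \<in> carrier H" for i by (simp add: d_def)
    have "kf (\<lambda>i j. k0 (f i) (f j)) xs xs = kf (\<lambda>i j. ip H (d i) (d j)) xs xs"
      by (rule kf_cong) (use k0 N in \<open>simp add: d_def\<close>)
    also have "\<dots> = ip H (lc H d xs) (lc H d xs)" by (rule ip_lc_lc[OF H d d, symmetric])
    finally show "kf (\<lambda>i j. k0 (f i) (f j)) xs xs \<in> \<real>\<^sub>\<ge>\<^sub>0"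
      using d by (simp add: H.ip_self)
  qed
  then obtain K :: "('i \<Rightarrow> complex) hilbert" and E where K: "hilbert_space K" and E: "total_family K E"
    and Eip: "\<And>i j. ip K (E i) (E j) = k0 (f i) (f j)"
    using kernel_hilbert_space by blast
  interpret K: hilbert_space K by (rule K)
  define u where "u p = E (inv_into UNIV f p)" for p
  have u [simp]: "u p \<in> carrier K" for p by (simp add: u_def total_in[OF E])
  have uip: "ip K (u p) (u q) = k0 p q" for p q
    using f by (simp add: u_def Eip bij_is_surj surj_f_inv_f)
  have uE: "u (f i) = E i" for i using f by (simp add: u_def bij_is_inj)
  have u_total: "total_family K u" using E uE unfolding total_family_def by (metis u)
  have u0: "ip K (u (0, i)) (u (0, j)) = ip H (e i) (e j)" for i j by (simp add: uip k0_def)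
  obtain z where z: "isometric H K z" "\<And>i. z (e i) = u (0, i)"
    by (rule isometric_extension[OF H K e u u0]) blast
  note zb = isometric_in[OF z(1)]
  note [simp] = bounded_ops_in[OF zb] bounded_ops_in[OF adj_in[OF H K zb]]
  \<comment> \<open>The Gram matrix of \<open>g\<close> below contains \<open>z (V (e i))\<close>,
    where \<open>V (e i)\<close> need not be a family vector; totality extends the formula to all of
    \<open>H\<close>.\<close>
  have zu: "ip K (z x) (u (m, j)) = ip H ((V ^^ m) x) (e j)" if x: "x \<in> carrier H" for x m j
  proof -
    have "adj H K z (u (m, j)) = (adj H H V ^^ m) (e j)"
    proof (rule total_vec_eqI[OF H e])
      fix i
      show "ip H (e i) (adj H K z (u (m, j))) = ip H (e i) ((adj H H V ^^ m) (e j))"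
        by (simp add: adj_ip'[OF H K zb] adj_funpow(2)[OF H Vb] z(2) uip k0_def)
    qed (simp_all add: adj_funpow(1)[OF H Vb])
    then show ?thesis
      using adj_ip'[OF H K zb x u[of "(m, j)"]] adj_funpow(2)[OF H Vb x ei] by simp
  qed
  have uz: "ip K (u (m, j)) (z x) = ip H (e j) ((V ^^ m) x)" if x: "x \<in> carrier H" for x m j
    using zu[OF x, of m j] K.ip_cnj[of "u (m, j)" "z x"] H.ip_cnj[of "e j" "(V ^^ m) x"] x by simp
  \<comment> \<open>\<open>U\<close> lowers the negative exponent by one; at exponent 0, where
    \<open>u (0, i) = z (e i)\<close>, it applies \<open>V\<close> inside \<open>z\<close>.\<close>
  define g where "g p = (case fst p of 0 \<Rightarrow> z (V (e (snd p))) | Suc n \<Rightarrow> u (n, snd p))" for p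
  have g: "g p \<in> carrier K" for p by (simp add: g_def split: nat.split)
  have gram: "ip K (g p) (g q) = ip K (u p) (u q)" for p q
    by (cases "fst p"; cases "fst q")
      (simp_all add: g_def uip k0_def zu uz isometric_ip[OF z(1)] isometric_ip[OF V] funpow_swap1)
  obtain U where U: "isometric K K U" "\<And>p. U (u p) = g p"
    by (rule isometric_extension[OF K K u_total g gram]) blast
  note Ub = isometric_in[OF U(1)] and Ua = adj_in[OF K K isometric_in[OF U(1)]]
  have UU1: "compose (carrier K) U (adj K K U) = op_one K"
  proof (rule total_op_eqI[OF K K u_total compose_in[OF K K K Ua Ub] op_one_in[OF K]])
    fix p :: "nat \<times> 'i"
    \<comment> \<open>Every family vector is hit, from the exponent one higher; for the isometry
      \<open>U\<close> this yields \<open>U U\<^sup>* = 1\<close>.\<close>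
    have "u p = U (u (Suc (fst p), snd p))" by (simp add: U(2) g_def)
    then show "compose (carrier K) U (adj K K U) (u p) = op_one K (u p)"
      by (simp add: compose_def isometric_adj[OF K K U(1)] bounded_ops_in[OF Ub])
  qed
  have "U (adj K K U x) = x" if "x \<in> carrier K" for x
    using fun_cong[OF UU1, of x] that by (simp add: compose_def)
  then have unitary: "unitary K U" using U(1) by (simp add: unitary_def)
  have Uz1: "compose (carrier H) U z = compose (carrier H) z V"
    by (rule total_op_eqI[OF H K e compose_in[OF H K K zb Ub] compose_in[OF H H K Vb zb]])
      (simp add: compose_def z(2) U(2) g_def)
  have "U (z x) = z (V x)" if "x \<in> carrier H" for x
    using fun_cong[OF Uz1, of x] that by (simp add: compose_def)
  then show thesis using that[OF K z(1) unitary] by blast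
qed

subsection \<open>The dilation generated by a unitary extension\<close>

lemma lift_op_apply: "x \<in> carrier K \<Longrightarrow> lift_op H K z a x = z (a (adj H K z x))"
  by (simp add: lift_op_def compose_def)

locale isometric_process = H: hilbert_space H + K: hilbert_space K
  for H :: "'h hilbert" and K :: "'k hilbert" and M V z U +
  assumes vna: "von_neumann_algebra H M"
    and V: "isometric H H V" and V_inv: "\<And>a. a \<in> M \<Longrightarrow> compress_op H H V a \<in> M"
    and z: "isometric H K z" and U: "unitary K U"
    and Uz: "\<And>x. x \<in> carrier H \<Longrightarrow> U (z x) = z (V x)"
begin

abbreviation "V' \<equiv> adj H H V"
abbreviation "U' \<equiv> adj K K U"
abbreviation "z' \<equiv> adj H K z"
abbreviation "\<Theta> \<equiv> compress_op K K U"

lemmas Hh = H.hilbert_space_axioms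
lemmas Kh = K.hilbert_space_axioms
lemmas Vb = isometric_in[OF V]
lemmas zb = isometric_in[OF z]

lemma U_iso: "isometric K K U"
  using U by (simp add: unitary_def)

lemmas Ub = isometric_in[OF U_iso]

lemmas closed [simp] = bounded_ops_in[OF Vb] bounded_ops_in[OF zb] bounded_ops_in[OF Ub]
  bounded_ops_in[OF adj_in[OF Hh Hh Vb]] bounded_ops_in[OF adj_in[OF Hh Kh zb]] bounded_ops_in[OF adj_in[OF Kh Kh Ub]]
  isometric_funpow(1)[OF V] isometric_funpow(1)[OF U_iso] adj_funpow(1)[OF Hh Vb] adj_funpow(1)[OF Kh Ub]

lemma M_closed [simp]: "\<lbrakk>a \<in> M; x \<in> carrier H\<rbrakk> \<Longrightarrow> a x \<in> carrier H"
  using bounded_ops_in[OF vna_in[OF vna]] .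

lemma UU' [simp]: "x \<in> carrier K \<Longrightarrow> U (U' x) = x"
  using U by (simp add: unitary_def)

lemma U'U [simp]: "x \<in> carrier K \<Longrightarrow> U' (U x) = x"
  by (rule isometric_adj[OF Kh Kh U_iso])

lemma z'z [simp]: "x \<in> carrier H \<Longrightarrow> z' (z x) = x"
  by (rule isometric_adj[OF Hh Kh z])

lemma Uz_pow: "x \<in> carrier H \<Longrightarrow> (U ^^ n) (z x) = z ((V ^^ n) x)"
  by (induction n) (simp_all add: Uz)

text \<open>The adjoint form of \<open>U z = z V\<close>. Together with \<open>Uz_pow\<close> it
  converts powers of \<open>U\<close> next to \<open>z\<close> into powers of
  \<open>V\<close>.\<close>

lemma z'U'_pow:
  assumes y: "y \<in> carrier K"
  shows "z' ((U' ^^ n) y) = (V' ^^ n) (z' y)"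
proof (rule H.vec_eqI)
  fix h assume h: "h \<in> carrier H"
  have "ip H h (z' ((U' ^^ n) y)) = ip K ((U ^^ n) (z h)) y"
    using h y by (simp add: adj_ip'[OF Hh Kh zb] adj_funpow(2)[OF Kh Ub])
  also have "\<dots> = ip H h ((V' ^^ n) (z' y))"
    using h y by (simp add: Uz_pow adj_funpow(2)[OF Hh Vb] adj_ip'[OF Hh Kh zb])
  finally show "ip H h (z' ((U' ^^ n) y)) = ip H h ((V' ^^ n) (z' y))" .
qed (use y in simp_all)

lemma U_U'_pow:
  assumes "x \<in> carrier K"
  shows "n \<le> m \<Longrightarrow> (U ^^ m) ((U' ^^ n) x) = (U ^^ (m - n)) x"
    and "m \<le> n \<Longrightarrow> (U ^^ m) ((U' ^^ n) x) = (U' ^^ (n - m)) x"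
proof -
  have c: "(U ^^ k) ((U' ^^ k) y) = y" if "y \<in> carrier K" for k y
    using that
  proof (induction k)
    case (Suc k)
    have "(U ^^ Suc k) ((U' ^^ Suc k) y) = (U ^^ k) (U (U' ((U' ^^ k) y)))"
      by (simp add: funpow_swap1)
    then show ?case using Suc by simp
  qed simp
  show "(U ^^ m) ((U' ^^ n) x) = (U ^^ (m - n)) x" if "n \<le> m"
  proof -
    have "U ^^ m = (U ^^ (m - n)) \<circ> (U ^^ n)" unfolding funpow_add[symmetric] using that by simp
    then show ?thesis using c assms by simp
  qed
  show "(U ^^ m) ((U' ^^ n) x) = (U' ^^ (n - m)) x" if "m \<le> n"
  proof -
    have "U' ^^ n = (U' ^^ m) \<circ> (U' ^^ (n - m))" unfolding funpow_add[symmetric] using that by simp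
    then show ?thesis using c assms by simp
  qed
qed

lemma lift_op_in: "a \<in> M \<Longrightarrow> lift_op H K z a \<in> bounded_ops K K"
  unfolding lift_op_def
  by (rule compose_in[OF Kh Hh Kh compose_in[OF Kh Hh Hh adj_in[OF Hh Kh zb] vna_in[OF vna]] zb])

lemma lift_op_adj: "a \<in> M \<Longrightarrow> adj K K (lift_op H K z a) = lift_op H K z (adj H H a)"
  using lift_op_in[OF vna_adj[OF vna]]
  by (intro adj_eqI[OF Kh]) (simp_all add: lift_op_apply adj_ip[OF Hh Kh zb] adj_ip'[OF Hh Kh zb, symmetric]
      adj_ip[OF Hh Hh vna_in[OF vna]] bounded_ops_in[OF vna_in[OF vna vna_adj[OF vna]]])

section \<open>Words in the conjugates of the lifted algebra\<close>

definition gen :: "nat \<Rightarrow> ('h \<Rightarrow> 'h) \<Rightarrow> 'k \<Rightarrow> 'k" where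
  "gen n a = (\<Theta> ^^ n) (lift_op H K z a)"

text \<open>Words grow at the right end because \<open>word_path\<close> consumes the generator next
  to \<open>z\<close>.\<close>

inductive_set words :: "('k \<Rightarrow> 'k) set" where
  one: "op_one K \<in> words"
| step: "\<lbrakk>w \<in> words; a \<in> M\<rbrakk> \<Longrightarrow> op_mult K w (gen n a) \<in> words"

lemma gen_in: "a \<in> M \<Longrightarrow> gen n a \<in> bounded_ops K K"
  unfolding gen_def by (rule compress_funpow(1)[OF Kh Ub lift_op_in])

lemma gen_apply: "\<lbrakk>a \<in> M; x \<in> carrier K\<rbrakk> \<Longrightarrow> gen n a x = (U' ^^ n) (z (a (z' ((U ^^ n) x))))"
  unfolding gen_def by (simp add: compress_funpow(2)[OF Kh Ub lift_op_in] lift_op_apply)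

lemma gen_Suc: "\<Theta> (gen n a) = gen (Suc n) a"
  by (simp add: gen_def)

lemma gen_adj: "a \<in> M \<Longrightarrow> adj K K (gen n a) = gen n (adj H H a)"
proof (induction n)
  case (Suc n)
  then show ?case
    using conjugation_adj[OF Kh U gen_in[OF Suc.prems, of n]] by (simp add: gen_Suc[symmetric])
qed (simp add: gen_def lift_op_adj)

lemma words_in: "w \<in> words \<Longrightarrow> w \<in> bounded_ops K K"
  by (induction rule: words.induct) (simp_all add: op_one_in[OF Kh] op_mult_in[OF Kh] gen_in)

lemma op_mult_one:
  assumes "X \<in> bounded_ops K K"
  shows "op_mult K (op_one K) X = X" "op_mult K X (op_one K) = X"
  using assms op_mult_in[OF Kh] op_one_in[OF Kh]
  by (auto intro!: bounded_ops_eqI[of _ K K] simp: bounded_ops_in[OF assms])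

lemma op_mult_assoc:
  assumes "X \<in> bounded_ops K K" "Y \<in> bounded_ops K K" "Z \<in> bounded_ops K K"
  shows "op_mult K (op_mult K X Y) Z = op_mult K X (op_mult K Y Z)"
  by (rule bounded_ops_eqI[OF op_mult_in[OF Kh op_mult_in[OF Kh assms(1,2)] assms(3)]
        op_mult_in[OF Kh assms(1) op_mult_in[OF Kh assms(2,3)]]])
    (simp add: bounded_ops_in[OF assms(3)])

lemma gen_words: "a \<in> M \<Longrightarrow> gen n a \<in> words"
  using words.step[OF words.one, of a n] by (simp add: op_mult_one gen_in)

lemma words_mult: "\<lbrakk>w \<in> words; v \<in> words\<rbrakk> \<Longrightarrow> op_mult K v w \<in> words"
proof (induction rule: words.induct)
  case one
  then show ?case by (simp add: op_mult_one words_in)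
next
  case (step w a n)
  then have "op_mult K v (op_mult K w (gen n a)) = op_mult K (op_mult K v w) (gen n a)"
    by (simp add: op_mult_assoc words_in gen_in)
  then show ?case using step by (simp add: words.step)
qed

lemma words_adj: "w \<in> words \<Longrightarrow> adj K K w \<in> words"
proof (induction rule: words.induct)
  case one
  then show ?case by (simp add: adj_op_one[OF Kh] words.one)
next
  case (step w a n)
  then show ?case
    by (simp add: adj_op_mult[OF Kh words_in gen_in] gen_adj words_mult gen_words vna_adj[OF vna])
qed

lemma words_conj: "w \<in> words \<Longrightarrow> \<Theta> w \<in> words"
proof (induction rule: words.induct)
  case one
  have "\<Theta> (op_one K) = op_one K"
    by (rule bounded_ops_eqI[OF compress_op_in[OF Kh Kh Ub op_one_in[OF Kh]] op_one_in[OF Kh]]) (simp add: compress_op_apply)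
  then show ?case by (simp add: words.one)
next
  case (step w a n)
  then show ?case
    by (simp add: conjugation_mult[OF Kh U words_in gen_in] gen_Suc words.step)
qed

text \<open>
  \<open>vpath k X\<close> holds if \<open>X = a\<^sub>0 V\<^sup>* a\<^sub>1 V\<^sup>* \<cdots> V\<^sup>* a\<^sub>k\<close> with \<open>a\<^sub>i \<in> M\<close>. The compression of a word is a product of
  such factors along a lattice path that stays nonnegative; each step down meets a step up and
  is absorbed by \<open>V\<^sup>* a V \<in> M\<close>.
\<close>

fun vpath :: "nat \<Rightarrow> ('h \<Rightarrow> 'h) \<Rightarrow> bool" where
  "vpath 0 X \<longleftrightarrow> (\<exists>a\<in>M. \<forall>x\<in>carrier H. X x = a x)"
| "vpath (Suc k) X \<longleftrightarrow> (\<exists>Y. \<exists>a\<in>M. vpath k Y \<and> (\<forall>x\<in>carrier H. X x = Y (V' (a x))))"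

lemma path_cong: "\<lbrakk>vpath k X; \<And>x. x \<in> carrier H \<Longrightarrow> X x = X' x\<rbrakk> \<Longrightarrow> vpath k X'"
  by (cases k) auto

lemma path_mult:
  assumes "vpath k X" "a \<in> M"
  shows "vpath k (\<lambda>x. X (a x))"
proof (cases k)
  case 0
  then obtain b where "b \<in> M" "\<forall>x\<in>carrier H. X x = b x" using assms by auto
  then show ?thesis using 0 assms by (auto intro!: bexI[of _ "op_mult H b a"] vna_mult[OF vna])
next
  case (Suc l)
  then obtain Y b where "vpath l Y" "b \<in> M" "\<forall>x\<in>carrier H. X x = Y (V' (b x))" using assms by auto
  then show ?thesis using Suc assms by (auto intro!: exI[of _ Y] bexI[of _ "op_mult H b a"] vna_mult[OF vna])
qed

lemma path_up: "vpath k X \<Longrightarrow> vpath (Suc k) (\<lambda>x. X (V' x))"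
  using vna_one[OF vna] by (auto intro!: exI[of _ X] bexI[of _ "op_one H"])

lemma path_down:
  assumes "vpath (Suc k) X"
  shows "vpath k (\<lambda>x. X (V x))"
proof -
  obtain Y a where Y: "vpath k Y" and a: "a \<in> M" and X: "\<forall>x\<in>carrier H. X x = Y (V' (a x))" using assms by auto
  show ?thesis
    by (rule path_cong[OF path_mult[OF Y V_inv[OF a]]]) (simp add: X compress_op_apply)
qed

lemma path_up_pow: "vpath k X \<Longrightarrow> vpath (k + n) (\<lambda>x. X ((V' ^^ n) x))"
proof (induction n)
  case (Suc n)
  have "vpath (Suc (k + n)) (\<lambda>x. X ((V' ^^ n) (V' x)))" using path_up Suc by blast
  then show ?case by (simp add: funpow_swap1 del: vpath.simps)
qed simp

lemma path_down_pow: "vpath (k + n) X \<Longrightarrow> vpath k (\<lambda>x. X ((V ^^ n) x))"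
proof (induction n arbitrary: k)
  case (Suc n)
  have "vpath (Suc k) (\<lambda>x. X ((V ^^ n) x))"
    using Suc.IH[of "Suc k"] Suc.prems by (simp del: vpath.simps)
  then have "vpath k (\<lambda>x. X ((V ^^ n) (V x)))" by (rule path_down)
  then show ?case by (simp add: funpow_swap1)
qed simp

text \<open>The exponent \<open>n\<close> makes an induction on the last generator possible. A
  generator of index \<open>m\<close> leaves \<open>(U' ^^ m) z\<close> behind it for the rest of
  the word, and between its \<open>z'\<close> and the old \<open>z\<close> stands
  \<open>(U ^^ m) (U' ^^ n)\<close>. This is a power of \<open>U\<close> or of \<open>U'\<close>,
  that is, a descent or an ascent of the path by the difference of the indices.\<close>

lemma word_path: "w \<in> words \<Longrightarrow> vpath n (\<lambda>x. z' (w ((U' ^^ n) (z x))))"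
proof (induction arbitrary: n rule: words.induct)
  case one
  have "vpath 0 (\<lambda>x. x)" using vna_one[OF vna] by (auto intro!: bexI[of _ "op_one H"])
  from path_up_pow[OF this, of n] have "vpath n (\<lambda>x. (V' ^^ n) x)" by simp
  then show ?case by (rule path_cong) (simp add: z'U'_pow)
next
  case (step w a m)
  have X: "vpath m (\<lambda>x. z' (w ((U' ^^ m) (z (a x)))))"
    by (rule path_mult[OF step.IH step.hyps(2)])
  show ?case
  proof (cases "n \<le> m")
    case True
    have "vpath n (\<lambda>x. z' (w ((U' ^^ m) (z (a ((V ^^ (m - n)) x))))))"
      by (rule path_down_pow[of n "m - n"]) (use X True in simp)
    then show ?thesis
      by (rule path_cong) (use True step.hyps in \<open>simp add: gen_apply U_U'_pow(1) Uz_pow\<close>)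
  next
    case False
    then have "vpath n (\<lambda>x. z' (w ((U' ^^ m) (z (a ((V' ^^ (n - m)) x))))))"
      using path_up_pow[OF X, of "n - m"] by simp
    then show ?thesis
      by (rule path_cong) (use False step.hyps in \<open>simp add: gen_apply U_U'_pow(2) z'U'_pow\<close>)
  qed
qed

lemma compress_word:
  assumes w: "w \<in> words"
  shows "compress_op H K z w \<in> M"
proof -
  obtain a where a: "a \<in> M" "\<forall>x\<in>carrier H. z' (w (z x)) = a x" using word_path[OF w, of 0] by auto
  have "compress_op H K z w = a"
    by (rule bounded_ops_eqI[OF compress_op_in[OF Hh Kh zb words_in[OF w]] vna_in[OF vna a(1)]])
      (simp add: compress_op_apply a(2))
  then show ?thesis using a by simp
qed

definition R :: "('k \<Rightarrow> 'k) set" where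
  "R = commutant K (commutant K words)"

lemma words_sub: "words \<subseteq> bounded_ops K K"
  using words_in by blast

lemma R_vna: "von_neumann_algebra K R"
  unfolding R_def by (rule vna_bicommutant[OF Kh words_sub words_adj])

text \<open>Since \<open>\<Theta>\<close> maps words to words, \<open>U y U\<^sup>*\<close> commutes
  with all words whenever \<open>y\<close> does; hence \<open>X\<close> commutes with it, and
  conjugating back shows that \<open>\<Theta> X\<close> commutes with \<open>y\<close>.\<close>

lemma R_conj:
  assumes X: "X \<in> R"
  shows "\<Theta> X \<in> R"
  unfolding R_def
proof (rule commutantI)
  have Xb: "X \<in> bounded_ops K K" using X unfolding R_def by (rule commutant_in)
  show "\<Theta> X \<in> bounded_ops K K" by (rule compress_op_in[OF Kh Kh Ub Xb])
  fix y x assume y: "y \<in> commutant K words" and x: "x \<in> carrier K"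
  have yb: "y \<in> bounded_ops K K" using y by (rule commutant_in)
  note [simp] = bounded_ops_in[OF yb] bounded_ops_in[OF Xb]
  define c where "c = compose (carrier K) U (compose (carrier K) y U')"
  have cx: "c v = U (y (U' v))" if "v \<in> carrier K" for v using that by (simp add: c_def compose_def)
  have cb: "c \<in> bounded_ops K K"
    unfolding c_def by (rule compose_in[OF Kh Kh Kh compose_in[OF Kh Kh Kh adj_in[OF Kh Kh Ub] yb] Ub])
  have "c \<in> commutant K words"
  proof (rule commutantI[OF cb])
    fix w v assume w: "w \<in> words" and v: "v \<in> carrier K"
    note [simp] = bounded_ops_in[OF words_in[OF w]]
    have "y (U' (w v)) = U' (w (U (y (U' v))))"
      using commutantD[OF y words_conj[OF w], of "U' v"] v by (simp add: compress_op_apply)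
    then show "c (w v) = w (c v)" using v by (simp add: cx)
  qed
  then have "X (c (U x)) = c (X (U x))" using X commutantD[of X K "commutant K words" c "U x"] x by (simp add: R_def)
  then have "X (U (y x)) = U (y (U' (X (U x))))" using x by (simp add: cx)
  then show "\<Theta> X (y x) = y (\<Theta> X x)" using x by (simp add: compress_op_apply)
qed

lemma is_dilation: "dilation H M (compress_op H H V) R \<Theta> K z"
  unfolding dilation_def
proof (intro conjI ballI allI)
  have R_in: "X \<in> bounded_ops K K" if "X \<in> R" for X using vna_in[OF R_vna that] .
  show "quantum_process K R \<Theta>" by (rule conjugation_quantum_process[OF Kh R_vna U_iso R_conj])
  show "star_hom K R K R \<Theta>" by (rule conjugation_star_hom[OF Kh R_vna U R_conj])
  show "isometric_embedding H K z"
    using zb by (simp add: isometric_embedding_def hnorm_def isometric_ip[OF z])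
  have "lift_op H K z a \<in> words" if "a \<in> M" for a using gen_words[OF that, of 0] by (simp add: gen_def)
  then show "lift_op H K z ` M \<subseteq> R" using subset_bicommutant[OF words_sub] unfolding R_def by blast
  show "compress_op H K z ` R \<subseteq> M"
    using compress_bicommutant[OF Kh vna zb words_sub words.one words_mult words_adj compress_word] unfolding R_def by blast
  show "(compress_op H H V ^^ n) a = compress_op H K z ((\<Theta> ^^ n) (lift_op H K z a))" if a: "a \<in> M" for a n
  proof (rule bounded_ops_eqI[OF compress_funpow(1)[OF Hh Vb vna_in[OF vna a]]
        compress_op_in[OF Hh Kh zb compress_funpow(1)[OF Kh Ub lift_op_in[OF a]]]])
    fix x assume x: "x \<in> carrier H"
    then show "(compress_op H H V ^^ n) a x = compress_op H K z ((\<Theta> ^^ n) (lift_op H K z a)) x"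
      using a by (simp add: compress_funpow(2)[OF Hh Vb vna_in[OF vna a]] compress_op_apply
          compress_funpow(2)[OF Kh Ub lift_op_in[OF a]] lift_op_apply Uz_pow z'U'_pow)
  qed
  show "compress_op H K z ((\<Theta> ^^ n) X) = (compress_op H H V ^^ n) (compress_op H K z X)" if X: "X \<in> R" for X n
  proof (rule bounded_ops_eqI[OF compress_op_in[OF Hh Kh zb compress_funpow(1)[OF Kh Ub R_in[OF X]]]
        compress_funpow(1)[OF Hh Vb compress_op_in[OF Hh Kh zb R_in[OF X]]]])
    fix x assume x: "x \<in> carrier H"
    then show "compress_op H K z ((\<Theta> ^^ n) X) x = (compress_op H H V ^^ n) (compress_op H K z X) x"
      by (simp add: compress_funpow(2)[OF Hh Vb compress_op_in[OF Hh Kh zb R_in[OF X]]] compress_op_apply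
          compress_funpow(2)[OF Kh Ub R_in[OF X]] Uz_pow z'U'_pow bounded_ops_in[OF R_in[OF X]])
  qed
qed

end

subsection \<open>The iterated Stinespring representation\<close>

lemma ev_sum: "ev f xs = (\<Sum>i<length xs. fst (xs ! i) * f (snd (xs ! i)))"
  by (simp add: ev_def sum_list_sum_nth split_beta atLeast0LessThan)

lemma kf_sum: "kf k xs ys = (\<Sum>i<length xs. \<Sum>j<length ys.
    cnj (fst (xs ! i)) * fst (ys ! j) * k (snd (xs ! i)) (snd (ys ! j)))"
  by (simp add: kf_def ev_sum sum_distrib_left mult.assoc)

lemma kf_add_kernel: "kf (\<lambda>i j. k i j + k' i j) xs ys = kf k xs ys + kf k' xs ys"
  by (simp add: kf_def ev_add)

lemma kf_scale_kernel: "kf (\<lambda>i j. c * k i j) xs ys = c * kf k xs ys"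
  using ev_scale[of "cnj c"] by (simp add: kf_def ev_scale)

lemma sum_in_nonneg_Reals: "(\<And>i. i \<in> A \<Longrightarrow> f i \<in> \<real>\<^sub>\<ge>\<^sub>0) \<Longrightarrow> sum f A \<in> (\<real>\<^sub>\<ge>\<^sub>0 :: complex set)"
  by (induction A rule: infinite_finite_induct) (auto intro: nonneg_Reals_add_I)

lemma rkhs_span_dense:
  assumes k: "psd_kernel k" and x: "x \<in> carrier (rkhs k)"
  shows "\<exists>X. (\<lambda>n. hnorm (rkhs k) (lc (rkhs k) (\<lambda>i j. k j i) (X n) \<ominus>\<^bsub>rkhs k\<^esub> x)) \<longlonglongrightarrow> 0"
proof -
  interpret hilbert_space "rkhs k" by (rule rkhs_hilbert[OF k])
  note in1 = rkhs_vector_in[OF k]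
  have lc: "lc (rkhs k) (\<lambda>i j. k j i) xs = (\<lambda>i. ev (k i) xs)" for xs
    by (induction xs) (auto simp: rkhs_simps[OF k])
  have lc_in': "lc (rkhs k) (\<lambda>i j. k j i) xs \<in> carrier (rkhs k)" for xs by (rule lc_in[OF in1])
  obtain c where c: "krep k c x" using x by (auto simp: rkhs_carrier_iff[OF k])
  have "(\<lambda>n. hnorm (rkhs k) (lc (rkhs k) (\<lambda>i j. k j i) (c n) \<ominus>\<^bsub>rkhs k\<^esub> x)) \<longlonglongrightarrow> 0"
  proof (rule LIMSEQ_I)
    fix r :: real assume r: "0 < r"
    then have "0 < r / 2" by simp
    then obtain N where N: "\<And>m. m \<ge> N \<Longrightarrow> hnorm (rkhs k) (\<lambda>i. x i - ev (k i) (c m)) \<le> r / 2"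
      using rkhs_dense[OF k c] by blast
    have "hnorm (rkhs k) (lc (rkhs k) (\<lambda>i j. k j i) (c n) \<ominus>\<^bsub>rkhs k\<^esub> x) < r" if n: "n \<ge> N" for n
      using N[OF n] r hnorm_diff_commute[OF lc_in' x, of "c n"] rkhs_diff[OF k x lc_in', of "c n"] by (simp add: lc)
    then show "\<exists>no. \<forall>n\<ge>no. norm (hnorm (rkhs k) (lc (rkhs k) (\<lambda>i j. k j i) (c n) \<ominus>\<^bsub>rkhs k\<^esub> x) - 0) < r"
      using lc_in' x by (intro exI[of _ N]) simp
  qed
  then show ?thesis by blast
qed

lemma qf_tendsto:
  assumes H: "hilbert_space H" and T: "T \<in> bounded_ops H H" and x: "x \<in> carrier H"
    and s: "\<And>n. s n \<in> carrier H" and lim: "(\<lambda>n. hnorm H (s n \<ominus>\<^bsub>H\<^esub> x)) \<longlonglongrightarrow> 0"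
  shows "(\<lambda>n. qf H T (s n)) \<longlonglongrightarrow> qf H T x"
proof -
  interpret hilbert_space H by (rule H)
  note [simp] = bounded_ops_in[OF T] bounded_ops_in[OF adj_in[OF H H T]]
  obtain B where B: "1 \<le> B" "\<And>v. v \<in> carrier H \<Longrightarrow> hnorm H (T v) \<le> B * hnorm H v"
    using bounded_ops_bound[OF H T] by blast
  have 1: "(\<lambda>n. ip H (s n \<ominus>\<^bsub>H\<^esub> x) (T (s n))) \<longlonglongrightarrow> 0"
  proof (rule Lim_null_comparison)
    have "cmod (ip H (s n \<ominus>\<^bsub>H\<^esub> x) (T (s n))) \<le> hnorm H (s n \<ominus>\<^bsub>H\<^esub> x) * (B * hnorm H (s n))" for n
    proof -
      have "cmod (ip H (s n \<ominus>\<^bsub>H\<^esub> x) (T (s n))) \<le> hnorm H (s n \<ominus>\<^bsub>H\<^esub> x) * hnorm H (T (s n))"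
        using s x by (intro cauchy_schwarz) simp_all
      also have "\<dots> \<le> hnorm H (s n \<ominus>\<^bsub>H\<^esub> x) * (B * hnorm H (s n))"
        using s x B(2) by (intro mult_left_mono) simp_all
      finally show ?thesis .
    qed
    then show "\<forall>\<^sub>F n in sequentially. norm (ip H (s n \<ominus>\<^bsub>H\<^esub> x) (T (s n))) \<le> hnorm H (s n \<ominus>\<^bsub>H\<^esub> x) * (B * hnorm H (s n))"
      by simp
    have "(\<lambda>n. hnorm H (s n \<ominus>\<^bsub>H\<^esub> x) * (B * hnorm H (s n))) \<longlonglongrightarrow> 0 * (B * hnorm H x)"
      by (intro tendsto_intros lim hnorm_tendsto x s)
    then show "(\<lambda>n. hnorm H (s n \<ominus>\<^bsub>H\<^esub> x) * (B * hnorm H (s n))) \<longlonglongrightarrow> 0" by simp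
  qed
  have 2: "(\<lambda>n. ip H x (T (s n))) \<longlonglongrightarrow> ip H x (T x)"
    using ip_tendsto[OF _ x s lim, of "adj H H T x"] x s by (simp add: adj_ip[OF H H T])
  have eq: "ip H (s n) (T (s n)) = ip H (s n \<ominus>\<^bsub>H\<^esub> x) (T (s n)) + ip H x (T (s n))" for n
    using s x by simp
  have "(\<lambda>n. ip H (s n) (T (s n))) \<longlonglongrightarrow> 0 + ip H x (T x)"
    unfolding eq by (rule tendsto_add[OF 1 2])
  then show ?thesis unfolding qf_def by (intro tendsto_Re) simp
qed

locale stinespring = H0: hilbert_space H0 for H0 :: "'h hilbert" +
  fixes M :: "('h \<Rightarrow> 'h) set" and \<Phi>
  assumes vna: "von_neumann_algebra H0 M"
    and cp: "completely_positive H0 M H0 M \<Phi>"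
    and unital: "\<Phi> (op_one H0) = op_one H0"
    and normal: "normal_map H0 M H0 M \<Phi>"
begin

lemmas Hh = H0.hilbert_space_axioms
lemmas M_in = vna_in[OF vna]
lemmas M_ops [simp] = vna_one[OF vna] vna_mult[OF vna] vna_add[OF vna] vna_smult[OF vna] vna_adj[OF vna]

lemma M_closed [simp]: "\<lbrakk>a \<in> M; x \<in> carrier H0\<rbrakk> \<Longrightarrow> a x \<in> carrier H0"
  using bounded_ops_in[OF M_in] .

lemma M_linear: "\<lbrakk>a \<in> M; x \<in> carrier H0; y \<in> carrier H0\<rbrakk> \<Longrightarrow> a (x \<oplus>\<^bsub>H0\<^esub> y) = a x \<oplus>\<^bsub>H0\<^esub> a y"
    "\<lbrakk>a \<in> M; x \<in> carrier H0\<rbrakk> \<Longrightarrow> a (c \<odot>\<^bsub>H0\<^esub> x) = c \<odot>\<^bsub>H0\<^esub> a x"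
  using bounded_ops_add[OF M_in] bounded_ops_smult[OF M_in] by blast+

lemma M_zero: "a \<in> M \<Longrightarrow> a \<zero>\<^bsub>H0\<^esub> = \<zero>\<^bsub>H0\<^esub>"
  using lc_bounded_op[OF Hh Hh M_in, of a "\<lambda>_. \<zero>\<^bsub>H0\<^esub>" "[]"] by simp

lemma M_adj_ip: "\<lbrakk>a \<in> M; x \<in> carrier H0; y \<in> carrier H0\<rbrakk> \<Longrightarrow> ip H0 x (adj H0 H0 a y) = ip H0 (a x) y"
  using adj_ip'[OF Hh Hh M_in] .

lemma M_eqI:
  "\<lbrakk>a \<in> M; b \<in> M; \<And>x y. \<lbrakk>x \<in> carrier H0; y \<in> carrier H0\<rbrakk> \<Longrightarrow> ip H0 y (a x) = ip H0 y (b x)\<rbrakk> \<Longrightarrow> a = b"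
  using bounded_ops_eqI_ip[OF Hh M_in M_in] by blast

lemma \<Phi>_in [simp]: "a \<in> M \<Longrightarrow> \<Phi> a \<in> M"
  and \<Phi>_add: "\<lbrakk>a \<in> M; b \<in> M\<rbrakk> \<Longrightarrow> \<Phi> (op_add H0 a b) = op_add H0 (\<Phi> a) (\<Phi> b)"
  and \<Phi>_smult: "a \<in> M \<Longrightarrow> \<Phi> (op_smult H0 c a) = op_smult H0 c (\<Phi> a)"
  using cp by (auto simp: completely_positive_def linear_map_def)

text \<open>The block \<open>a\<^sup>* m b\<close>, to which \<open>\<Phi>\<close> is applied in the
  Stinespring form between \<open>a \<otimes> h\<close> and \<open>b \<otimes> g\<close>.\<close>

definition sand :: "('h \<Rightarrow> 'h) \<Rightarrow> ('h \<Rightarrow> 'h) \<Rightarrow> ('h \<Rightarrow> 'h) \<Rightarrow> 'h \<Rightarrow> 'h" where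
  "sand a m b = op_mult H0 (adj H0 H0 a) (op_mult H0 m b)"

lemma sand_in [simp]: "\<lbrakk>a \<in> M; m \<in> M; b \<in> M\<rbrakk> \<Longrightarrow> sand a m b \<in> M"
  by (simp add: sand_def)

lemma sand_ip: "\<lbrakk>a \<in> M; m \<in> M; b \<in> M; x \<in> carrier H0; y \<in> carrier H0\<rbrakk>
    \<Longrightarrow> ip H0 x (sand a m b y) = ip H0 (a x) (m (b y))"
  by (simp add: sand_def M_adj_ip)

text \<open>
  \<open>\<langle>h, F m [a\<^sub>1, \<dots>, a\<^sub>n] [b\<^sub>1, \<dots>, b\<^sub>n] g\<rangle>\<close> is the matrix coefficient of \<open>m\<close> between \<open>a\<^sub>1 \<otimes> \<cdots> \<otimes> a\<^sub>n \<otimes> h\<close>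
  and \<open>b\<^sub>1 \<otimes> \<cdots> \<otimes> b\<^sub>n \<otimes> g\<close> in the \<open>n\<close>-th iterated Stinespring space. The clauses for lists of
  different lengths are irrelevant.
\<close>

fun F :: "('h \<Rightarrow> 'h) \<Rightarrow> ('h \<Rightarrow> 'h) list \<Rightarrow> ('h \<Rightarrow> 'h) list \<Rightarrow> 'h \<Rightarrow> 'h" where
  "F m (a # as) (b # bs) = F (\<Phi> (sand a m b)) as bs"
| "F m as bs = m"

lemma F_in [simp]: "\<lbrakk>m \<in> M; set as \<subseteq> M; set bs \<subseteq> M\<rbrakk> \<Longrightarrow> F m as bs \<in> M"
  by (induction m as bs rule: F.induct) simp_all

lemma F_add: "\<lbrakk>m \<in> M; m' \<in> M; set as \<subseteq> M; set bs \<subseteq> M; length as = length bs\<rbrakk>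
    \<Longrightarrow> F (op_add H0 m m') as bs = op_add H0 (F m as bs) (F m' as bs)"
proof (induction as arbitrary: bs m m')
  case (Cons a as)
  then obtain b bs' where bs: "bs = b # bs'" by (cases bs) auto
  have "sand a (op_add H0 m m') b = op_add H0 (sand a m b) (sand a m' b)"
    by (rule M_eqI) (use Cons.prems bs in \<open>simp_all add: sand_ip\<close>)
  then show ?case using Cons bs by (simp add: \<Phi>_add)
qed simp

lemma F_smult: "\<lbrakk>m \<in> M; set as \<subseteq> M; set bs \<subseteq> M; length as = length bs\<rbrakk>
    \<Longrightarrow> F (op_smult H0 c m) as bs = op_smult H0 c (F m as bs)"
proof (induction as arbitrary: bs m)
  case (Cons a as)
  then obtain b bs' where bs: "bs = b # bs'" by (cases bs) auto
  have "sand a (op_smult H0 c m) b = op_smult H0 c (sand a m b)"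
    by (rule M_eqI) (use Cons.prems bs in \<open>simp_all add: sand_ip\<close>)
  then show ?case using Cons bs by (simp add: \<Phi>_smult)
qed simp

text \<open>Complete positivity enters here: the matrix with entries
  \<open>a\<^sub>i\<^sup>* m\<^sub>i\<^sub>j a\<^sub>j\<close> is positive along with
  \<open>m\<close>, and \<open>\<Phi>\<close> applied entrywise keeps it positive, which removes one
  tensor factor.\<close>

lemma F_positive:
  assumes "\<And>i j. \<lbrakk>i < n; j < n\<rbrakk> \<Longrightarrow> m i j \<in> M" "positive_matrix H0 n m"
    and "\<And>i. i < n \<Longrightarrow> set (as i) \<subseteq> M" "\<And>i. i < n \<Longrightarrow> length (as i) = l" and h: "\<And>i. i < n \<Longrightarrow> h i \<in> carrier H0"
  shows "(\<Sum>i<n. \<Sum>j<n. ip H0 (h i) (F (m i j) (as i) (as j) (h j))) \<in> \<real>\<^sub>\<ge>\<^sub>0"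
  using assms(1-4)
proof (induction l arbitrary: m as)
  case 0
  have "(\<Sum>i<n. \<Sum>j<n. ip H0 (h i) (F (m i j) (as i) (as j) (h j))) = (\<Sum>i<n. \<Sum>j<n. ip H0 (h i) (m i j (h j)))"
    using 0(4) by (intro sum.cong refl) simp
  then show ?case using 0(2) h by (simp add: positive_matrix_def)
next
  case (Suc l)
  define a where "a i = hd (as i)" for i
  define bs where "bs i = tl (as i)" for i
  have as: "as i = a i # bs i" if "i < n" for i
    using Suc.prems(4)[OF that] by (cases "as i") (auto simp: a_def bs_def)
  have a: "a i \<in> M" "set (bs i) \<subseteq> M" "length (bs i) = l" if "i < n" for i
    using Suc.prems(3,4)[OF that] as[OF that] by auto
  have "positive_matrix H0 n (\<lambda>i j. sand (a i) (m i j) (a j))"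
    unfolding positive_matrix_def
  proof (intro allI impI)
    fix \<xi> assume \<xi>: "\<forall>i<n. \<xi> i \<in> carrier H0"
    have "(\<Sum>i<n. \<Sum>j<n. ip H0 (\<xi> i) (sand (a i) (m i j) (a j) (\<xi> j)))
        = (\<Sum>i<n. \<Sum>j<n. ip H0 (a i (\<xi> i)) (m i j (a j (\<xi> j))))"
      using \<xi> a Suc.prems(1) by (intro sum.cong refl sand_ip) auto
    also have "\<dots> \<in> \<real>\<^sub>\<ge>\<^sub>0"
      using Suc.prems(2)[unfolded positive_matrix_def, THEN spec, of "\<lambda>i. a i (\<xi> i)"] \<xi> a by simp
    finally show "(\<Sum>i<n. \<Sum>j<n. ip H0 (\<xi> i) (sand (a i) (m i j) (a j) (\<xi> j))) \<in> \<real>\<^sub>\<ge>\<^sub>0" .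
  qed
  then have pos: "positive_matrix H0 n (\<lambda>i j. \<Phi> (sand (a i) (m i j) (a j)))"
    using cp a Suc.prems(1) by (simp add: completely_positive_def)
  have "(\<Sum>i<n. \<Sum>j<n. ip H0 (h i) (F (m i j) (as i) (as j) (h j)))
      = (\<Sum>i<n. \<Sum>j<n. ip H0 (h i) (F (\<Phi> (sand (a i) (m i j) (a j))) (bs i) (bs j) (h j)))"
    by (intro sum.cong refl) (simp add: as)
  also have "\<dots> \<in> \<real>\<^sub>\<ge>\<^sub>0"
    by (rule Suc.IH[OF _ pos]) (use a Suc.prems(1) in auto)
  finally show ?case .
qed

section \<open>The positive definite kernel of the iterated Stinespring space\<close>

definition valid :: "('h \<Rightarrow> 'h) list \<times> 'h \<Rightarrow> bool" where
  "valid x \<longleftrightarrow> set (fst x) \<subseteq> M \<and> snd x \<in> carrier H0"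

text \<open>For \<open>p\<close> the identity this is the Gram matrix of the elementary tensors in
  the sum over all levels; general \<open>p\<close> gives the matrix coefficients of the
  representation. The value 0 makes different levels orthogonal and sends invalid indices to the
  zero vector.\<close>

definition kk :: "('h \<Rightarrow> 'h) \<Rightarrow> ('h \<Rightarrow> 'h) list \<times> 'h \<Rightarrow> ('h \<Rightarrow> 'h) list \<times> 'h \<Rightarrow> complex" where
  "kk p x y = (if valid x \<and> valid y \<and> length (fst x) = length (fst y)
     then ip H0 (snd x) (F p (fst x) (fst y) (snd y)) else 0)"

text \<open>The double sum is \<open>\<langle>x, p x\<rangle>\<close> for the single vector
  \<open>x\<close> that is the sum of all \<open>\<xi> i\<close>.\<close>

lemma constant_positive_matrix:
  assumes p: "p \<in> M" and pos: "\<And>x. x \<in> carrier H0 \<Longrightarrow> ip H0 x (p x) \<in> \<real>\<^sub>\<ge>\<^sub>0"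
  shows "positive_matrix H0 n (\<lambda>i j. p)"
  unfolding positive_matrix_def
proof (intro allI impI)
  fix \<xi> assume \<xi>: "\<forall>i<n. \<xi> i \<in> carrier H0"
  define x where "x i = (if i < n then \<xi> i else \<zero>\<^bsub>H0\<^esub>)" for i
  have x: "x i \<in> carrier H0" for i using \<xi> by (simp add: x_def)
  have px: "p (x i) \<in> carrier H0" for i using x p by simp
  define xs where "xs = map (\<lambda>i. (1 :: complex, i)) [0..<n]"
  have "ip H0 (lc H0 x xs) (p (lc H0 x xs)) = kf (\<lambda>i j. ip H0 (x i) (p (x j))) xs xs"
    using ip_lc_lc[of H0 x "\<lambda>i. p (x i)" xs xs, OF Hh x px] lc_bounded_op[OF Hh Hh M_in[OF p], of x xs] x by simp
  also have "\<dots> = (\<Sum>i<n. \<Sum>j<n. ip H0 (\<xi> i) (p (\<xi> j)))"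
    unfolding kf_sum by (simp add: xs_def x_def)
  finally show "(\<Sum>i<n. \<Sum>j<n. ip H0 (\<xi> i) (p (\<xi> j))) \<in> \<real>\<^sub>\<ge>\<^sub>0"
    using pos[of "lc H0 x xs"] x by simp
qed

text \<open>Index families of different lengths are orthogonal, so the kernel is the sum over the lengths \<open>l\<close>.\<close>

lemma kk_psd:
  assumes p: "p \<in> M" and pos: "\<And>x. x \<in> carrier H0 \<Longrightarrow> ip H0 x (p x) \<in> \<real>\<^sub>\<ge>\<^sub>0"
  shows "psd_kernel (kk p)"
  unfolding psd_kernel_def
proof
  fix xs :: "(complex \<times> (('h \<Rightarrow> 'h) list \<times> 'h)) list"
  define n where "n = length xs"
  define c where "c i = fst (xs ! i)" for i
  define x where "x i = snd (xs ! i)" for i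
  define L where "L = (\<lambda>i. length (fst (x i))) ` {..<n}"
  define s where "s l i \<longleftrightarrow> valid (x i) \<and> length (fst (x i)) = l" for l i
  \<comment> \<open>Indices that are invalid or of another length are replaced by the zero vector
    and a list of \<open>l\<close> identities: \<open>F_positive\<close> then applies to all
    \<open>n\<close> indices at once, and the padded terms contribute nothing.\<close>
  define h where "h l i = (if s l i then c i \<odot>\<^bsub>H0\<^esub> snd (x i) else \<zero>\<^bsub>H0\<^esub>)" for l i
  define as where "as l i = (if s l i then fst (x i) else replicate l (op_one H0))" for l i
  have h: "h l i \<in> carrier H0" for l i by (simp add: h_def s_def valid_def)
  have as: "set (as l i) \<subseteq> M" "length (as l i) = l" for l i
    by (auto simp: as_def s_def valid_def)
  have Fas: "F p (as l i) (as l j) \<in> M" for l i j using as p by simp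
  have summand: "cnj (c i) * c j * kk p (x i) (x j) = (\<Sum>l\<in>L. ip H0 (h l i) (F p (as l i) (as l j) (h l j)))"
    if i: "i < n" and j: "j < n" for i j
  proof (cases "valid (x i) \<and> valid (x j) \<and> length (fst (x i)) = length (fst (x j))")
    case True
    define l0 where "l0 = length (fst (x i))"
    have l0: "l0 \<in> L" using i by (simp add: L_def l0_def)
    have "ip H0 (h l i) (F p (as l i) (as l j) (h l j)) = (if l = l0 then cnj (c i) * c j * kk p (x i) (x j) else 0)" for l
    proof (cases "l = l0")
      case l: True
      have "s l i" "s l j" using True by (auto simp: s_def l l0_def)
      moreover have "snd (x i) \<in> carrier H0" "snd (x j) \<in> carrier H0" "F p (fst (x i)) (fst (x j)) \<in> M"
        using True p by (auto simp: valid_def)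
      ultimately show ?thesis using True l by (simp add: h_def as_def kk_def M_linear)
    next
      case False
      then have "\<not> s l i" by (auto simp: s_def l0_def)
      then show ?thesis using False Fas[of l i j] h by (simp add: h_def)
    qed
    moreover have "finite L" by (simp add: L_def)
    ultimately show ?thesis using l0 by simp
  next
    case False
    have "ip H0 (h l i) (F p (as l i) (as l j) (h l j)) = 0" for l
    proof (cases "s l i")
      case True
      then have "\<not> s l j" using False by (auto simp: s_def)
      then show ?thesis using Fas[of l i j] h by (simp add: h_def[of l j] M_zero)
    next
      case False
      then show ?thesis using Fas[of l i j] h by (simp add: h_def[of l i])
    qed
    moreover have "kk p (x i) (x j) = 0" using False unfolding kk_def by (rule if_not_P)
    ultimately show ?thesis by simp
  qed
  have "kf (kk p) xs xs = (\<Sum>i<n. \<Sum>j<n. cnj (c i) * c j * kk p (x i) (x j))"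
    unfolding kf_sum n_def c_def x_def ..
  also have "\<dots> = (\<Sum>i<n. \<Sum>j<n. \<Sum>l\<in>L. ip H0 (h l i) (F p (as l i) (as l j) (h l j)))"
    by (intro sum.cong refl summand) auto
  also have "\<dots> = (\<Sum>i<n. \<Sum>l\<in>L. \<Sum>j<n. ip H0 (h l i) (F p (as l i) (as l j) (h l j)))"
    by (intro sum.cong refl sum.swap)
  also have "\<dots> = (\<Sum>l\<in>L. \<Sum>i<n. \<Sum>j<n. ip H0 (h l i) (F p (as l i) (as l j) (h l j)))"
    by (rule sum.swap)
  also have "\<dots> \<in> \<real>\<^sub>\<ge>\<^sub>0"
  proof (rule sum_in_nonneg_Reals)
    fix l
    show "(\<Sum>i<n. \<Sum>j<n. ip H0 (h l i) (F p (as l i) (as l j) (h l j))) \<in> \<real>\<^sub>\<ge>\<^sub>0"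
      using as p h by (intro F_positive[where l = l] constant_positive_matrix pos) simp_all
  qed
  finally show "kf (kk p) xs xs \<in> \<real>\<^sub>\<ge>\<^sub>0" .
qed

lemma kk_add: "\<lbrakk>p \<in> M; q \<in> M\<rbrakk> \<Longrightarrow> kk (op_add H0 p q) x y = kk p x y + kk q x y"
  by (simp add: kk_def F_add valid_def)

lemma kk_smult: "p \<in> M \<Longrightarrow> kk (op_smult H0 c p) x y = c * kk p x y"
  by (simp add: kk_def F_smult valid_def)

text \<open>Left multiplication on the outermost tensor factor; on level 0 there is no factor, so
  \<open>m\<close> acts on the vector itself.\<close>

definition act :: "('h \<Rightarrow> 'h) \<Rightarrow> ('h \<Rightarrow> 'h) list \<times> 'h \<Rightarrow> ('h \<Rightarrow> 'h) list \<times> 'h" where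
  "act m x = (if valid x then (case fst x of [] \<Rightarrow> ([], m (snd x)) | a # as \<Rightarrow> (op_mult H0 m a # as, snd x)) else x)"

definition shift :: "('h \<Rightarrow> 'h) list \<times> 'h \<Rightarrow> ('h \<Rightarrow> 'h) list \<times> 'h" where
  "shift x = (op_one H0 # fst x, snd x)"

lemma valid_act [simp]: "m \<in> M \<Longrightarrow> valid (act m x) \<longleftrightarrow> valid x"
  by (cases x; cases "fst x") (auto simp: act_def valid_def)

lemma length_act [simp]: "length (fst (act m x)) = length (fst x)"
  by (cases x; cases "fst x") (auto simp: act_def)

lemma valid_shift [simp]: "valid (shift x) \<longleftrightarrow> valid x"
  by (simp add: shift_def valid_def)

text \<open>The outermost factors enter \<open>F\<close> only through \<open>a\<^sup>* p b\<close>,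
  where multiplying \<open>b\<close> by \<open>m\<close> amounts to multiplying \<open>p\<close> by
  \<open>m\<close>.\<close>

lemma kk_act_right:
  assumes p: "p \<in> M" and m: "m \<in> M"
  shows "kk p x (act m y) = kk (op_mult H0 p m) x y"
proof (cases "valid x \<and> valid y \<and> length (fst x) = length (fst y)")
  case True
  then have v: "snd x \<in> carrier H0" "snd y \<in> carrier H0" "set (fst x) \<subseteq> M" "set (fst y) \<subseteq> M"
    by (auto simp: valid_def)
  show ?thesis
  proof (cases "fst y")
    case Nil
    then show ?thesis using True v p m by (simp add: kk_def) (simp add: act_def)
  next
    case (Cons b bs)
    then obtain a as where x: "fst x = a # as" using True by (cases "fst x") auto
    have "sand a p (op_mult H0 m b) = sand a (op_mult H0 p m) b"
      by (rule M_eqI) (use v x Cons p m in \<open>simp_all add: sand_ip\<close>)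
    then show ?thesis using True v p m x Cons by (simp add: kk_def) (simp add: act_def)
  qed
qed (use m in \<open>auto simp: kk_def\<close>)

lemma kk_act_left:
  assumes p: "p \<in> M" and m: "m \<in> M"
  shows "kk p (act m x) y = kk (op_mult H0 (adj H0 H0 m) p) x y"
proof (cases "valid x \<and> valid y \<and> length (fst x) = length (fst y)")
  case True
  then have v: "snd x \<in> carrier H0" "snd y \<in> carrier H0" "set (fst x) \<subseteq> M" "set (fst y) \<subseteq> M"
    by (auto simp: valid_def)
  show ?thesis
  proof (cases "fst x")
    case Nil
    then show ?thesis using True v p m by (simp add: kk_def) (simp add: act_def M_adj_ip)
  next
    case (Cons a as)
    then obtain b bs where y: "fst y = b # bs" using True by (cases "fst y") auto
    have "sand (op_mult H0 m a) p b = sand a (op_mult H0 (adj H0 H0 m) p) b"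
      by (rule M_eqI) (use v y Cons p m in \<open>simp_all add: sand_ip M_adj_ip\<close>)
    then show ?thesis using True v p m y Cons by (simp add: kk_def) (simp add: act_def)
  qed
qed (use m in \<open>auto simp: kk_def\<close>)

lemma kk_shift: "m \<in> M \<Longrightarrow> kk m (shift x) (shift y) = kk (\<Phi> m) x y"
proof -
  assume m: "m \<in> M"
  have "sand (op_one H0) m (op_one H0) = m"
    by (rule M_eqI) (use m in \<open>simp_all add: sand_ip\<close>)
  then show ?thesis by (simp add: kk_def) (auto simp: shift_def)
qed

lemma adj_one_mult: "m \<in> M \<Longrightarrow> op_mult H0 m (op_one H0) = m" "m \<in> M \<Longrightarrow> op_mult H0 (op_one H0) m = m"
  by (rule M_eqI; simp)+

section \<open>The representation of \<open>M\<close> on the kernel space\<close>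

definition Hs :: "(('h \<Rightarrow> 'h) list \<times> 'h \<Rightarrow> complex) hilbert" where
  "Hs = rkhs (kk (op_one H0))"

definition e :: "('h \<Rightarrow> 'h) list \<times> 'h \<Rightarrow> ('h \<Rightarrow> 'h) list \<times> 'h \<Rightarrow> complex" where
  "e i = (\<lambda>j. kk (op_one H0) j i)"

lemma kk_one_psd: "psd_kernel (kk (op_one H0))"
  by (rule kk_psd) (simp_all add: H0.ip_self)

lemma Hs: "hilbert_space Hs"
  unfolding Hs_def by (rule rkhs_hilbert[OF kk_one_psd])

lemma e_total: "total_family Hs e"
  unfolding Hs_def e_def by (rule rkhs_total[OF kk_one_psd])

lemmas e_in [simp] = total_in[OF e_total]

lemma e_ip: "ip Hs (e i) (e j) = kk (op_one H0) i j"
  unfolding Hs_def e_def using rkhs_reproducing[OF kk_one_psd rkhs_vector_in[OF kk_one_psd]] .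

lemma e_dense: "x \<in> carrier Hs \<Longrightarrow> \<exists>X. (\<lambda>n. hnorm Hs (lc Hs e (X n) \<ominus>\<^bsub>Hs\<^esub> x)) \<longlonglongrightarrow> 0"
  unfolding Hs_def e_def by (rule rkhs_span_dense[OF kk_one_psd])

lemma representation_exists:
  assumes m: "m \<in> M"
  shows "\<exists>T. T \<in> bounded_ops Hs Hs \<and> (\<forall>i. T (e i) = e (act m i))"
proof -
  interpret K: hilbert_space Hs by (rule Hs)
  obtain B where B: "1 \<le> B" "\<And>x. x \<in> carrier H0 \<Longrightarrow> hnorm H0 (m x) \<le> B * hnorm H0 x"
    using bounded_ops_bound[OF Hh M_in[OF m]] by blast
  define q where "q = op_mult H0 (adj H0 H0 m) m"
  have q: "q \<in> M" using m by (simp add: q_def)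
  \<comment> \<open>\<open>p = B\<^sup>2 - m\<^sup>* m\<close> is positive on \<open>H0\<close>, and
    positivity of the kernel \<open>kk p\<close> is precisely the bound by \<open>B\<close> for the
    action of \<open>m\<close> on combinations.\<close>
  define p where "p = op_add H0 (op_smult H0 (of_real (B\<^sup>2)) (op_one H0)) (op_smult H0 (- 1) q)"
  have p: "p \<in> M" using q by (simp add: p_def)
  have ppos: "ip H0 x (p x) \<in> \<real>\<^sub>\<ge>\<^sub>0" if x: "x \<in> carrier H0" for x
  proof -
    have "ip H0 x (p x) = of_real ((B * hnorm H0 x)\<^sup>2 - (hnorm H0 (m x))\<^sup>2)"
      using x m by (simp add: p_def q_def M_adj_ip H0.ip_self power_mult_distrib)
    moreover have "(hnorm H0 (m x))\<^sup>2 \<le> (B * hnorm H0 x)\<^sup>2"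
      using B(2)[OF x] x m by (intro power_mono) simp_all
    ultimately show ?thesis by (simp only: nonneg_Reals_of_real_iff diff_ge_0_iff_ge)
  qed
  have gram: "ip Hs (e (act m i)) (e (act m j)) = kk q i j" for i j
    using m by (simp add: e_ip kk_act_right kk_act_left adj_one_mult q_def)
  have kp: "kk p = (\<lambda>i j. of_real (B\<^sup>2) * kk (op_one H0) i j + (- 1) * kk q i j)"
    using q by (intro ext) (simp add: p_def kk_add kk_smult)
  have dom: "hnorm Hs (lc Hs (\<lambda>i. e (act m i)) xs) \<le> B * hnorm Hs (lc Hs e xs)" for xs
  proof -
    have n1: "(hnorm Hs (lc Hs (\<lambda>i. e (act m i)) xs))\<^sup>2 = Re (kf (kk q) xs xs)"
      by (simp add: K.hnorm_sq ip_lc_lc[OF Hs] gram)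
    have n2: "(hnorm Hs (lc Hs e xs))\<^sup>2 = Re (kf (kk (op_one H0)) xs xs)"
      by (simp add: K.hnorm_sq ip_lc_lc[OF Hs] e_ip)
    have "0 \<le> Re (kf (kk p) xs xs)"
      using kk_psd[OF p ppos] by (simp add: psd_kernel_def complex_nonneg_Reals_iff)
    also have "kf (kk p) xs xs = of_real (B\<^sup>2) * kf (kk (op_one H0)) xs xs + (- 1) * kf (kk q) xs xs"
      unfolding kp kf_add_kernel kf_scale_kernel ..
    finally have "(hnorm Hs (lc Hs (\<lambda>i. e (act m i)) xs))\<^sup>2 \<le> (B * hnorm Hs (lc Hs e xs))\<^sup>2"
      unfolding power_mult_distrib n1 n2 by simp
    then show ?thesis by (rule power2_le_imp_le) (use B in simp)
  qed
  have B0: "0 \<le> B" using B by simp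
  show ?thesis
    by (rule gram_extension[of Hs Hs e "\<lambda>i. e (act m i)", OF Hs Hs e_in e_in B0 dom]) blast
qed

definition rep :: "('h \<Rightarrow> 'h) \<Rightarrow> (('h \<Rightarrow> 'h) list \<times> 'h \<Rightarrow> complex) \<Rightarrow> (('h \<Rightarrow> 'h) list \<times> 'h \<Rightarrow> complex)" where
  "rep m = (SOME T. T \<in> bounded_ops Hs Hs \<and> (\<forall>i. T (e i) = e (act m i)))"

lemma rep_in: "m \<in> M \<Longrightarrow> rep m \<in> bounded_ops Hs Hs"
  and rep_e: "m \<in> M \<Longrightarrow> rep m (e i) = e (act m i)"
  using someI_ex[OF representation_exists] unfolding rep_def by blast+

lemma rep_kk: "m \<in> M \<Longrightarrow> ip Hs (e i) (rep m (e j)) = kk m i j"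
  by (simp add: rep_e e_ip kk_act_right adj_one_mult)

lemma op_eqI_e:
  assumes "T \<in> bounded_ops Hs Hs" "S \<in> bounded_ops Hs Hs" "\<And>i j. ip Hs (e i) (T (e j)) = ip Hs (e i) (S (e j))"
  shows "T = S"
  by (rule total_op_eqI[OF Hs Hs e_total assms(1,2)], rule total_vec_eqI[OF Hs e_total])
    (simp_all add: assms(3) bounded_ops_in[OF assms(1)] bounded_ops_in[OF assms(2)])

lemma rep_star_hom: "star_hom H0 M Hs (bounded_ops Hs Hs) rep"
proof -
  interpret K: hilbert_space Hs by (rule Hs)
  have pc [simp]: "rep m x \<in> carrier Hs" if "m \<in> M" "x \<in> carrier Hs" for m x using bounded_ops_in[OF rep_in] that .
  show ?thesis
    unfolding star_hom_def linear_map_def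
  proof (intro conjI ballI allI)
    show "rep \<in> M \<rightarrow> bounded_ops Hs Hs" using rep_in by blast
    fix a assume a: "a \<in> M"
    show "rep (op_smult H0 c a) = op_smult Hs c (rep a)" for c
      by (rule op_eqI_e) (simp_all add: a rep_in op_smult_in[OF Hs] rep_kk kk_smult)
    show "rep (adj H0 H0 a) = adj Hs Hs (rep a)"
    proof (rule op_eqI_e)
      fix i j
      have "ip Hs (e i) (adj Hs Hs (rep a) (e j)) = ip Hs (e (act a i)) (e j)"
        using a by (simp add: adj_ip'[OF Hs Hs rep_in] rep_e)
      then show "ip Hs (e i) (rep (adj H0 H0 a) (e j)) = ip Hs (e i) (adj Hs Hs (rep a) (e j))"
        using a by (simp add: rep_kk e_ip kk_act_left adj_one_mult)
    qed (simp_all add: a rep_in adj_in[OF Hs Hs])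
    fix b assume b: "b \<in> M"
    show "rep (op_add H0 a b) = op_add Hs (rep a) (rep b)"
      by (rule op_eqI_e) (simp_all add: a b rep_in op_add_in[OF Hs] rep_kk kk_add)
    show "rep (op_mult H0 a b) = op_mult Hs (rep a) (rep b)"
    proof (rule op_eqI_e)
      fix i j
      have "ip Hs (e i) (rep a (rep b (e j))) = kk (op_mult H0 a b) i j"
        using a b by (simp add: rep_e[OF b] rep_kk kk_act_right)
      then show "ip Hs (e i) (rep (op_mult H0 a b) (e j)) = ip Hs (e i) (op_mult Hs (rep a) (rep b) (e j))"
        using a b by (simp add: rep_kk)
    qed (simp_all add: a b rep_in op_mult_in[OF Hs])
  qed
qed

lemma rep_one: "rep (op_one H0) = op_one Hs"
  by (rule op_eqI_e) (simp_all add: rep_in op_one_in[OF Hs] rep_kk e_ip)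

text \<open>Level 0 carries the defining representation, whose matrix coefficients separate the
  elements of \<open>M\<close>.\<close>

lemma rep_inj: "inj_on rep M"
proof (rule inj_onI, rule M_eqI)
  fix a b x y assume ab: "a \<in> M" "b \<in> M" "rep a = rep b" and "x \<in> carrier H0" "y \<in> carrier H0"
  then show "ip H0 y (a x) = ip H0 y (b x)"
    using rep_kk[OF ab(1), of "([], y)" "([], x)"] rep_kk[OF ab(2), of "([], y)" "([], x)"] by (simp add: kk_def valid_def)
qed

lemma rep_lc:
  assumes m: "m \<in> M"
  shows "ip Hs (lc Hs e xs) (rep m (lc Hs e ys)) = kf (kk m) xs ys"
proof -
  have pe: "rep m (e i) \<in> carrier Hs" for i using bounded_ops_in[OF rep_in[OF m]] by simp
  show ?thesis
    using ip_lc_lc[of Hs e "\<lambda>i. rep m (e i)" xs ys, OF Hs e_in pe] lc_bounded_op[OF Hs Hs rep_in[OF m], of e ys]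
    by (simp add: rep_kk[OF m])
qed

lemma rep_positive:
  assumes p: "p \<in> M" and pos: "\<And>x. x \<in> carrier H0 \<Longrightarrow> ip H0 x (p x) \<in> \<real>\<^sub>\<ge>\<^sub>0" and x: "x \<in> carrier Hs"
  shows "0 \<le> qf Hs (rep p) x"
proof -
  interpret K: hilbert_space Hs by (rule Hs)
  obtain X where X: "(\<lambda>n. hnorm Hs (lc Hs e (X n) \<ominus>\<^bsub>Hs\<^esub> x)) \<longlonglongrightarrow> 0" using e_dense[OF x] by blast
  have "0 \<le> qf Hs (rep p) (lc Hs e xs)" for xs
    using kk_psd[OF p pos] by (simp add: rep_lc[OF p] qf_def psd_kernel_def complex_nonneg_Reals_iff)
  moreover have "(\<lambda>n. qf Hs (rep p) (lc Hs e (X n))) \<longlonglongrightarrow> qf Hs (rep p) x"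
    by (rule qf_tendsto[OF Hs rep_in[OF p] x _ X]) simp
  ultimately show ?thesis by (intro LIMSEQ_le_const) auto
qed

end

section \<open>Normality of the representation, the embedding of level 0 and the shift\<close>

context stinespring
begin

lemma compress_sand: "\<lbrakk>c \<in> M; x \<in> M\<rbrakk> \<Longrightarrow> compress_op H0 H0 c x = sand c x c"
  by (rule bounded_ops_eqI[OF compress_op_in[OF Hh Hh M_in M_in] M_in]) (simp_all add: compress_op_apply sand_def)

text \<open>\<open>4 a\<^sup>* x b\<close> is the sum of \<open>w\<^sup>* (a + w b)\<^sup>* x (a + w b)\<close> over the fourth roots of unity \<open>w\<close>, and \<open>c\<^sup>* \<cdot> c\<close> is normal.\<close>

lemma F_tendsto:
  assumes "length as = length bs" "set as \<subseteq> M" "set bs \<subseteq> M" and h: "h \<in> carrier H0" and g: "g \<in> carrier H0"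
    and "directed_in H0 M D" "s \<in> M" "weak_lim H0 D s"
  shows "((\<lambda>a. ip H0 h (F a as bs g)) \<longlongrightarrow> ip H0 h (F s as bs g)) (op_net H0 D)"
  using assms(1-3,6-8)
proof (induction as bs arbitrary: D s rule: list_induct2)
  case Nil
  then show ?case using h g by (simp add: weak_lim_def)
next
  case (Cons a as b bs)
  note D = Cons.prems(3) and s = Cons.prems(4,5)
  have ab: "a \<in> M" "b \<in> M" "set as \<subseteq> M" "set bs \<subseteq> M" using Cons.prems by auto
  define G where "G y = ip H0 h (F (\<Phi> y) as bs g)" for y
  have G_add: "G (op_add H0 y y') = G y + G y'" if "y \<in> M" "y' \<in> M" for y y'
    using that ab h g Cons.hyps by (simp add: G_def \<Phi>_add F_add)
  have G_smult: "G (op_smult H0 c y) = c * G y" if "y \<in> M" for c y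
    using that ab h g Cons.hyps by (simp add: G_def \<Phi>_smult F_smult)
  \<comment> \<open>For equal outer factors \<open>x \<mapsto> c\<^sup>* x c\<close> is positive and
    normal, so it sends \<open>D\<close> to a directed set; with distinct factors self-adjointness
    could be lost, hence the detour through polarization.\<close>
  have lim: "((\<lambda>x. G (sand c x c)) \<longlongrightarrow> G (sand c s c)) (op_net H0 D)" if c: "c \<in> M" for c
  proof -
    have inv: "compress_op H0 H0 c x \<in> M" if "x \<in> M" for x using that c by (simp add: compress_sand)
    have cn: "normal_map H0 M H0 M (compress_op H0 H0 c)"
      by (rule conjugation_normal_map[OF Hh vna M_in[OF c] inv])
    note 1 = normal_mapD[OF vna vna cn inv D s h g]
    note 2 = normal_mapD[OF vna vna normal \<Phi>_in 1(2) inv[OF s(1)] 1(3) h g]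
    \<comment> \<open>The induction hypothesis gives a limit along the image of \<open>D\<close>
      under both maps; the two \<open>filterlim\<close> facts pull it back to
      \<open>D\<close>.\<close>
    have "((\<lambda>x. ip H0 h (F x as bs g)) \<longlongrightarrow> ip H0 h (F (\<Phi> (compress_op H0 H0 c s)) as bs g))
        (op_net H0 (\<Phi> ` compress_op H0 H0 c ` D))"
      by (rule Cons.IH[OF ab(3,4) 2(2) \<Phi>_in[OF inv[OF s(1)]] 2(3)])
    from filterlim_compose[OF filterlim_compose[OF this 2(4)] 1(4)]
    have "((\<lambda>x. G (compress_op H0 H0 c x)) \<longlongrightarrow> G (compress_op H0 H0 c s)) (op_net H0 D)"
      unfolding G_def .
    moreover have "\<forall>\<^sub>F x in op_net H0 D. G (compress_op H0 H0 c x) = G (sand c x c)"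
      using eventually_op_net_in[OF D] by (rule eventually_mono) (simp add: compress_sand c directed_inD(1)[OF D])
    ultimately show ?thesis
      using compress_sand[OF c s(1)] Lim_transform_eventually by fastforce
  qed
  define cw where "cw w = op_add H0 a (op_smult H0 w b)" for w
  have cw: "cw w \<in> M" for w using ab by (simp add: cw_def)
  define P where "P x = (1/4) * ((G (sand (cw 1) x (cw 1)) + (- 1) * G (sand (cw (- 1)) x (cw (- 1))))
    + ((- \<i>) * G (sand (cw \<i>) x (cw \<i>)) + \<i> * G (sand (cw (- \<i>)) x (cw (- \<i>)))))" for x
  have P: "P x = G (sand a x b)" if x: "x \<in> M" for x
  proof -
    have "sand a x b = op_smult H0 (1/4) (op_add H0
        (op_add H0 (sand (cw 1) x (cw 1)) (op_smult H0 (- 1) (sand (cw (- 1)) x (cw (- 1)))))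
        (op_add H0 (op_smult H0 (- \<i>) (sand (cw \<i>) x (cw \<i>))) (op_smult H0 \<i> (sand (cw (- \<i>)) x (cw (- \<i>))))))"
    proof (rule M_eqI)
      fix u v assume uv: "u \<in> carrier H0" "v \<in> carrier H0"
      have sc: "ip H0 v (sand (cw w) x (cw w) u) = ip H0 (a v) (x (a u)) + w * ip H0 (a v) (x (b u))
          + cnj w * ip H0 (b v) (x (a u)) + cnj w * w * ip H0 (b v) (x (b u))" for w
        using uv x ab by (simp add: sand_ip cw) (simp add: cw_def M_linear algebra_simps)
      have si: "sand (cw w) x (cw w) u \<in> carrier H0" for w using x uv cw by simp
      show "ip H0 v (sand a x b u) = ip H0 v (op_smult H0 (1/4) (op_add H0
        (op_add H0 (sand (cw 1) x (cw 1)) (op_smult H0 (- 1) (sand (cw (- 1)) x (cw (- 1)))))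
        (op_add H0 (op_smult H0 (- \<i>) (sand (cw \<i>) x (cw \<i>))) (op_smult H0 \<i> (sand (cw (- \<i>)) x (cw (- \<i>)))))) u)"
        using uv si by (simp add: sc) (simp add: sand_ip ab x uv algebra_simps)
    qed (use x cw ab in simp_all)
    then show ?thesis using x cw by (simp add: P_def G_add G_smult)
  qed
  have "(P \<longlongrightarrow> P s) (op_net H0 D)" unfolding P_def by (intro tendsto_intros lim cw)
  moreover have "\<forall>\<^sub>F x in op_net H0 D. P x = G (sand a x b)"
    using eventually_op_net_in[OF D] by (rule eventually_mono) (simp add: P directed_inD(1)[OF D])
  ultimately have "((\<lambda>x. G (sand a x b)) \<longlongrightarrow> P s) (op_net H0 D)" by (rule Lim_transform_eventually)
  then show ?case by (simp add: P[OF s(1)]) (simp add: G_def)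
qed

lemma kf_kk_tendsto:
  assumes "directed_in H0 M D" "s \<in> M" "weak_lim H0 D s"
  shows "((\<lambda>a. kf (kk a) xs ys) \<longlongrightarrow> kf (kk s) xs ys) (op_net H0 D)"
proof -
  have "((\<lambda>a. kk a i j) \<longlongrightarrow> kk s i j) (op_net H0 D)" for i j
  proof (cases "valid i \<and> valid j \<and> length (fst i) = length (fst j)")
    case True
    then show ?thesis
      using F_tendsto[OF _ _ _ _ _ assms, of "fst i" "fst j" "snd i" "snd j"] by (simp add: kk_def) (simp add: valid_def)
  next
    case False
    then have "kk m i j = 0" for m unfolding kk_def by (rule if_not_P)
    then show ?thesis by simp
  qed
  then show ?thesis unfolding kf_def by (intro tendsto_cnj ev_tendsto)
qed

lemma rep_diff:
  assumes ab: "a \<in> M" "b \<in> M" and x: "x \<in> carrier Hs"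
  shows "qf Hs (rep (op_diff H0 b a)) x = qf Hs (rep b) x - qf Hs (rep a) x"
proof -
  have "rep (op_diff H0 b a) = op_diff Hs (rep b) (rep a)"
    using rep_star_hom ab by (simp add: star_hom_def linear_map_def)
  then show ?thesis using qf_op_diff[OF Hs rep_in[OF ab(2)] rep_in[OF ab(1)] x] by simp
qed

lemma rep_mono:
  assumes ab: "a \<in> M" "b \<in> M" and le: "op_le H0 a b" and x: "x \<in> carrier Hs"
  shows "qf Hs (rep a) x \<le> qf Hs (rep b) x"
proof -
  have "0 \<le> qf Hs (rep (op_diff H0 b a)) x"
    using ab le x by (intro rep_positive) (simp_all add: op_le_def)
  then show ?thesis using rep_diff[OF ab x] by simp
qed

lemma rep_self_adjoint:
  assumes "a \<in> M" "self_adjoint H0 a"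
  shows "self_adjoint Hs (rep a)"
proof -
  have "adj Hs Hs (rep a) = rep (adj H0 H0 a)" using rep_star_hom assms(1) by (simp add: star_hom_def)
  then show ?thesis using assms by (simp add: self_adjoint_def rep_in)
qed

text \<open>
  For \<open>a \<ge> a0\<close> the positive form \<open>q\<close> of \<open>\<pi> (s - a)\<close> is bounded by that of \<open>\<pi> (s - a0)\<close>, and
  \<open>q x \<le> 2 q y + 2 q (x - y)\<close> reduces the convergence at \<open>x\<close> to that at nearby \<open>y\<close> in the span.
\<close>

lemma rep_qf_tendsto:
  assumes D: "directed_in H0 M D" and s: "s \<in> M" "weak_lim H0 D s" and x: "x \<in> carrier Hs"
  shows "((\<lambda>a. qf Hs (rep a) x) \<longlongrightarrow> qf Hs (rep s) x) (op_net H0 D)"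
proof (rule tendstoI)
  interpret K: hilbert_space Hs by (rule Hs)
  fix r :: real assume r: "0 < r"
  have DM: "a \<in> M" if "a \<in> D" for a using directed_inD(1)[OF D that] .
  have le: "op_le H0 a s" if "a \<in> D" for a
    using op_lub_of_weak_lim[OF vna D M_in[OF s(1)] s(2)] that by (simp add: op_lub_def)
  obtain a0 where a0: "a0 \<in> D" using D by (auto simp: directed_in_def)
  define d where "d = rep (op_diff H0 s a0)"
  have d: "d \<in> bounded_ops Hs Hs" using DM[OF a0] s(1) by (simp add: d_def rep_in)
  obtain C where C: "1 \<le> C" "\<And>v. v \<in> carrier Hs \<Longrightarrow> hnorm Hs (d v) \<le> C * hnorm Hs v"
    using bounded_ops_bound[OF Hs d] by blast
  have dq: "qf Hs d v \<le> C * (hnorm Hs v)\<^sup>2" if v: "v \<in> carrier Hs" for v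
    by (rule qf_le[OF Hs d v C(2)[OF v]])
  obtain X where X: "(\<lambda>n. hnorm Hs (lc Hs e (X n) \<ominus>\<^bsub>Hs\<^esub> x)) \<longlonglongrightarrow> 0" using e_dense[OF x] by blast
  have "(\<lambda>n. 2 * (C * (hnorm Hs (lc Hs e (X n) \<ominus>\<^bsub>Hs\<^esub> x))\<^sup>2)) \<longlonglongrightarrow> 2 * (C * 0\<^sup>2)"
    by (intro tendsto_intros X)
  then have "(\<lambda>n. 2 * (C * (hnorm Hs (lc Hs e (X n) \<ominus>\<^bsub>Hs\<^esub> x))\<^sup>2)) \<longlonglongrightarrow> 0" by simp
  moreover have "0 < r / 2" using r by simp
  ultimately have "\<forall>\<^sub>F n in sequentially. 2 * (C * (hnorm Hs (lc Hs e (X n) \<ominus>\<^bsub>Hs\<^esub> x))\<^sup>2) < r / 2"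
    by (rule order_tendstoD(2))
  then obtain n where n: "2 * (C * (hnorm Hs (lc Hs e (X n) \<ominus>\<^bsub>Hs\<^esub> x))\<^sup>2) < r / 2"
    unfolding eventually_sequentially by blast
  define y where "y = lc Hs e (X n)"
  have y: "y \<in> carrier Hs" by (simp add: y_def)
  have yq: "qf Hs (rep a) y = Re (kf (kk a) (X n) (X n))" if "a \<in> M" for a
    by (simp add: qf_def y_def rep_lc[OF that])
  have "((\<lambda>a. Re (kf (kk s) (X n) (X n)) - Re (kf (kk a) (X n) (X n))) \<longlongrightarrow>
      Re (kf (kk s) (X n) (X n)) - Re (kf (kk s) (X n) (X n))) (op_net H0 D)"
    by (intro tendsto_intros kf_kk_tendsto D s)
  \<comment> \<open>The threshold \<open>r / 4\<close> gives \<open>2 q y < r / 2\<close>, and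
    \<open>n\<close> was chosen for \<open>2 q (x - y) < r / 2\<close>; together they stay below
    \<open>r\<close>.\<close>
  then have "\<forall>\<^sub>F a in op_net H0 D. Re (kf (kk s) (X n) (X n)) - Re (kf (kk a) (X n) (X n)) < r / 4"
    using r by (intro order_tendstoD(2)[where y = 0]) simp_all
  with eventually_op_net_above[OF D a0]
  show "\<forall>\<^sub>F a in op_net H0 D. dist (qf Hs (rep a) x) (qf Hs (rep s) x) < r"
  proof eventually_elim
    case (elim a)
    then have a: "a \<in> D" "op_le H0 a0 a" "a \<in> M" using DM by auto
    define T where "T = rep (op_diff H0 s a)"
    have T: "T \<in> bounded_ops Hs Hs" using a s(1) by (simp add: T_def rep_in)
    note [simp] = bounded_ops_in[OF T] bounded_ops_add[OF T] bounded_ops_smult[OF T]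
    have Tq: "qf Hs T v = qf Hs (rep s) v - qf Hs (rep a) v" if "v \<in> carrier Hs" for v
      unfolding T_def by (rule rep_diff[OF a(3) s(1) that])
    have T0: "0 \<le> qf Hs T v" if "v \<in> carrier Hs" for v
      using Tq[OF that] rep_mono[OF a(3) s(1) le[OF a(1)] that] by simp
    have Td: "qf Hs T v \<le> qf Hs d v" if "v \<in> carrier Hs" for v
      using Tq[OF that] rep_mono[OF DM[OF a0] a(3,2) that] rep_diff[OF DM[OF a0] s(1) that] by (simp add: d_def)
    define u where "u = y \<oplus>\<^bsub>Hs\<^esub> (- 1) \<odot>\<^bsub>Hs\<^esub> x"
    have u: "u \<in> carrier Hs" using x y by (simp add: u_def)
    have x_eq: "x = y \<oplus>\<^bsub>Hs\<^esub> (- 1) \<odot>\<^bsub>Hs\<^esub> u" by (rule K.vec_eqI) (use x y in \<open>simp_all add: u_def\<close>)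
    have "qf Hs T (y \<oplus>\<^bsub>Hs\<^esub> (- 1) \<odot>\<^bsub>Hs\<^esub> u) + qf Hs T (y \<oplus>\<^bsub>Hs\<^esub> u) = 2 * qf Hs T y + 2 * qf Hs T u"
      using y u by (simp add: qf_def)
    moreover have "0 \<le> qf Hs T (y \<oplus>\<^bsub>Hs\<^esub> u)" using T0 y u by simp
    ultimately have "qf Hs T x \<le> 2 * qf Hs T y + 2 * qf Hs T u" unfolding x_eq[symmetric] by simp
    moreover have "qf Hs T y < r / 4" using elim(2) Tq[OF y] yq s(1) a(3) by simp
    moreover have "hnorm Hs u = hnorm Hs (y \<ominus>\<^bsub>Hs\<^esub> x)"
    proof -
      have "u = y \<ominus>\<^bsub>Hs\<^esub> x" by (rule K.vec_eqI) (use x y in \<open>simp_all add: u_def\<close>)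
      then show ?thesis by simp
    qed
    then have "2 * qf Hs T u < r / 2" using Td[OF u] dq[OF u] n by (simp add: y_def)
    ultimately have "qf Hs T x < r" by simp
    then show ?case using Tq[OF x] T0[OF x] by (simp add: dist_real_def)
  qed
qed

lemma rep_normal: "normal_map H0 M Hs (bounded_ops Hs Hs) rep"
proof (rule normal_mapI[OF vna vna_bounded_ops[OF Hs] rep_in rep_self_adjoint])
  show "op_le Hs (rep a) (rep b)" if "a \<in> M" "b \<in> M" "self_adjoint H0 a" "self_adjoint H0 b" "op_le H0 a b" for a b
    using that by (simp add: op_le_iff[OF Hs] rep_self_adjoint rep_mono)
  fix D s x assume D: "directed_in H0 M D" and s: "s \<in> M" "weak_lim H0 D s" and x: "x \<in> carrier Hs"
  have ssa: "self_adjoint H0 s" by (rule weak_lim_self_adjoint[OF Hh D M_in[OF s(1)] s(2)])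
  have "((\<lambda>a. complex_of_real (qf Hs (rep a) x)) \<longlongrightarrow> of_real (qf Hs (rep s) x)) (op_net H0 D)"
    by (intro tendsto_of_real rep_qf_tendsto D s x)
  moreover have "\<forall>\<^sub>F a in op_net H0 D. complex_of_real (qf Hs (rep a) x) = ip Hs x (rep a x)"
    using eventually_op_net_in[OF D] by (rule eventually_mono)
      (simp add: self_adjoint_qf[OF Hs rep_self_adjoint[OF directed_inD[OF D]] x])
  ultimately show "((\<lambda>a. ip Hs x (rep a x)) \<longlongrightarrow> ip Hs x (rep s x)) (op_net H0 D)"
    unfolding self_adjoint_qf[OF Hs rep_self_adjoint[OF s(1) ssa] x] by (rule Lim_transform_eventually)
qed

text \<open>Vectors with the empty list span level 0, where the kernel is the inner product of
  \<open>H0\<close> and \<open>rep a\<close> acts as \<open>a\<close>.\<close>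

lemma isometric_intertwiner:
  obtains J where "isometric H0 Hs J" "\<And>a x. \<lbrakk>a \<in> M; x \<in> carrier H0\<rbrakk> \<Longrightarrow> J (a x) = rep a (J x)"
proof -
  define c where "c h = (if h \<in> carrier H0 then h else \<zero>\<^bsub>H0\<^esub>)" for h
  have c: "c h \<in> carrier H0" for h by (simp add: c_def)
  have total: "total_family H0 c"
    unfolding total_family_def
  proof (intro conjI ballI impI allI c)
    fix x assume x: "x \<in> carrier H0" and "\<forall>i. ip H0 (c i) x = 0"
    then have "ip H0 x x = 0" by (metis c_def)
    then show "x = \<zero>\<^bsub>H0\<^esub>" using x by (intro H0.ip_definite)
  qed
  have gram: "ip Hs (e ([], c h)) (e ([], c g)) = ip H0 (c h) (c g)" for h g
    using c by (simp add: e_ip kk_def valid_def)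
  obtain J where J: "isometric H0 Hs J" "\<And>h. J (c h) = e ([], c h)"
    by (rule isometric_extension[OF Hh Hs total e_in gram]) blast
  have Jx: "J x = e ([], x)" if "x \<in> carrier H0" for x using J(2)[of x] that by (simp add: c_def)
  have "J (a x) = rep a (J x)" if "a \<in> M" "x \<in> carrier H0" for a x
    using that by (simp add: Jx rep_e act_def valid_def)
  then show thesis using that J(1) by blast
qed

text \<open>\<open>kk_shift\<close> does both tasks: at the identity, with \<open>\<Phi>\<close>
  unital, it makes the shift isometric, and at \<open>a\<close> it says that the compression of
  \<open>rep a\<close> has the matrix coefficients of \<open>rep (\<Phi> a)\<close>.\<close>

lemma implementing_isometry:
  obtains V where "isometric Hs Hs V" "\<And>a. a \<in> M \<Longrightarrow> compress_op Hs Hs V (rep a) = rep (\<Phi> a)"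
proof -
  have gram: "ip Hs (e (shift i)) (e (shift j)) = ip Hs (e i) (e j)" for i j
    by (simp add: e_ip kk_shift unital)
  obtain V where V: "isometric Hs Hs V" "\<And>i. V (e i) = e (shift i)"
    by (rule isometric_extension[OF Hs Hs e_total e_in gram]) blast
  have "compress_op Hs Hs V (rep a) = rep (\<Phi> a)" if a: "a \<in> M" for a
    by (rule op_eqI_e[OF compress_op_in[OF Hs Hs isometric_in[OF V(1)] rep_in[OF a]] rep_in[OF \<Phi>_in[OF a]]])
      (simp add: compress_ip[OF Hs Hs isometric_in[OF V(1)] rep_in[OF a]] V(2) rep_kk a kk_shift)
  then show thesis using that V(1) by blast
qed

end

theorem mainTheorem5:
  fixes H0 :: "'a hilbert" and M :: "('a \<Rightarrow> 'a) set"
    and \<Phi> :: "('a \<Rightarrow> 'a) \<Rightarrow> ('a \<Rightarrow> 'a)"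
  assumes "quantum_process H0 M \<Phi>"
  shows "\<exists>(H :: 'a large hilbert) \<pi> \<Psi>.
    faithful_normal_representation H0 M H \<pi> \<and>
    (\<forall>x\<in>M. \<Psi> (\<pi> x) = \<pi> (\<Phi> x)) \<and>
    quantum_process H (\<pi> ` M) \<Psi> \<and>
    (\<exists>R \<Theta> (K :: 'a large hilbert) z. dilation H (\<pi> ` M) \<Psi> R \<Theta> K z)"
proof -
  interpret S: stinespring H0 M \<Phi>
    using assms vna_hilbert[of H0 M]
    by (intro stinespring.intro stinespring_axioms.intro) (auto simp: quantum_process_def)
  interpret N: normal_rep H0 S.Hs M S.rep
    by (intro normal_rep.intro normal_rep_axioms.intro S.Hh S.Hs S.vna S.rep_star_hom S.rep_one S.rep_normal)
  obtain J where J: "isometric H0 S.Hs J" "\<And>a x. \<lbrakk>a \<in> M; x \<in> carrier H0\<rbrakk> \<Longrightarrow> J (a x) = S.rep a (J x)"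
    using S.isometric_intertwiner by blast
  have vna: "von_neumann_algebra S.Hs (S.rep ` M)"
    by (rule N.image_vna[OF isometric_in[OF J(1)] isometric_ip[OF J(1)] J(2)])
  obtain V where V: "isometric S.Hs S.Hs V" and V\<Phi>: "\<And>a. a \<in> M \<Longrightarrow> compress_op S.Hs S.Hs V (S.rep a) = S.rep (\<Phi> a)"
    using S.implementing_isometry by blast
  \<comment> \<open>Compression by \<open>V\<close> thus maps the represented algebra into itself
    and serves as the witness for \<open>\<Psi>\<close>.\<close>
  have inv: "compress_op S.Hs S.Hs V X \<in> S.rep ` M" if "X \<in> S.rep ` M" for X
    using that V\<Phi> S.\<Phi>_in by auto
  \<comment> \<open>Lists form an infinite type even over a finite \<open>'a\<close>; this is the
    condition on the index type in \<open>unitary_extension\<close>.\<close>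
  have inf: "infinite (UNIV :: (('a \<Rightarrow> 'a) list \<times> 'a) set)"
    using infinite_UNIV_listI[where 'a = "'a \<Rightarrow> 'a"] by (simp add: finite_prod)
  obtain K :: "'a large hilbert" and z U where K: "hilbert_space K" and z: "isometric S.Hs K z" and U: "unitary K U"
    and Uz: "\<And>x. x \<in> carrier S.Hs \<Longrightarrow> U (z x) = z (V x)"
    using unitary_extension[OF S.Hs S.e_total V inf] by blast
  interpret D: isometric_process S.Hs K "S.rep ` M" V z U
    by (intro isometric_process.intro isometric_process_axioms.intro S.Hs K vna V inv z U Uz)
  have "faithful_normal_representation H0 M S.Hs S.rep"
    unfolding faithful_normal_representation_def
    using S.Hs S.rep_star_hom S.rep_one S.rep_inj S.rep_normal by blast
  moreover have "\<forall>x\<in>M. compress_op S.Hs S.Hs V (S.rep x) = S.rep (\<Phi> x)" using V\<Phi> by blast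
  moreover have "quantum_process S.Hs (S.rep ` M) (compress_op S.Hs S.Hs V)"
    by (rule conjugation_quantum_process[OF S.Hs vna V inv])
  ultimately show ?thesis using D.is_dilation by blast
qed

end
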